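(* Let $d\ge2$. The axiom (E1) for $d$-exact categories is redundant. That is, if $\mathcal{N}$ is an additive category and $\mathcal{X}$ is a class of $d$-exact sequences in $\mathcal{N}$ which is closed under weak isomorphisms and satisfies axioms (E0), (E1)$^{\rm op}$, (E2) and (E2)$^{\rm op}$, then $\mathcal{X}$ also satisfies (E1): $\mathcal{X}$-admissible monomorphisms are closed under composition.
   Context: Let $\mathcal{N}$ be an additive category. A complex $X_{d+1}\to\cdots\to X_0$ in $\mathcal{N}$ is left $d$-exact if $0\to\operatorname{Hom}(X,X_{d+1})\to\cdots\to\operatorname{Hom}(X,X_0)$ is exact for all $X\in\mathcal{N}$, right $d$-exact if $0\to\operatorname{Hom}(X_0,X)\to\cdots\to\operatorname{Hom}(X_{d+1},X)$ is exact for all $X\in\mathcal{N}$, and $d$-exact if both. A morphism $h_\bullet\colon X_\bullet\to Y_\bullet$ of $d$-exact sequences is a morphism of complexes; it is a weak isomorphism if for some $0\le i\le d+1$ both $h_i$ and $h_{i+1}$ are isomorphisms (with $h_{d+2}:=h_0$). Closure of $\mathcal{X}$ under weak isomorphisms means: if there is a weak isomorphism between two $d$-exact sequences, one of which lies in $\mathcal{X}$, then so does the other. Members of $\mathcal{X}$ are called $\mathcal{X}$-admissible $d$-exact sequences; for such $X_{d+1}\to X_d\to\cdots\to X_1\to X_0$, the morphism $X_{d+1}\to X_d$ is called an $\mathcal{X}$-admissible monomorphism and $X_1\to X_0$ an $\mathcal{X}$-admissible epimorphism. A $d$-pushout of a complex $Y_d\to\cdots\to Y_0$ along $f\colon Y_d\to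 Z_d$ is a morphism of complexes $f_\bullet\colon Y_\bullet\to Z_\bullet$, $Z_\bullet=(Z_d\to\cdots\to Z_0)$, with $f_d=f$ whose mapping cone $Y_d\to Y_{d-1}\oplus Z_d\to\cdots\to Y_0\oplus Z_1\to Z_0$ is right $d$-exact. A $d$-pullback of $Y_\bullet$ along $g\colon X_0\to Y_0$ is a morphism of complexes $g_\bullet\colon X_\bullet\to Y_\bullet$, $X_\bullet=(X_d\to\cdots\to X_0)$, with $g_0=g$ whose mapping cone $X_d\to X_{d-1}\oplus Y_d\to\cdots\to X_0\oplus Y_1\to Y_0$ is left $d$-exact. Axioms: (E0) the sequence $0\to0\to\cdots\to0$ with $d+2$ terms is in $\mathcal{X}$. (E1) $\mathcal{X}$-admissible monomorphisms are closed under composition. (E1)$^{\rm op}$ $\mathcal{X}$-admissible epimorphisms are closed under composition. (E2) Given an $\mathcal{X}$-admissible $d$-exact sequence $Y_{d+1}\to\cdots\to Y_0$ and a morphism $Y_{d+1}\to Z_{d+1}$, there is a $d$-pushout $Z_{d+1}\to\cdots\to Z_1$ of $Y_{d+1}\to\cdots\to Y_1$ along it with $Z_{d+1}\to Z_d$ an $\mathcal{X}$-admissible monomorphism. (E2)$^{\rm op}$ Given an $\mathcal{X}$-admissible $d$-exact sequence $Y_{d+1}\to\cdots\to Y_0$ and a morphism $X_0\to Y_0$, there is a $d$-pullback $X_d\to\cdots\to X_0$ of $Y_d\to\cdots\to Y_0$ along it with $X_1\to X_0$ an $\mathcal{X}$-admissible epimorphism. A $d$-exact category is an additive category with a class $\mathcal{X}$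 of $d$-exact sequences, closed under weak isomorphisms, satisfying (E0), (E1), (E1)$^{\rm op}$, (E2), (E2)$^{\rm op}$. *)

theory Defs
  imports "HOL-Algebra.Coset"
begin

section \<open>Additive categories\<close>

text \<open>
  An arrow determines its source and target, so the hom-sets are disjoint, and a single total
  operation on arrows serves as the addition of all hom-groups. All operations are only
  constrained on arrows (and composable or parallel pairs of arrows).
\<close>

record ('o, 'm) cat_data =
  objs :: "'o set"
  arrs :: "'m set"
  src :: "'m \<Rightarrow> 'o"
  tgt :: "'m \<Rightarrow> 'o"
  ident :: "'o \<Rightarrow> 'm"
  cmp :: "'m \<Rightarrow> 'm \<Rightarrow> 'm"  (infixl "\<cdot>\<index>" 70)
  plus_arr :: "'m \<Rightarrow> 'm \<Rightarrow> 'm"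
  zero_arr :: "'o \<Rightarrow> 'o \<Rightarrow> 'm"

definition hom_set :: "('o, 'm) cat_data \<Rightarrow> 'o \<Rightarrow> 'o \<Rightarrow> 'm set" where
  "hom_set C A B = {f \<in> arrs C. src C f = A \<and> tgt C f = B}"

text \<open>The abelian group of arrows from A to B, written multiplicatively as a HOL-Algebra
  monoid.\<close>

definition hom_group :: "('o, 'm) cat_data \<Rightarrow> 'o \<Rightarrow> 'o \<Rightarrow> 'm monoid" where
  "hom_group C A B =
     \<lparr>carrier = hom_set C A B, monoid.mult = plus_arr C, one = zero_arr C A B\<rparr>"

definition neg_arr :: "('o, 'm) cat_data \<Rightarrow> 'm \<Rightarrow> 'm" where
  "neg_arr C f = m_inv (hom_group C (src C f) (tgt C f)) f"

locale category =
  fixes C :: "('o, 'm) cat_data" (structure)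
  assumes src_in_objs: "f \<in> arrs C \<Longrightarrow> src C f \<in> objs C"
    and tgt_in_objs: "f \<in> arrs C \<Longrightarrow> tgt C f \<in> objs C"
    and ident_in_hom: "A \<in> objs C \<Longrightarrow> ident C A \<in> hom_set C A A"
    and cmp_in_hom: "\<lbrakk>f \<in> hom_set C A B; g \<in> hom_set C B D\<rbrakk> \<Longrightarrow> g \<cdot> f \<in> hom_set C A D"
    and cmp_assoc: "\<lbrakk>f \<in> hom_set C A B; g \<in> hom_set C B D; h \<in> hom_set C D E\<rbrakk>
          \<Longrightarrow> h \<cdot> (g \<cdot> f) = (h \<cdot> g) \<cdot> f"
    and cmp_ident_right: "f \<in> hom_set C A B \<Longrightarrow> f \<cdot> ident C A = f"
    and cmp_ident_left: "f \<in> hom_set C A B \<Longrightarrow> ident C B \<cdot> f = f"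

locale preadditive_category = category +
  assumes hom_comm_group:
      "\<lbrakk>A \<in> objs C; B \<in> objs C\<rbrakk> \<Longrightarrow> comm_group (hom_group C A B)"
    and cmp_plus_right: "\<lbrakk>f \<in> hom_set C A B; f' \<in> hom_set C A B; g \<in> hom_set C B D\<rbrakk>
          \<Longrightarrow> g \<cdot> plus_arr C f f' = plus_arr C (g \<cdot> f) (g \<cdot> f')"
    and cmp_plus_left: "\<lbrakk>f \<in> hom_set C A B; g \<in> hom_set C B D; g' \<in> hom_set C B D\<rbrakk>
          \<Longrightarrow> plus_arr C g g' \<cdot> f = plus_arr C (g \<cdot> f) (g' \<cdot> f)"

definition zero_object :: "('o, 'm) cat_data \<Rightarrow> 'o \<Rightarrow> bool" where
  "zero_object C Z \<longleftrightarrow> Z \<in> objs C \<and>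
     (\<forall>A \<in> objs C. (\<exists>!f. f \<in> hom_set C Z A) \<and> (\<exists>!f. f \<in> hom_set C A Z))"

record ('o, 'm) biproduct_data =
  bip_obj :: 'o
  inj1 :: 'm
  inj2 :: 'm
  proj1 :: 'm
  proj2 :: 'm

definition is_biproduct ::
    "('o, 'm) cat_data \<Rightarrow> 'o \<Rightarrow> 'o \<Rightarrow> ('o, 'm) biproduct_data \<Rightarrow> bool" where
  "is_biproduct C A B P \<longleftrightarrow>
     bip_obj P \<in> objs C \<and>
     inj1 P \<in> hom_set C A (bip_obj P) \<and> inj2 P \<in> hom_set C B (bip_obj P) \<and>
     proj1 P \<in> hom_set C (bip_obj P) A \<and> proj2 P \<in> hom_set C (bip_obj P) B \<and>
     proj1 P \<cdot>\<^bsub>C\<^esub> inj1 P = ident C A \<and>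
     proj2 P \<cdot>\<^bsub>C\<^esub> inj2 P = ident C B \<and>
     proj2 P \<cdot>\<^bsub>C\<^esub> inj1 P = zero_arr C A B \<and>
     proj1 P \<cdot>\<^bsub>C\<^esub> inj2 P = zero_arr C B A \<and>
     plus_arr C (inj1 P \<cdot>\<^bsub>C\<^esub> proj1 P) (inj2 P \<cdot>\<^bsub>C\<^esub> proj2 P) = ident C (bip_obj P)"

locale additive_category = preadditive_category +
  assumes zero_object_exists: "\<exists>Z. zero_object C Z"
    and biproduct_exists: "\<lbrakk>A \<in> objs C; B \<in> objs C\<rbrakk> \<Longrightarrow> \<exists>P. is_biproduct C A B P"

text \<open>A choice of biproducts. They are unique up to isomorphism, so the exactness of mapping
  cones below does not depend on the choice.\<close>

definition biproduct :: "('o, 'm) cat_data \<Rightarrow> 'o \<Rightarrow> 'o \<Rightarrow> ('o, 'm) biproduct_data" where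
  "biproduct C A B = (SOME P. is_biproduct C A B P)"

definition is_iso :: "('o, 'm) cat_data \<Rightarrow> 'm \<Rightarrow> bool" where
  "is_iso C f \<longleftrightarrow> f \<in> arrs C \<and>
     (\<exists>g \<in> hom_set C (tgt C f) (src C f).
        g \<cdot>\<^bsub>C\<^esub> f = ident C (src C f) \<and> f \<cdot>\<^bsub>C\<^esub> g = ident C (tgt C f))"


section \<open>Complexes and d-exact sequences\<close>

text \<open>
  A sequence with terms \<open>n, \<dots>, 0\<close> is given by its objects \<open>trm S i\<close> for \<open>i \<le> n\<close> and its
  arrows \<open>diff S i\<close> from term \<open>i + 1\<close> to term \<open>i\<close> for \<open>i < n\<close>. Values at larger indices are
  irrelevant, and every notion below ignores them. In particular, the identity is a weak
  isomorphism between two representations of one d-exact sequence, so that a set closed under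
  weak isomorphisms contains either all representations or none.
\<close>

record ('o, 'm) sequence =
  trm :: "nat \<Rightarrow> 'o"
  diff :: "nat \<Rightarrow> 'm"

definition complex :: "('o, 'm) cat_data \<Rightarrow> nat \<Rightarrow> ('o, 'm) sequence \<Rightarrow> bool" where
  "complex C n S \<longleftrightarrow>
     (\<forall>i \<le> n. trm S i \<in> objs C) \<and>
     (\<forall>i < n. diff S i \<in> hom_set C (trm S (Suc i)) (trm S i)) \<and>
     (\<forall>i. Suc i < n \<longrightarrow>
        diff S i \<cdot>\<^bsub>C\<^esub> diff S (Suc i) = zero_arr C (trm S (Suc (Suc i))) (trm S i))"

definition complex_morphism ::
    "('o, 'm) cat_data \<Rightarrow> nat \<Rightarrow> ('o, 'm) sequence \<Rightarrow> ('o, 'm) sequence \<Rightarrow> (nat \<Rightarrow> 'm) \<Rightarrow> bool"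
  where
  "complex_morphism C n S T h \<longleftrightarrow>
     complex C n S \<and> complex C n T \<and>
     (\<forall>i \<le> n. h i \<in> hom_set C (trm S i) (trm T i)) \<and>
     (\<forall>i < n. h i \<cdot>\<^bsub>C\<^esub> diff S i = diff T i \<cdot>\<^bsub>C\<^esub> h (Suc i))"

text \<open>Exactness of \<open>0 \<rightarrow> Hom(W, S\<^sub>d\<^sub>+\<^sub>1) \<rightarrow> \<dots> \<rightarrow> Hom(W, S\<^sub>0)\<close>, with nothing required at the last term;
  dually for the right-hand version.\<close>

definition left_d_exact :: "('o, 'm) cat_data \<Rightarrow> nat \<Rightarrow> ('o, 'm) sequence \<Rightarrow> bool" where
  "left_d_exact C d S \<longleftrightarrow> complex C (d + 1) S \<and>
     (\<forall>W \<in> objs C.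
        kernel (hom_group C W (trm S (d + 1))) (hom_group C W (trm S d))
            (\<lambda>f. diff S d \<cdot>\<^bsub>C\<^esub> f)
          = {zero_arr C W (trm S (d + 1))} \<and>
        (\<forall>i < d.
           kernel (hom_group C W (trm S (i + 1))) (hom_group C W (trm S i))
               (\<lambda>f. diff S i \<cdot>\<^bsub>C\<^esub> f)
             = (\<lambda>f. diff S (i + 1) \<cdot>\<^bsub>C\<^esub> f) ` hom_set C W (trm S (i + 2))))"

definition right_d_exact :: "('o, 'm) cat_data \<Rightarrow> nat \<Rightarrow> ('o, 'm) sequence \<Rightarrow> bool" where
  "right_d_exact C d S \<longleftrightarrow> complex C (d + 1) S \<and>
     (\<forall>W \<in> objs C.
        kernel (hom_group C (trm S 0) W) (hom_group C (trm S 1) W)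
            (\<lambda>f. f \<cdot>\<^bsub>C\<^esub> diff S 0)
          = {zero_arr C (trm S 0) W} \<and>
        (\<forall>i < d.
           kernel (hom_group C (trm S (i + 1)) W) (hom_group C (trm S (i + 2)) W)
               (\<lambda>f. f \<cdot>\<^bsub>C\<^esub> diff S (i + 1))
             = (\<lambda>f. f \<cdot>\<^bsub>C\<^esub> diff S i) ` hom_set C (trm S i) W))"

definition d_exact :: "('o, 'm) cat_data \<Rightarrow> nat \<Rightarrow> ('o, 'm) sequence \<Rightarrow> bool" where
  "d_exact C d S \<longleftrightarrow> left_d_exact C d S \<and> right_d_exact C d S"

definition weak_isomorphism ::
    "('o, 'm) cat_data \<Rightarrow> nat \<Rightarrow> ('o, 'm) sequence \<Rightarrow> ('o, 'm) sequence \<Rightarrow> (nat \<Rightarrow> 'm) \<Rightarrow> bool"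
  where
  "weak_isomorphism C d S T h \<longleftrightarrow>
     d_exact C d S \<and> d_exact C d T \<and> complex_morphism C (d + 1) S T h \<and>
     (\<exists>i \<le> d + 1. is_iso C (h i) \<and> is_iso C (h ((i + 1) mod (d + 2))))"

definition closed_under_weak_isomorphisms ::
    "('o, 'm) cat_data \<Rightarrow> nat \<Rightarrow> ('o, 'm) sequence set \<Rightarrow> bool" where
  "closed_under_weak_isomorphisms C d X \<longleftrightarrow>
     (\<forall>S T h. weak_isomorphism C d S T h \<longrightarrow> (S \<in> X \<longleftrightarrow> T \<in> X))"


section \<open>Mapping cones, d-pushouts and d-pullbacks\<close>

text \<open>
  For a morphism \<open>h\<close> from \<open>S\<^sub>d \<rightarrow> \<dots> \<rightarrow> S\<^sub>0\<close> to \<open>T\<^sub>d \<rightarrow> \<dots> \<rightarrow> T\<^sub>0\<close> with \<open>d \<ge> 1\<close>, the cone is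
  \<open>S\<^sub>d \<rightarrow> S\<^sub>d\<^sub>-\<^sub>1 \<oplus> T\<^sub>d \<rightarrow> \<dots> \<rightarrow> S\<^sub>0 \<oplus> T\<^sub>1 \<rightarrow> T\<^sub>0\<close>. Its middle arrows send \<open>(s, t)\<close> to
  \<open>(- diff s, h s + diff t)\<close>; at the two ends the missing component is left out.
\<close>

definition mapping_cone ::
    "('o, 'm) cat_data \<Rightarrow> nat \<Rightarrow> ('o, 'm) sequence \<Rightarrow> ('o, 'm) sequence \<Rightarrow> (nat \<Rightarrow> 'm)
      \<Rightarrow> ('o, 'm) sequence" where
  "mapping_cone C d S T h =
     (let P = (\<lambda>i. biproduct C (trm S (i - 1)) (trm T i)) in
      \<lparr>trm = (\<lambda>i. if i = 0 then trm T 0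
                   else if i = d + 1 then trm S d
                   else bip_obj (P i)),
       diff = (\<lambda>i. if i = 0 then
                     plus_arr C (h 0 \<cdot>\<^bsub>C\<^esub> proj1 (P 1)) (diff T 0 \<cdot>\<^bsub>C\<^esub> proj2 (P 1))
                   else if i = d then
                     plus_arr C (inj1 (P d) \<cdot>\<^bsub>C\<^esub> neg_arr C (diff S (d - 1)))
                                (inj2 (P d) \<cdot>\<^bsub>C\<^esub> h d)
                   else
                     plus_arr C
                       (inj1 (P i) \<cdot>\<^bsub>C\<^esub> (neg_arr C (diff S (i - 1)) \<cdot>\<^bsub>C\<^esub> proj1 (P (i + 1))))
                       (inj2 (P i) \<cdot>\<^bsub>C\<^esub>
                          plus_arr C (h i \<cdot>\<^bsub>C\<^esub> proj1 (P (i + 1)))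
                                     (diff T i \<cdot>\<^bsub>C\<^esub> proj2 (P (i + 1)))))\<rparr>)"

definition is_d_pushout ::
    "('o, 'm) cat_data \<Rightarrow> nat \<Rightarrow> ('o, 'm) sequence \<Rightarrow> 'm \<Rightarrow> ('o, 'm) sequence \<Rightarrow> (nat \<Rightarrow> 'm) \<Rightarrow> bool"
  where
  "is_d_pushout C d Y f Z h \<longleftrightarrow>
     complex_morphism C d Y Z h \<and> h d = f \<and> right_d_exact C d (mapping_cone C d Y Z h)"

definition is_d_pullback ::
    "('o, 'm) cat_data \<Rightarrow> nat \<Rightarrow> ('o, 'm) sequence \<Rightarrow> 'm \<Rightarrow> ('o, 'm) sequence \<Rightarrow> (nat \<Rightarrow> 'm) \<Rightarrow> bool"
  where
  "is_d_pullback C d Y g X h \<longleftrightarrow>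
     complex_morphism C d X Y h \<and> h 0 = g \<and> left_d_exact C d (mapping_cone C d X Y h)"


section \<open>The axioms of d-exact categories\<close>

definition admissible_mono :: "nat \<Rightarrow> ('o, 'm) sequence set \<Rightarrow> 'm \<Rightarrow> bool" where
  "admissible_mono d X f \<longleftrightarrow> (\<exists>S \<in> X. f = diff S d)"

definition admissible_epi :: "('o, 'm) sequence set \<Rightarrow> 'm \<Rightarrow> bool" where
  "admissible_epi X f \<longleftrightarrow> (\<exists>S \<in> X. f = diff S 0)"

definition axiom_E0 :: "('o, 'm) cat_data \<Rightarrow> ('o, 'm) sequence set \<Rightarrow> bool" where
  "axiom_E0 C X \<longleftrightarrow>
     (\<exists>Z. zero_object C Z \<and> \<lparr>trm = (\<lambda>_. Z), diff = (\<lambda>_. zero_arr C Z Z)\<rparr> \<in> X)"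

definition axiom_E1 :: "('o, 'm) cat_data \<Rightarrow> nat \<Rightarrow> ('o, 'm) sequence set \<Rightarrow> bool" where
  "axiom_E1 C d X \<longleftrightarrow>
     (\<forall>f g. admissible_mono d X f \<longrightarrow> admissible_mono d X g \<longrightarrow> tgt C f = src C g \<longrightarrow>
        admissible_mono d X (g \<cdot>\<^bsub>C\<^esub> f))"

definition axiom_E1op :: "('o, 'm) cat_data \<Rightarrow> ('o, 'm) sequence set \<Rightarrow> bool" where
  "axiom_E1op C X \<longleftrightarrow>
     (\<forall>f g. admissible_epi X f \<longrightarrow> admissible_epi X g \<longrightarrow> tgt C f = src C g \<longrightarrow>
        admissible_epi X (g \<cdot>\<^bsub>C\<^esub> f))"

text \<open>The truncation \<open>S\<^sub>d\<^sub>+\<^sub>1 \<rightarrow> \<dots> \<rightarrow> S\<^sub>1\<close>, reindexed by \<open>d, \<dots>, 0\<close>. The other truncation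
  \<open>S\<^sub>d \<rightarrow> \<dots> \<rightarrow> S\<^sub>0\<close> is represented by \<open>S\<close> itself.\<close>

definition drop_term0 :: "('o, 'm) sequence \<Rightarrow> ('o, 'm) sequence" where
  "drop_term0 S = \<lparr>trm = (\<lambda>i. trm S (i + 1)), diff = (\<lambda>i. diff S (i + 1))\<rparr>"

text \<open>In (E2) the pushout \<open>Z\<^sub>d\<^sub>+\<^sub>1 \<rightarrow> \<dots> \<rightarrow> Z\<^sub>1\<close> is likewise reindexed by \<open>d, \<dots>, 0\<close>, so its leftmost
  arrow is \<open>diff Z (d - 1)\<close>.\<close>

definition axiom_E2 :: "('o, 'm) cat_data \<Rightarrow> nat \<Rightarrow> ('o, 'm) sequence set \<Rightarrow> bool" where
  "axiom_E2 C d X \<longleftrightarrow>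
     (\<forall>Y \<in> X. \<forall>f \<in> arrs C. src C f = trm Y (d + 1) \<longrightarrow>
        (\<exists>Z h. is_d_pushout C d (drop_term0 Y) f Z h \<and> admissible_mono d X (diff Z (d - 1))))"

definition axiom_E2op :: "('o, 'm) cat_data \<Rightarrow> nat \<Rightarrow> ('o, 'm) sequence set \<Rightarrow> bool" where
  "axiom_E2op C d X \<longleftrightarrow>
     (\<forall>Y \<in> X. \<forall>g \<in> arrs C. tgt C g = trm Y 0 \<longrightarrow>
        (\<exists>W h. is_d_pullback C d Y g W h \<and> admissible_epi X (diff W 0)))"

end

theory Submission
  imports Defs
begin

text \<open>
  Let \<open>A \<rightarrow> B \<rightarrow> S\<^sub>d\<^sub>-\<^sub>1 \<rightarrow> \<dots> \<rightarrow> S\<^sub>0\<close> and \<open>B \<rightarrow> T\<^sub>d \<rightarrow> \<dots> \<rightarrow> T\<^sub>0\<close> be admissible. Pushing \<open>T\<close> out along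
  \<open>B \<rightarrow> S\<^sub>d\<^sub>-\<^sub>1\<close> gives an admissible sequence \<open>Z\<close> with \<open>Z\<^sub>0 = T\<^sub>0\<close>. The cone
  \<open>P = (B \<rightarrow> T\<^sub>d \<oplus> S\<^sub>d\<^sub>-\<^sub>1 \<rightarrow> T\<^sub>d\<^sub>-\<^sub>1 \<oplus> Z\<^sub>d \<rightarrow> \<dots> \<rightarrow> T\<^sub>1 \<oplus> Z\<^sub>2 \<rightarrow> Z\<^sub>1)\<close> is again admissible: it is
  left d-exact, and its last arrow factors through the admissible epimorphism obtained by pulling
  \<open>T\<close> back along \<open>Z\<^sub>1 \<rightarrow> T\<^sub>0\<close>, and conversely. Such a mutual factorization suffices because, after
  adding contractible summands in degrees 1 and 2 (which changes neither end of the sequence), both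
  sequences end in the same epimorphism. The projection \<open>T\<^sub>d \<oplus> S\<^sub>d\<^sub>-\<^sub>1 \<rightarrow> S\<^sub>d\<^sub>-\<^sub>1\<close> extends to a morphism
  \<open>\<phi>\<close> from \<open>P\<close> to \<open>S\<close> of degree \<open>-1\<close>, and the cone of \<open>\<phi>\<close>, after cancelling isomorphic summands, is a
  left d-exact sequence \<open>A \<rightarrow> T\<^sub>d \<rightarrow> P\<^sub>d\<^sub>-\<^sub>1 \<rightarrow> P\<^sub>d\<^sub>-\<^sub>2 \<oplus> S\<^sub>d\<^sub>-\<^sub>2 \<rightarrow> \<dots> \<rightarrow> P\<^sub>0 \<oplus> S\<^sub>0\<close> starting with the composite.
  Its last arrow and a composite of two admissible epimorphisms factor through each other, so the
  sequence is admissible by (E1)op.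
\<close>

section \<open>Calculus in preadditive categories\<close>

context category
begin

lemma hom_iff [simp]: "f \<in> hom_set C A B \<longleftrightarrow> f \<in> arrs C \<and> src C f = A \<and> tgt C f = B"
  by (auto simp: hom_set_def)

lemmas objs_simps [simp] = src_in_objs tgt_in_objs

lemma ident_simps [simp]:
  assumes "A \<in> objs C"
  shows "ident C A \<in> arrs C" "src C (ident C A) = A" "tgt C (ident C A) = A"
  using ident_in_hom[OF assms] by auto

lemma cmp_simps [simp]:
  assumes "f \<in> arrs C" "g \<in> arrs C" "tgt C f = src C g"
  shows "g \<cdot> f \<in> arrs C" "src C (g \<cdot> f) = src C f" "tgt C (g \<cdot> f) = tgt C g"
  using cmp_in_hom[of f "src C f" "tgt C f" g "tgt C g"] assms by auto

lemma assoc [simp]: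
  assumes "f \<in> arrs C" "g \<in> arrs C" "h \<in> arrs C" "tgt C f = src C g" "tgt C g = src C h"
  shows "(h \<cdot> g) \<cdot> f = h \<cdot> (g \<cdot> f)"
  using cmp_assoc[of f "src C f" "tgt C f" g "tgt C g" h "tgt C h"] assms by auto

lemma cmp_ident [simp]:
  assumes "f \<in> arrs C"
  shows "src C f = A \<Longrightarrow> f \<cdot> ident C A = f" "tgt C f = B \<Longrightarrow> ident C B \<cdot> f = f"
  using cmp_ident_right[of f "src C f" "tgt C f"] cmp_ident_left[of f "src C f" "tgt C f"] assms
  by auto

lemma cmp_reduce:
  assumes "g \<cdot> f = r" "f \<in> arrs C" "g \<in> arrs C" "tgt C f = src C g" "x \<in> arrs C" "tgt C x = src C f"
  shows "g \<cdot> (f \<cdot> x) = r \<cdot> x"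
  using assoc[of x f g] assms by simp

lemma is_iso_ident [simp]: "A \<in> objs C \<Longrightarrow> is_iso C (ident C A)"
  unfolding is_iso_def by (auto intro!: bexI[of _ "ident C A"])

end

section \<open>Hom-group arithmetic and bilinearity of composition\<close>

context preadditive_category
begin

abbreviation add_arr (infixl "\<oplus>" 65) where "f \<oplus> g \<equiv> plus_arr C f g"
abbreviation uminus_arr ("\<ominus> _" [81] 80) where "\<ominus> f \<equiv> neg_arr C f"
abbreviation null ("\<zero>") where "\<zero> \<equiv> zero_arr C"

lemma null_simps [simp]:
  assumes "A \<in> objs C" "B \<in> objs C"
  shows "\<zero> A B \<in> arrs C" "src C (\<zero> A B) = A" "tgt C (\<zero> A B) = B"
proof -
  interpret G: comm_group "hom_group C A B" using hom_comm_group assms by simp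
  show "\<zero> A B \<in> arrs C" "src C (\<zero> A B) = A" "tgt C (\<zero> A B) = B"
    using G.one_closed by (auto simp: hom_group_def)
qed

lemma add_simps [simp]:
  assumes "f \<in> arrs C" "g \<in> arrs C" "src C f = src C g" "tgt C f = tgt C g"
  shows "f \<oplus> g \<in> arrs C" "src C (f \<oplus> g) = src C g" "tgt C (f \<oplus> g) = tgt C g"
proof -
  interpret G: comm_group "hom_group C (src C g) (tgt C g)" using hom_comm_group assms by simp
  show "f \<oplus> g \<in> arrs C" "src C (f \<oplus> g) = src C g" "tgt C (f \<oplus> g) = tgt C g"
    using G.m_closed[of f g] assms by (auto simp: hom_group_def)
qed

lemma neg_simps [simp]:
  assumes "f \<in> arrs C"
  shows "\<ominus> f \<in> arrs C" "src C (\<ominus> f) = src C f" "tgt C (\<ominus> f) = tgt C f"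
proof -
  interpret G: comm_group "hom_group C (src C f) (tgt C f)" using hom_comm_group assms by simp
  have "\<ominus> f \<in> carrier (hom_group C (src C f) (tgt C f))"
    unfolding neg_arr_def by (rule G.inv_closed) (simp add: hom_group_def assms)
  then show "\<ominus> f \<in> arrs C" "src C (\<ominus> f) = src C f" "tgt C (\<ominus> f) = tgt C f"
    by (auto simp: hom_group_def)
qed

lemma add_assoc [simp]:
  assumes "f \<in> arrs C" "g \<in> arrs C" "h \<in> arrs C" "src C f = src C g" "tgt C f = tgt C g"
    "src C g = src C h" "tgt C g = tgt C h"
  shows "(f \<oplus> g) \<oplus> h = f \<oplus> (g \<oplus> h)"
proof -
  interpret G: comm_group "hom_group C (src C f) (tgt C f)" using hom_comm_group assms by simp
  show ?thesis using G.m_assoc[of f g h] assms by (auto simp: hom_group_def)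
qed

lemma add_commute:
  assumes "f \<in> arrs C" "g \<in> arrs C" "src C f = src C g" "tgt C f = tgt C g"
  shows "f \<oplus> g = g \<oplus> f"
proof -
  interpret G: comm_group "hom_group C (src C f) (tgt C f)" using hom_comm_group assms by simp
  show ?thesis using G.m_comm[of f g] assms by (auto simp: hom_group_def)
qed

lemma add_left_commute:
  assumes "f \<in> arrs C" "g \<in> arrs C" "h \<in> arrs C" "src C f = src C g" "tgt C f = tgt C g"
    "src C g = src C h" "tgt C g = tgt C h"
  shows "f \<oplus> (g \<oplus> h) = g \<oplus> (f \<oplus> h)"
  using assms add_assoc[of f g h] add_assoc[of g f h] add_commute[of f g] by simp

lemmas add_ac = add_commute add_left_commute

lemma add_null [simp]:
  assumes "f \<in> arrs C" "src C f = A" "tgt C f = B"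
  shows "f \<oplus> \<zero> A B = f" "\<zero> A B \<oplus> f = f"
proof -
  interpret G: comm_group "hom_group C A B" using hom_comm_group assms by auto
  show "f \<oplus> \<zero> A B = f" "\<zero> A B \<oplus> f = f"
    using G.r_one[of f] G.l_one[of f] assms by (auto simp: hom_group_def)
qed

lemma add_neg [simp]:
  assumes "f \<in> arrs C"
  shows "f \<oplus> \<ominus> f = \<zero> (src C f) (tgt C f)" "\<ominus> f \<oplus> f = \<zero> (src C f) (tgt C f)"
proof -
  interpret G: comm_group "hom_group C (src C f) (tgt C f)" using hom_comm_group assms by simp
  have "f \<in> carrier (hom_group C (src C f) (tgt C f))" by (simp add: hom_group_def assms)
  from G.r_inv[OF this] G.l_inv[OF this]
  show "f \<oplus> \<ominus> f = \<zero> (src C f) (tgt C f)" "\<ominus> f \<oplus> f = \<zero> (src C f) (tgt C f)"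
    unfolding neg_arr_def by (simp_all add: hom_group_def)
qed

lemma add_neg_cancel [simp]:
  assumes "f \<in> arrs C" "g \<in> arrs C" "src C f = src C g" "tgt C f = tgt C g"
  shows "f \<oplus> (\<ominus> f \<oplus> g) = g" "\<ominus> f \<oplus> (f \<oplus> g) = g"
  using assms add_assoc[of f "\<ominus> f" g] add_assoc[of "\<ominus> f" f g] by simp_all

lemma add_left_cancel:
  assumes "f \<in> arrs C" "g \<in> arrs C" "h \<in> arrs C" "src C f = src C g" "tgt C f = tgt C g"
    "src C f = src C h" "tgt C f = tgt C h"
  shows "f \<oplus> g = f \<oplus> h \<longleftrightarrow> g = h"
proof
  assume *: "f \<oplus> g = f \<oplus> h"
  have "g = \<ominus> f \<oplus> (f \<oplus> g)" using add_neg_cancel(2)[of f g] assms(1,2,4,5) by simp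
  also have "\<dots> = h" unfolding * using add_neg_cancel(2)[of f h] assms(1,3,6,7) by simp
  finally show "g = h" .
qed (rule arg_cong)

lemma neg_unique:
  assumes "f \<in> arrs C" "g \<in> arrs C" "src C f = src C g" "tgt C f = tgt C g"
    "f \<oplus> g = \<zero> (src C f) (tgt C f)"
  shows "g = \<ominus> f"
proof -
  have "f \<oplus> g = f \<oplus> \<ominus> f" unfolding assms(5) using assms(1) by simp
  then show ?thesis
    by (rule iffD1[OF add_left_cancel, rotated -1]) (use assms(1-4) in simp_all)
qed

lemma neg_neg [simp]: "f \<in> arrs C \<Longrightarrow> \<ominus> (\<ominus> f) = f"
  by (rule neg_unique[symmetric]) simp_all

lemma diff_eq_null:
  assumes "f \<in> arrs C" "g \<in> arrs C" "src C f = A" "tgt C f = B" "src C g = A" "tgt C g = B"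
  shows "f \<oplus> \<ominus> g = \<zero> A B \<longleftrightarrow> f = g" "\<ominus> f \<oplus> g = \<zero> A B \<longleftrightarrow> f = g"
proof -
  have "f = g" if "\<ominus> f \<oplus> g = \<zero> A B"
  proof -
    have "g = \<ominus> (\<ominus> f)"
      by (rule neg_unique) (use assms that in simp_all)
    then show ?thesis using neg_neg[OF assms(1)] by (rule trans[THEN sym])
  qed
  moreover have "f = g" if "f \<oplus> \<ominus> g = \<zero> A B"
  proof -
    have "\<ominus> g = \<ominus> f"
      by (rule neg_unique) (use assms that in simp_all)
    then have "\<ominus> (\<ominus> g) = \<ominus> (\<ominus> f)" by (rule arg_cong)
    then show ?thesis unfolding neg_neg[OF assms(1)] neg_neg[OF assms(2)] by (rule sym)
  qed
  moreover have "f \<oplus> \<ominus> f = \<zero> A B" "\<ominus> f \<oplus> f = \<zero> A B" using assms by simp_all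
  ultimately show "f \<oplus> \<ominus> g = \<zero> A B \<longleftrightarrow> f = g" "\<ominus> f \<oplus> g = \<zero> A B \<longleftrightarrow> f = g"
    by fast+
qed

lemma cmp_add [simp]:
  assumes "f \<in> arrs C" "f' \<in> arrs C" "src C f = src C f'" "tgt C f = tgt C f'"
    "g \<in> arrs C" "src C g = tgt C f'"
  shows "g \<cdot> (f \<oplus> f') = g \<cdot> f \<oplus> g \<cdot> f'"
  using cmp_plus_right[of f "src C f" "tgt C f" f' g "tgt C g"] assms by simp

lemma add_cmp [simp]:
  assumes "g \<in> arrs C" "g' \<in> arrs C" "src C g = src C g'" "tgt C g = tgt C g'"
    "f \<in> arrs C" "src C g' = tgt C f"
  shows "(g \<oplus> g') \<cdot> f = g \<cdot> f \<oplus> g' \<cdot> f"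
  using cmp_plus_left[of f "src C f" "tgt C f" g "tgt C g" g'] assms by simp

text \<open>The composite is its own double because \<open>\<zero> A B\<close> is; cancelling one
  copy leaves zero.\<close>

lemma cmp_null [simp]:
  assumes "f \<in> arrs C" "A \<in> objs C" "src C f = B"
  shows "f \<cdot> \<zero> A B = \<zero> A (tgt C f)"
proof -
  have B: "B \<in> objs C" using assms by auto
  have "f \<cdot> \<zero> A B \<oplus> f \<cdot> \<zero> A B = f \<cdot> (\<zero> A B \<oplus> \<zero> A B)"
    by (rule cmp_add[symmetric]) (use assms B in simp_all)
  also have "\<dots> = f \<cdot> \<zero> A B \<oplus> \<zero> A (tgt C f)" using assms B by simp
  finally show ?thesis
    by (rule iffD1[OF add_left_cancel, rotated -1]) (use assms B in simp_all)
qed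

lemma null_cmp [simp]:
  assumes "f \<in> arrs C" "B \<in> objs C" "tgt C f = A"
  shows "\<zero> A B \<cdot> f = \<zero> (src C f) B"
proof -
  have A: "A \<in> objs C" using assms by auto
  have "\<zero> A B \<cdot> f \<oplus> \<zero> A B \<cdot> f = (\<zero> A B \<oplus> \<zero> A B) \<cdot> f"
    by (rule add_cmp[symmetric]) (use assms A in simp_all)
  also have "\<dots> = \<zero> A B \<cdot> f \<oplus> \<zero> (src C f) B" using assms A by simp
  finally show ?thesis
    by (rule iffD1[OF add_left_cancel, rotated -1]) (use assms A in simp_all)
qed

lemma neg_null [simp]: "A \<in> objs C \<Longrightarrow> B \<in> objs C \<Longrightarrow> \<ominus> (\<zero> A B) = \<zero> A B"
  by (rule neg_unique[symmetric]) simp_all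

lemma cmp_neg [simp]:
  assumes "f \<in> arrs C" "g \<in> arrs C" "tgt C f = src C g"
  shows "g \<cdot> (\<ominus> f) = \<ominus> (g \<cdot> f)"
proof (rule neg_unique)
  have "g \<cdot> f \<oplus> g \<cdot> (\<ominus> f) = g \<cdot> (f \<oplus> \<ominus> f)"
    by (rule cmp_add[symmetric]) (use assms in simp_all)
  then show "g \<cdot> f \<oplus> g \<cdot> (\<ominus> f) = \<zero> (src C (g \<cdot> f)) (tgt C (g \<cdot> f))"
    using assms by simp
qed (use assms in simp_all)

lemma neg_cmp [simp]:
  assumes "f \<in> arrs C" "g \<in> arrs C" "tgt C f = src C g"
  shows "(\<ominus> g) \<cdot> f = \<ominus> (g \<cdot> f)"
proof (rule neg_unique)
  have "g \<cdot> f \<oplus> (\<ominus> g) \<cdot> f = (g \<oplus> \<ominus> g) \<cdot> f"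
    by (rule add_cmp[symmetric]) (use assms in simp_all)
  then show "g \<cdot> f \<oplus> (\<ominus> g) \<cdot> f = \<zero> (src C (g \<cdot> f)) (tgt C (g \<cdot> f))"
    using assms by simp
qed (use assms in simp_all)

lemma neg_add [simp]:
  assumes "f \<in> arrs C" "g \<in> arrs C" "src C f = src C g" "tgt C f = tgt C g"
  shows "\<ominus> (f \<oplus> g) = \<ominus> f \<oplus> \<ominus> g"
proof (rule neg_unique[symmetric])
  have "g \<oplus> (\<ominus> f \<oplus> \<ominus> g) = \<ominus> f \<oplus> (g \<oplus> \<ominus> g)"
    by (rule add_left_commute) (use assms in simp_all)
  then show "(f \<oplus> g) \<oplus> (\<ominus> f \<oplus> \<ominus> g) = \<zero> (src C (f \<oplus> g)) (tgt C (f \<oplus> g))"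
    using assms by simp
qed (use assms in simp_all)

lemma neg_eq_null [simp]:
  assumes "f \<in> arrs C" "src C f = A" "tgt C f = B"
  shows "\<ominus> f = \<zero> A B \<longleftrightarrow> f = \<zero> A B"
proof -
  have "A \<in> objs C" "B \<in> objs C" using assms by auto
  then show ?thesis using neg_neg[OF assms(1)] neg_null[of A B] by auto
qed

end

section \<open>Biproducts and matrices\<close>

context preadditive_category
begin

text \<open>The summands are recovered as targets of the projections, so a biproduct is handled as a
  single datum without carrying its two objects along.\<close>

definition biprod :: "('a, 'b) biproduct_data \<Rightarrow> bool" where
  "biprod B \<longleftrightarrow> is_biproduct C (tgt C (proj1 B)) (tgt C (proj2 B)) B"

definition pair :: "('a, 'b) biproduct_data \<Rightarrow> 'b \<Rightarrow> 'b \<Rightarrow> 'b" where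
  "pair B x y = inj1 B \<cdot> x \<oplus> inj2 B \<cdot> y"

definition copair :: "('a, 'b) biproduct_data \<Rightarrow> 'b \<Rightarrow> 'b \<Rightarrow> 'b" where
  "copair B u v = u \<cdot> proj1 B \<oplus> v \<cdot> proj2 B"

lemma biprodI:
  assumes "is_biproduct C X Y B"
  shows "biprod B" "tgt C (proj1 B) = X" "tgt C (proj2 B) = Y"
  using assms by (auto simp: biprod_def is_biproduct_def)

lemma biprod_simps [simp]:
  assumes "biprod B"
  shows "bip_obj B \<in> objs C"
    "inj1 B \<in> arrs C" "src C (inj1 B) = tgt C (proj1 B)" "tgt C (inj1 B) = bip_obj B"
    "inj2 B \<in> arrs C" "src C (inj2 B) = tgt C (proj2 B)" "tgt C (inj2 B) = bip_obj B"
    "proj1 B \<in> arrs C" "src C (proj1 B) = bip_obj B"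
    "proj2 B \<in> arrs C" "src C (proj2 B) = bip_obj B"
    "proj1 B \<cdot> inj1 B = ident C (tgt C (proj1 B))" "proj2 B \<cdot> inj2 B = ident C (tgt C (proj2 B))"
    "proj2 B \<cdot> inj1 B = \<zero> (tgt C (proj1 B)) (tgt C (proj2 B))"
    "proj1 B \<cdot> inj2 B = \<zero> (tgt C (proj2 B)) (tgt C (proj1 B))"
    "inj1 B \<cdot> proj1 B \<oplus> inj2 B \<cdot> proj2 B = ident C (bip_obj B)"
  using assms by (auto simp: biprod_def is_biproduct_def)

lemma proj_inj_cmp [simp]:
  assumes "biprod B" "x \<in> arrs C"
  shows "tgt C x = tgt C (proj1 B) \<Longrightarrow> proj1 B \<cdot> (inj1 B \<cdot> x) = x"
    "tgt C x = tgt C (proj2 B) \<Longrightarrow> proj2 B \<cdot> (inj2 B \<cdot> x) = x"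
    "tgt C x = tgt C (proj1 B) \<Longrightarrow> proj2 B \<cdot> (inj1 B \<cdot> x) = \<zero> (src C x) (tgt C (proj2 B))"
    "tgt C x = tgt C (proj2 B) \<Longrightarrow> proj1 B \<cdot> (inj2 B \<cdot> x) = \<zero> (src C x) (tgt C (proj1 B))"
  using assms by (simp_all add: cmp_reduce[where r = "ident C _"] cmp_reduce[where r = "\<zero> _ _"])

lemma pair_simps [simp]:
  assumes "biprod B" "x \<in> arrs C" "y \<in> arrs C" "src C x = src C y"
    "tgt C x = tgt C (proj1 B)" "tgt C y = tgt C (proj2 B)"
  shows "pair B x y \<in> arrs C" "src C (pair B x y) = src C y" "tgt C (pair B x y) = bip_obj B"
    "proj1 B \<cdot> pair B x y = x" "proj2 B \<cdot> pair B x y = y"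
  using assms by (simp_all add: pair_def)

lemma pair_cmp [simp]:
  assumes "biprod B" "x \<in> arrs C" "y \<in> arrs C" "src C x = src C y"
    "tgt C x = tgt C (proj1 B)" "tgt C y = tgt C (proj2 B)" "f \<in> arrs C" "tgt C f = src C y"
  shows "pair B x y \<cdot> f = pair B (x \<cdot> f) (y \<cdot> f)"
  using assms by (simp add: pair_def)

lemma copair_simps [simp]:
  assumes "biprod B" "u \<in> arrs C" "v \<in> arrs C" "tgt C u = tgt C v"
    "src C u = tgt C (proj1 B)" "src C v = tgt C (proj2 B)"
  shows "copair B u v \<in> arrs C" "src C (copair B u v) = bip_obj B" "tgt C (copair B u v) = tgt C v"
    "copair B u v \<cdot> inj1 B = u" "copair B u v \<cdot> inj2 B = v"
  using assms by (simp_all add: copair_def)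

lemma cmp_copair [simp]:
  assumes "biprod B" "u \<in> arrs C" "v \<in> arrs C" "tgt C u = tgt C v"
    "src C u = tgt C (proj1 B)" "src C v = tgt C (proj2 B)" "f \<in> arrs C" "src C f = tgt C v"
  shows "f \<cdot> copair B u v = copair B (f \<cdot> u) (f \<cdot> v)"
  using assms by (simp add: copair_def)

lemma copair_cmp:
  assumes "biprod B" "u \<in> arrs C" "v \<in> arrs C" "tgt C u = tgt C v"
    "src C u = tgt C (proj1 B)" "src C v = tgt C (proj2 B)" "z \<in> arrs C" "tgt C z = bip_obj B"
  shows "copair B u v \<cdot> z = u \<cdot> (proj1 B \<cdot> z) \<oplus> v \<cdot> (proj2 B \<cdot> z)"
  using assms by (simp add: copair_def)

lemma copair_pair [simp]:
  assumes "biprod B" "u \<in> arrs C" "v \<in> arrs C" "tgt C u = tgt C v"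
    "src C u = tgt C (proj1 B)" "src C v = tgt C (proj2 B)"
    "x \<in> arrs C" "y \<in> arrs C" "src C x = src C y"
    "tgt C x = tgt C (proj1 B)" "tgt C y = tgt C (proj2 B)"
  shows "copair B u v \<cdot> pair B x y = u \<cdot> x \<oplus> v \<cdot> y"
  using assms by (simp add: copair_cmp)

lemma pair_eta:
  assumes "biprod B" "z \<in> arrs C" "tgt C z = bip_obj B"
  shows "pair B (proj1 B \<cdot> z) (proj2 B \<cdot> z) = z"
proof -
  have "pair B (proj1 B \<cdot> z) (proj2 B \<cdot> z) = (inj1 B \<cdot> proj1 B \<oplus> inj2 B \<cdot> proj2 B) \<cdot> z"
    using assms by (simp add: pair_def del: biprod_simps(16))
  then show ?thesis using assms by simp
qed

lemma pair_eq_iff: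
  assumes "biprod B" "x \<in> arrs C" "y \<in> arrs C" "src C x = src C y"
    "tgt C x = tgt C (proj1 B)" "tgt C y = tgt C (proj2 B)"
    "x' \<in> arrs C" "y' \<in> arrs C" "src C x' = src C y'"
    "tgt C x' = tgt C (proj1 B)" "tgt C y' = tgt C (proj2 B)"
  shows "pair B x y = pair B x' y' \<longleftrightarrow> x = x' \<and> y = y'"
proof
  assume *: "pair B x y = pair B x' y'"
  have "proj1 B \<cdot> pair B x y = x" "proj2 B \<cdot> pair B x y = y"
    using assms(1-6) by simp_all
  moreover have "proj1 B \<cdot> pair B x' y' = x'" "proj2 B \<cdot> pair B x' y' = y'"
    using assms(1,7-) by simp_all
  ultimately show "x = x' \<and> y = y'" unfolding * by auto
qed auto

lemma pair_null [simp]: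
  assumes "biprod B" "A \<in> objs C" "X = tgt C (proj1 B)" "Y = tgt C (proj2 B)"
  shows "pair B (\<zero> A X) (\<zero> A Y) = \<zero> A (bip_obj B)"
  using assms by (simp add: pair_def)

lemma pair_eq_null:
  assumes "biprod B" "x \<in> arrs C" "y \<in> arrs C" "src C x = A" "src C y = A"
    "tgt C x = tgt C (proj1 B)" "tgt C y = tgt C (proj2 B)"
  shows "pair B x y = \<zero> A (bip_obj B) \<longleftrightarrow> x = \<zero> A (tgt C (proj1 B)) \<and> y = \<zero> A (tgt C (proj2 B))"
proof -
  have A: "A \<in> objs C" using assms by auto
  have "pair B x y = \<zero> A (bip_obj B)
      \<longleftrightarrow> pair B x y = pair B (\<zero> A (tgt C (proj1 B))) (\<zero> A (tgt C (proj2 B)))"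
    using A assms(1) by simp
  also have "\<dots> \<longleftrightarrow> x = \<zero> A (tgt C (proj1 B)) \<and> y = \<zero> A (tgt C (proj2 B))"
    by (rule pair_eq_iff) (use A assms in simp_all)
  finally show ?thesis .
qed

text \<open>The underlying object stays the same. This lets two stabilized sequences share their
  term of index 1 on the nose and not just up to isomorphism.\<close>

definition swap_biprod :: "('a, 'b) biproduct_data \<Rightarrow> ('a, 'b) biproduct_data" where
  "swap_biprod B = \<lparr>bip_obj = bip_obj B, inj1 = inj2 B, inj2 = inj1 B, proj1 = proj2 B, proj2 = proj1 B\<rparr>"

lemma swap_biprod: "biprod B \<Longrightarrow> biprod (swap_biprod B)"
  unfolding swap_biprod_def biprod_def is_biproduct_def
  by (auto simp: add_commute[of "inj2 B \<cdot> proj2 B"])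

end

section \<open>Exactness in terms of generalized elements\<close>

context preadditive_category
begin

lemma complexD:
  assumes "complex C n S"
  shows "i \<le> n \<Longrightarrow> trm S i \<in> objs C"
    "i < n \<Longrightarrow> diff S i \<in> arrs C"
    "i < n \<Longrightarrow> src C (diff S i) = trm S (Suc i)"
    "i < n \<Longrightarrow> tgt C (diff S i) = trm S i"
    "Suc i < n \<Longrightarrow> diff S i \<cdot> diff S (Suc i) = \<zero> (trm S (Suc (Suc i))) (trm S i)"
  using assms by (auto simp: complex_def)

lemma complex_cmp_null:
  assumes "complex C n S" "Suc i < n" "x \<in> arrs C" "tgt C x = trm S (Suc (Suc i))"
  shows "diff S i \<cdot> (diff S (Suc i) \<cdot> x) = \<zero> (src C x) (trm S i)"
  using assms complexD[OF assms(1)] by (simp add: cmp_reduce[where r = "\<zero> _ _"])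

lemma complex_morphismD:
  assumes "complex_morphism C n S T h"
  shows "complex C n S" "complex C n T"
    "i \<le> n \<Longrightarrow> h i \<in> arrs C" "i \<le> n \<Longrightarrow> src C (h i) = trm S i" "i \<le> n \<Longrightarrow> tgt C (h i) = trm T i"
    "i < n \<Longrightarrow> h i \<cdot> diff S i = diff T i \<cdot> h (Suc i)"
  using assms by (auto simp: complex_morphism_def)

lemma complex_morphism_cmp:
  assumes "complex_morphism C n S T h" "i < n" "x \<in> arrs C" "tgt C x = trm S (Suc i)"
  shows "h i \<cdot> (diff S i \<cdot> x) = diff T i \<cdot> (h (Suc i) \<cdot> x)"
proof -
  note S = complexD[OF complex_morphismD(1)[OF assms(1)]]
    and T = complexD[OF complex_morphismD(2)[OF assms(1)]] and h = complex_morphismD[OF assms(1)]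
  have "h i \<cdot> (diff S i \<cdot> x) = (diff T i \<cdot> h (Suc i)) \<cdot> x"
    by (rule cmp_reduce) (use assms h S in simp_all)
  then show ?thesis using assms h T by simp
qed

text \<open>The test object is hidden in \<open>x\<close> as its source. Images lie in kernels
  because \<open>S\<close> is a complex, so only the other inclusion is left to check.\<close>

lemma left_d_exactI:
  assumes "complex C (Suc d) S"
    and "\<And>x. x \<in> arrs C \<Longrightarrow> tgt C x = trm S (Suc d) \<Longrightarrow> diff S d \<cdot> x = \<zero> (src C x) (trm S d)
      \<Longrightarrow> x = \<zero> (src C x) (trm S (Suc d))"
    and "\<And>i x. i < d \<Longrightarrow> x \<in> arrs C \<Longrightarrow> tgt C x = trm S (Suc i) \<Longrightarrow>
      diff S i \<cdot> x = \<zero> (src C x) (trm S i) \<Longrightarrow>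
      \<exists>y \<in> arrs C. src C y = src C x \<and> tgt C y = trm S (Suc (Suc i)) \<and> x = diff S (Suc i) \<cdot> y"
  shows "left_d_exact C d S"
  using assms complexD[OF assms(1)] unfolding left_d_exact_def
  by (auto simp: kernel_def hom_group_def complex_cmp_null[OF assms(1)] image_iff Bex_def)

lemma left_d_exactD:
  assumes "left_d_exact C d S"
  shows "complex C (Suc d) S"
    and "x \<in> arrs C \<Longrightarrow> tgt C x = trm S (Suc d) \<Longrightarrow> diff S d \<cdot> x = \<zero> (src C x) (trm S d)
      \<Longrightarrow> x = \<zero> (src C x) (trm S (Suc d))"
    and "i < d \<Longrightarrow> x \<in> arrs C \<Longrightarrow> tgt C x = trm S (Suc i) \<Longrightarrow>
      diff S i \<cdot> x = \<zero> (src C x) (trm S i) \<Longrightarrow>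
      \<exists>y. y \<in> arrs C \<and> src C y = src C x \<and> tgt C y = trm S (Suc (Suc i)) \<and> x = diff S (Suc i) \<cdot> y"
proof -
  show "complex C (Suc d) S" using assms by (simp add: left_d_exact_def)
  show "x = \<zero> (src C x) (trm S (Suc d))"
    if "x \<in> arrs C" "tgt C x = trm S (Suc d)" "diff S d \<cdot> x = \<zero> (src C x) (trm S d)"
  proof -
    have "x \<in> kernel (hom_group C (src C x) (trm S (d + 1))) (hom_group C (src C x) (trm S d))
            (\<lambda>f. diff S d \<cdot> f)"
      using that by (simp add: kernel_def hom_group_def)
    then show ?thesis using assms that by (auto simp: left_d_exact_def)
  qed
  show "\<exists>y. y \<in> arrs C \<and> src C y = src C x \<and> tgt C y = trm S (Suc (Suc i)) \<and> x = diff S (Suc i) \<cdot> y"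
    if "i < d" "x \<in> arrs C" "tgt C x = trm S (Suc i)" "diff S i \<cdot> x = \<zero> (src C x) (trm S i)"
  proof -
    have "x \<in> kernel (hom_group C (src C x) (trm S (i + 1))) (hom_group C (src C x) (trm S i))
            (\<lambda>f. diff S i \<cdot> f)"
      using that by (simp add: kernel_def hom_group_def)
    then have "x \<in> (\<lambda>f. diff S (i + 1) \<cdot> f) ` hom_set C (src C x) (trm S (i + 2))"
      using assms that by (simp add: left_d_exact_def)
    then show ?thesis by auto
  qed
qed

lemma right_d_exactI:
  assumes "complex C (Suc d) S"
    and "\<And>x. x \<in> arrs C \<Longrightarrow> src C x = trm S 0 \<Longrightarrow> x \<cdot> diff S 0 = \<zero> (trm S 1) (tgt C x)
      \<Longrightarrow> x = \<zero> (trm S 0) (tgt C x)"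
    and "\<And>i x. i < d \<Longrightarrow> x \<in> arrs C \<Longrightarrow> src C x = trm S (Suc i) \<Longrightarrow>
      x \<cdot> diff S (Suc i) = \<zero> (trm S (Suc (Suc i))) (tgt C x) \<Longrightarrow>
      \<exists>y \<in> arrs C. src C y = trm S i \<and> tgt C y = tgt C x \<and> x = y \<cdot> diff S i"
  shows "right_d_exact C d S"
proof -
  have "(y \<cdot> diff S i) \<cdot> diff S (Suc i) = \<zero> (trm S (Suc (Suc i))) (tgt C y)"
    if "i < d" "y \<in> arrs C" "src C y = trm S i" for i y
    using that complexD[OF assms(1)] by simp
  then show ?thesis
    using assms complexD[OF assms(1)] unfolding right_d_exact_def
    by (auto simp: kernel_def hom_group_def image_iff Bex_def)
qed

lemma right_d_exactD:
  assumes "right_d_exact C d S"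
  shows "complex C (Suc d) S"
    and "x \<in> arrs C \<Longrightarrow> src C x = trm S 0 \<Longrightarrow> x \<cdot> diff S 0 = \<zero> (trm S 1) (tgt C x)
      \<Longrightarrow> x = \<zero> (trm S 0) (tgt C x)"
    and "i < d \<Longrightarrow> x \<in> arrs C \<Longrightarrow> src C x = trm S (Suc i) \<Longrightarrow>
      x \<cdot> diff S (Suc i) = \<zero> (trm S (Suc (Suc i))) (tgt C x) \<Longrightarrow>
      \<exists>y. y \<in> arrs C \<and> src C y = trm S i \<and> tgt C y = tgt C x \<and> x = y \<cdot> diff S i"
proof -
  show "complex C (Suc d) S" using assms by (simp add: right_d_exact_def)
  show "x = \<zero> (trm S 0) (tgt C x)"
    if "x \<in> arrs C" "src C x = trm S 0" "x \<cdot> diff S 0 = \<zero> (trm S 1) (tgt C x)"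
  proof -
    have "x \<in> kernel (hom_group C (trm S 0) (tgt C x)) (hom_group C (trm S 1) (tgt C x))
            (\<lambda>f. f \<cdot> diff S 0)"
      using that by (simp add: kernel_def hom_group_def)
    then show ?thesis using assms that by (auto simp: right_d_exact_def)
  qed
  show "\<exists>y. y \<in> arrs C \<and> src C y = trm S i \<and> tgt C y = tgt C x \<and> x = y \<cdot> diff S i"
    if "i < d" "x \<in> arrs C" "src C x = trm S (Suc i)"
      "x \<cdot> diff S (Suc i) = \<zero> (trm S (Suc (Suc i))) (tgt C x)"
  proof -
    have "x \<in> kernel (hom_group C (trm S (i + 1)) (tgt C x)) (hom_group C (trm S (i + 2)) (tgt C x))
            (\<lambda>f. f \<cdot> diff S (i + 1))"
      using that by (simp add: kernel_def hom_group_def)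
    then have "x \<in> (\<lambda>f. f \<cdot> diff S i) ` hom_set C (trm S i) (tgt C x)"
      using assms that by (simp add: right_d_exact_def)
    then show ?thesis by auto
  qed
qed

end

section \<open>Comparison of exact sequences\<close>

context preadditive_category
begin

text \<open>As in the comparison of resolutions, with exactness under every Hom(W, -) in place of
  projectivity: the arrow just built, precomposed with the differential of \<open>S\<close>, is
  killed by that of \<open>T\<close>, because squares commute and \<open>S\<close> is a complex.
  Hence it lifts one index further to the left.\<close>

lemma extend_complex_morphism:
  assumes S: "complex C (Suc d) S" and T: "left_d_exact C d T"
    and f0: "f0 \<in> hom_set C (trm S 0) (trm T 0)" and f1: "f1 \<in> hom_set C (trm S 1) (trm T 1)"
    and sq: "f0 \<cdot> diff S 0 = diff T 0 \<cdot> f1"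
  obtains f where "complex_morphism C (Suc d) S T f" "f 0 = f0" "f 1 = f1"
proof -
  note S' = complexD[OF S] and T' = complexD[OF left_d_exactD(1)[OF T]]
  have "\<exists>f. f 0 = f0 \<and> f 1 = f1 \<and> (\<forall>i \<le> Suc k. f i \<in> hom_set C (trm S i) (trm T i)) \<and>
      (\<forall>i \<le> k. f i \<cdot> diff S i = diff T i \<cdot> f (Suc i))" if "k \<le> d" for k
    using that
  proof (induction k)
    case 0
    have "i \<le> Suc 0 \<longleftrightarrow> i = 0 \<or> i = 1" for i by auto
    then show ?case
      by (intro exI[of _ "\<lambda>i. if i = 0 then f0 else f1"]) (use f0 f1 sq in simp)
  next
    case (Suc k)
    then obtain f where f: "f 0 = f0" "f 1 = f1" "\<And>i. i \<le> Suc k \<Longrightarrow> f i \<in> hom_set C (trm S i) (trm T i)"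
      "\<And>i. i \<le> k \<Longrightarrow> f i \<cdot> diff S i = diff T i \<cdot> f (Suc i)"
      by auto
    have fk: "f i \<in> arrs C" "src C (f i) = trm S i" "tgt C (f i) = trm T i" if "i \<le> Suc k" for i
      using f(3)[OF that] by simp_all
    let ?x = "f (Suc k) \<cdot> diff S (Suc k)"
    have "diff T k \<cdot> ?x = (diff T k \<cdot> f (Suc k)) \<cdot> diff S (Suc k)"
      using Suc.prems fk S' T' by simp
    also have "\<dots> = f k \<cdot> (diff S k \<cdot> diff S (Suc k))"
      using Suc.prems fk S' T' by (simp flip: f(4))
    also have "\<dots> = \<zero> (src C ?x) (trm T k)"
      using Suc.prems fk S' T' by simp
    finally obtain y where y: "y \<in> arrs C" "src C y = trm S (Suc (Suc k))" "tgt C y = trm T (Suc (Suc k))"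
      "?x = diff T (Suc k) \<cdot> y"
      using left_d_exactD(3)[OF T, of k ?x] Suc.prems fk S' T' by auto
    show ?case
    proof (intro exI conjI allI impI)
      fix i
      show "(f(Suc (Suc k) := y)) i \<in> hom_set C (trm S i) (trm T i)" if "i \<le> Suc (Suc k)"
        using that y Suc.prems fk S' by auto
      show "(f(Suc (Suc k) := y)) i \<cdot> diff S i = diff T i \<cdot> (f(Suc (Suc k) := y)) (Suc i)" if "i \<le> Suc k"
        using that y(4) f(4)[of i] by (cases "i = Suc k") auto
    qed (use f in auto)
  qed
  from this[of d] obtain f where f: "f 0 = f0" "f 1 = f1" "\<And>i. i \<le> Suc d \<Longrightarrow> f i \<in> hom_set C (trm S i) (trm T i)"
      "\<And>i. i \<le> d \<Longrightarrow> f i \<cdot> diff S i = diff T i \<cdot> f (Suc i)"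
    by auto
  show thesis
    by (rule that[of f]) (use f S left_d_exactD(1)[OF T] in \<open>auto simp: complex_morphism_def\<close>)
qed

text \<open>The homotopy is found from right to left, by lifting at each index what the components
  chosen so far fail to account for.\<close>

lemma homotopy_exists:
  assumes f: "complex_morphism C (Suc d) S T f" and g: "complex_morphism C (Suc d) S T g"
    and T: "left_d_exact C d T" and fg: "f 0 = g 0"
  obtains s where "\<And>i. i \<le> d \<Longrightarrow> s i \<in> hom_set C (trm S i) (trm T (Suc i))"
    "\<And>i. i < d \<Longrightarrow> f (Suc i) = g (Suc i) \<oplus> (diff T (Suc i) \<cdot> s (Suc i) \<oplus> s i \<cdot> diff S i)"
    "f (Suc d) = g (Suc d) \<oplus> s d \<cdot> diff S d"
proof -
  note f' = complex_morphismD[OF f] and g' = complex_morphismD[OF g]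
  note S' = complexD[OF f'(1)] and T' = complexD[OF f'(2)]
  let ?r = "\<lambda>s i. f (Suc i) \<oplus> \<ominus> (g (Suc i) \<oplus> s \<cdot> diff S i)"
  have r: "?r s i \<in> arrs C" "src C (?r s i) = trm S (Suc i)" "tgt C (?r s i) = trm T (Suc i)"
    if "i \<le> d" "s \<in> hom_set C (trm S i) (trm T (Suc i))" for s i
    using that f' g' S' T' by simp_all
  \<comment> \<open>The last clause carries the recursion: the remainder at index
    \<open>k + 1\<close> is a cycle of \<open>T\<close>, so for \<open>k < d\<close> it lifts to the
    next component of \<open>s\<close>.\<close>
  have "\<exists>s. (\<forall>i \<le> k. s i \<in> hom_set C (trm S i) (trm T (Suc i))) \<and>
      (\<forall>i < k. f (Suc i) = g (Suc i) \<oplus> (diff T (Suc i) \<cdot> s (Suc i) \<oplus> s i \<cdot> diff S i)) \<and>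
      diff T k \<cdot> ?r (s k) k = \<zero> (trm S (Suc k)) (trm T k)" if "k \<le> d" for k
    using that
  proof (induction k)
    case 0
    have "f 0 \<cdot> diff S 0 = g 0 \<cdot> diff S 0" using fg by simp
    then have "diff T 0 \<cdot> f 1 = diff T 0 \<cdot> g 1" using f'(6)[of 0] g'(6)[of 0] by simp
    \<comment> \<open>Since \<open>f\<close> and \<open>g\<close> agree at index 0, the homotopy can
      start with zero.\<close>
    then show ?case
      by (intro exI[of _ "\<lambda>_. \<zero> (trm S 0) (trm T 1)"]) (use f' g' S' T' in simp)
  next
    case (Suc k)
    then obtain s where s: "\<And>i. i \<le> k \<Longrightarrow> s i \<in> hom_set C (trm S i) (trm T (Suc i))"
      "\<And>i. i < k \<Longrightarrow> f (Suc i) = g (Suc i) \<oplus> (diff T (Suc i) \<cdot> s (Suc i) \<oplus> s i \<cdot> diff S i)"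
      "diff T k \<cdot> ?r (s k) k = \<zero> (trm S (Suc k)) (trm T k)"
      by auto
    have sk: "s i \<in> arrs C" "src C (s i) = trm S i" "tgt C (s i) = trm T (Suc i)" if "i \<le> k" for i
      using s(1)[OF that] by simp_all
    obtain y where y: "y \<in> arrs C" "src C y = trm S (Suc k)" "tgt C y = trm T (Suc (Suc k))"
      "?r (s k) k = diff T (Suc k) \<cdot> y"
      using left_d_exactD(3)[OF T, of k "?r (s k) k"] s(3) r[of k "s k"] Suc.prems sk by auto
    have "g (Suc k) \<oplus> (diff T (Suc k) \<cdot> y \<oplus> s k \<cdot> diff S k)
        = (g (Suc k) \<oplus> s k \<cdot> diff S k) \<oplus> diff T (Suc k) \<cdot> y"
      using y(1-3) sk f' g' S' T' Suc.prems by (simp add: add_ac)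
    also have "\<dots> = f (Suc k)"
      unfolding y(4)[symmetric] using sk f' g' S' T' Suc.prems
      by (simp add: add_ac)
    finally have fk: "f (Suc k) = g (Suc k) \<oplus> (diff T (Suc k) \<cdot> y \<oplus> s k \<cdot> diff S k)" ..
    have "diff T (Suc k) \<cdot> f (Suc (Suc k)) = f (Suc k) \<cdot> diff S (Suc k)"
      using f'(6)[of "Suc k"] Suc.prems by simp
    also have "\<dots> = g (Suc k) \<cdot> diff S (Suc k) \<oplus> diff T (Suc k) \<cdot> (y \<cdot> diff S (Suc k))"
      unfolding fk using y(1-3) sk g' S' T' Suc.prems by simp
    also have "\<dots> = diff T (Suc k) \<cdot> (g (Suc (Suc k)) \<oplus> y \<cdot> diff S (Suc k))"
      using y(1-3) sk g' S' T' Suc.prems by simp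
    finally have eq: "diff T (Suc k) \<cdot> f (Suc (Suc k))
        = diff T (Suc k) \<cdot> (g (Suc (Suc k)) \<oplus> y \<cdot> diff S (Suc k))" .
    have "diff T (Suc k) \<cdot> ?r y (Suc k) = diff T (Suc k) \<cdot> f (Suc (Suc k))
        \<oplus> \<ominus> (diff T (Suc k) \<cdot> (g (Suc (Suc k)) \<oplus> y \<cdot> diff S (Suc k)))"
      using y(1-3) f' g' S' T' Suc.prems by simp
    also have "\<dots> = \<zero> (trm S (Suc (Suc k))) (trm T (Suc k))"
      unfolding eq using y(1-3) g' S' T' Suc.prems by (simp del: cmp_add)
    finally have "diff T (Suc k) \<cdot> ?r y (Suc k) = \<zero> (trm S (Suc (Suc k))) (trm T (Suc k))" .
    moreover have "f (Suc i) = g (Suc i) \<oplus> (diff T (Suc i) \<cdot> (s(Suc k := y)) (Suc i) \<oplus> (s(Suc k := y)) i \<cdot> diff S i)"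
      if "i < Suc k" for i
      using fk s(2)[of i] that by (cases "i = k") auto
    ultimately show ?case
      by (intro exI[of _ "s(Suc k := y)"]) (use s(1) y in auto)
  qed
  from this[of d] obtain s where s: "\<And>i. i \<le> d \<Longrightarrow> s i \<in> hom_set C (trm S i) (trm T (Suc i))"
      "\<And>i. i < d \<Longrightarrow> f (Suc i) = g (Suc i) \<oplus> (diff T (Suc i) \<cdot> s (Suc i) \<oplus> s i \<cdot> diff S i)"
      "diff T d \<cdot> ?r (s d) d = \<zero> (trm S (Suc d)) (trm T d)"
    by auto
  have sd: "s d \<in> arrs C" "src C (s d) = trm S d" "tgt C (s d) = trm T (Suc d)"
    using s(1)[of d] by simp_all
  \<comment> \<open>At the left end \<open>diff T d\<close> is monic, so the remainder itself is
    zero and the last equation has one term fewer.\<close>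
  have "?r (s d) d = \<zero> (trm S (Suc d)) (trm T (Suc d))"
    using left_d_exactD(2)[OF T, of "?r (s d) d"] s(3) r[of d "s d"] sd by simp
  then have "f (Suc d) = g (Suc d) \<oplus> s d \<cdot> diff S d"
    by (rule iffD1[OF diff_eq_null(1), rotated -1]) (use sd f' g' S' T' in simp_all)
  with s(1,2) show thesis by (rule that[of s])
qed

lemma complex_morphism_ident:
  "complex C n S \<Longrightarrow> complex_morphism C n S S (\<lambda>i. ident C (trm S i))"
  by (auto simp: complex_morphism_def complexD)

lemma complex_morphism_comp:
  assumes f: "complex_morphism C n S T f" and g: "complex_morphism C n T U g"
  shows "complex_morphism C n S U (\<lambda>i. g i \<cdot> f i)"
proof -
  note f' = complex_morphismD[OF f] and g' = complex_morphismD[OF g]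
  note S' = complexD[OF f'(1)] and T' = complexD[OF f'(2)] and U' = complexD[OF g'(2)]
  have "(g i \<cdot> f i) \<cdot> diff S i = diff U i \<cdot> (g (Suc i) \<cdot> f (Suc i))" if "i < n" for i
  proof -
    have "(g i \<cdot> f i) \<cdot> diff S i = g i \<cdot> (diff T i \<cdot> f (Suc i))"
      using that f' g' S' by simp
    also have "\<dots> = diff U i \<cdot> (g (Suc i) \<cdot> f (Suc i))"
      by (rule complex_morphism_cmp[OF g that]) (use that f' in simp_all)
    finally show ?thesis .
  qed
  then show ?thesis using f' g' by (auto simp: complex_morphism_def)
qed

text \<open>Exactness is invariant under homotopy equivalence, and by the comparison lemmas the two
  factorizations extend to mutually inverse homotopy equivalences.\<close>

lemma left_d_exact_imp_d_exact:
  assumes S: "left_d_exact C d S" and T: "d_exact C d T" and eq0: "trm S 0 = trm T 0"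
    and a: "a \<in> hom_set C (trm S 1) (trm T 1)" "diff S 0 = diff T 0 \<cdot> a"
    and b: "b \<in> hom_set C (trm T 1) (trm S 1)" "diff T 0 = diff S 0 \<cdot> b"
  shows "d_exact C d S"
proof -
  have T1: "left_d_exact C d T" and T2: "right_d_exact C d T" using T by (auto simp: d_exact_def)
  note S' = complexD[OF left_d_exactD(1)[OF S]] and T' = complexD[OF left_d_exactD(1)[OF T1]]
  obtain f where f: "complex_morphism C (Suc d) S T f" "f 0 = ident C (trm S 0)"
    by (rule extend_complex_morphism[OF left_d_exactD(1)[OF S] T1, of "ident C (trm S 0)" a])
      (use a eq0 S' T' in auto)
  obtain g where g: "complex_morphism C (Suc d) T S g" "g 0 = ident C (trm S 0)"
    by (rule extend_complex_morphism[OF left_d_exactD(1)[OF T1] S, of "ident C (trm S 0)" b])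
      (use b eq0 S' T' in auto)
  note f' = complex_morphismD[OF f(1)] and g' = complex_morphismD[OF g(1)]
  obtain s where s: "\<And>i. i \<le> d \<Longrightarrow> s i \<in> hom_set C (trm S i) (trm S (Suc i))"
    "\<And>i. i < d \<Longrightarrow> g (Suc i) \<cdot> f (Suc i)
      = ident C (trm S (Suc i)) \<oplus> (diff S (Suc i) \<cdot> s (Suc i) \<oplus> s i \<cdot> diff S i)"
    by (rule homotopy_exists[OF complex_morphism_comp[OF f(1) g(1)]
          complex_morphism_ident[OF left_d_exactD(1)[OF S]] S])
      (use f(2) g(2) S' in auto)
  have s': "s i \<in> arrs C" "src C (s i) = trm S i" "tgt C (s i) = trm S (Suc i)" if "i \<le> d" for i
    using s(1)[OF that] by simp_all
  have "right_d_exact C d S"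
  proof (rule right_d_exactI[OF left_d_exactD(1)[OF S]])
    fix x assume x: "x \<in> arrs C" "src C x = trm S 0" "x \<cdot> diff S 0 = \<zero> (trm S 1) (tgt C x)"
    have "x \<cdot> diff T 0 = (x \<cdot> diff S 0) \<cdot> b" using x(1,2) b S' T' by simp
    also have "\<dots> = \<zero> (trm T 1) (tgt C x)" unfolding x(3) using x(1) b S' by simp
    finally show "x = \<zero> (trm S 0) (tgt C x)"
      using right_d_exactD(2)[OF T2, of x] x eq0 by simp
  next
    fix i x assume i: "i < d" and x: "x \<in> arrs C" "src C x = trm S (Suc i)"
      "x \<cdot> diff S (Suc i) = \<zero> (trm S (Suc (Suc i))) (tgt C x)"
    \<comment> \<open>Composition with \<open>g\<close> carries the cocycle \<open>x\<close> to
      \<open>T\<close>, where it factors. Going back with \<open>f\<close> returns \<open>x\<close>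
      up to the homotopy term \<open>x \<cdot> (s i \<cdot> diff S i)\<close>, which factors through
      \<open>diff S i\<close> as well.\<close>
    have "(x \<cdot> g (Suc i)) \<cdot> diff T (Suc i) = (x \<cdot> diff S (Suc i)) \<cdot> g (Suc (Suc i))"
      using i x(1,2) g' S' T' by simp
    also have "\<dots> = \<zero> (trm T (Suc (Suc i))) (tgt C x)"
      unfolding x(3) using i x(1) g' S' by simp
    finally obtain y where y: "y \<in> arrs C" "src C y = trm T i" "tgt C y = tgt C x" "x \<cdot> g (Suc i) = y \<cdot> diff T i"
      using right_d_exactD(3)[OF T2, of i "x \<cdot> g (Suc i)"] i x g' by auto
    have "(x \<cdot> g (Suc i)) \<cdot> f (Suc i) = y \<cdot> (f i \<cdot> diff S i)"
      unfolding y(4) using i y(1-3) f' T' by simp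
    moreover have "x \<cdot> (g (Suc i) \<cdot> f (Suc i)) = x \<oplus> x \<cdot> (s i \<cdot> diff S i)"
    proof -
      have "x \<cdot> (diff S (Suc i) \<cdot> s (Suc i)) = \<zero> (trm S (Suc i)) (tgt C x)"
        using cmp_reduce[OF x(3), of "s (Suc i)"] i x(1,2) s' S' by simp
      then show ?thesis unfolding s(2)[OF i] using i x(1,2) s' S' by simp
    qed
    ultimately have *: "x \<oplus> x \<cdot> (s i \<cdot> diff S i) = y \<cdot> (f i \<cdot> diff S i)"
      using i x(1,2) f' g' by simp
    have "x = (x \<oplus> x \<cdot> (s i \<cdot> diff S i)) \<oplus> \<ominus> (x \<cdot> (s i \<cdot> diff S i))"
      using i x(1,2) s' S' by simp
    also have "\<dots> = (y \<cdot> f i \<oplus> \<ominus> (x \<cdot> s i)) \<cdot> diff S i"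
      unfolding * using i x(1,2) y(1-3) f' s' S' by simp
    finally show "\<exists>y\<in>arrs C. src C y = trm S i \<and> tgt C y = tgt C x \<and> x = y \<cdot> diff S i"
      using i x(1,2) y(1-3) f' s' by (intro bexI[of _ "y \<cdot> f i \<oplus> \<ominus> (x \<cdot> s i)"]) simp_all
  qed
  then show ?thesis using S by (simp add: d_exact_def)
qed

end

section \<open>Classes closed under weak isomorphisms: membership read off from the last
  arrow\<close>

locale exact_class = preadditive_category +
  fixes d :: nat and X :: "('a, 'b) sequence set"
  assumes X_exact: "S \<in> X \<Longrightarrow> d_exact C d S"
    and X_closed: "closed_under_weak_isomorphisms C d X"
begin

lemma X_left: "S \<in> X \<Longrightarrow> left_d_exact C d S"
  and X_right: "S \<in> X \<Longrightarrow> right_d_exact C d S"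
  using X_exact by (auto simp: d_exact_def)

lemma X_complex: "S \<in> X \<Longrightarrow> complex C (Suc d) S"
  using X_left left_d_exactD(1) by blast

lemma weak_isomorphism_in_X:
  assumes "complex_morphism C (Suc d) S T h" "d_exact C d S" "d_exact C d T"
    "i \<le> d + 1" "is_iso C (h i)" "is_iso C (h ((i + 1) mod (d + 2)))"
  shows "S \<in> X \<longleftrightarrow> T \<in> X"
  using X_closed assms unfolding closed_under_weak_isomorphisms_def weak_isomorphism_def
  by (metis Suc_eq_plus1)

text \<open>The comparison morphism to \<open>V\<close> can be chosen as the identity at the
  adjacent indices 0 and 1, so it is a weak isomorphism as soon as \<open>S\<close> is known to be
  d-exact; that follows from mutual factorization by identities.\<close>

lemma in_X_if_same_epi:
  assumes V: "V \<in> X" and S: "left_d_exact C d S" and eq: "diff S 0 = diff V 0"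
  shows "S \<in> X"
proof -
  note S' = complexD[OF left_d_exactD(1)[OF S]] and V' = complexD[OF X_complex[OF V]]
  have t: "trm S 0 = trm V 0" "trm S 1 = trm V 1"
    using S'(3,4)[of 0] V'(3,4)[of 0] eq by simp_all
  have "d_exact C d S"
    by (rule left_d_exact_imp_d_exact[OF S X_exact[OF V], of "ident C (trm S 1)" "ident C (trm S 1)"])
      (use S' V' t eq in simp_all)
  moreover obtain f where f: "complex_morphism C (Suc d) S V f" "f 0 = ident C (trm S 0)" "f 1 = ident C (trm S 1)"
    by (rule extend_complex_morphism[OF left_d_exactD(1)[OF S] X_left[OF V],
          of "ident C (trm S 0)" "ident C (trm S 1)"])
      (use S' V' t eq in simp_all)
  ultimately show ?thesis
    using weak_isomorphism_in_X[OF f(1) _ X_exact[OF V], of 0] V S' by simp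
qed

end

section \<open>The opposite category\<close>

definition op_cat :: "('o, 'm) cat_data \<Rightarrow> ('o, 'm) cat_data" where
  "op_cat C = \<lparr>objs = objs C, arrs = arrs C, src = tgt C, tgt = src C, ident = ident C,
     cmp = (\<lambda>g f. cmp C f g), plus_arr = plus_arr C, zero_arr = (\<lambda>A B. zero_arr C B A)\<rparr>"

text \<open>Subtraction is truncated, so applying this twice returns the terms of \<open>S\<close>
  only up to index \<open>d + 1\<close>. The double opposite is therefore another representation of
  \<open>S\<close> and need not equal it.\<close>

definition op_seq :: "nat \<Rightarrow> ('o, 'm) sequence \<Rightarrow> ('o, 'm) sequence" where
  "op_seq d S = \<lparr>trm = (\<lambda>i. trm S (Suc d - i)), diff = (\<lambda>i. diff S (d - i))\<rparr>"

lemma op_cat_simps [simp]: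
  "objs (op_cat C) = objs C" "arrs (op_cat C) = arrs C" "src (op_cat C) = tgt C"
  "tgt (op_cat C) = src C" "ident (op_cat C) = ident C" "cmp (op_cat C) g f = cmp C f g"
  "plus_arr (op_cat C) = plus_arr C" "zero_arr (op_cat C) A B = zero_arr C B A"
  "op_cat (op_cat C) = C"
  by (simp_all add: op_cat_def)

lemma op_seq_simps [simp]:
  "trm (op_seq d S) i = trm S (Suc d - i)" "diff (op_seq d S) i = diff S (d - i)"
  by (simp_all add: op_seq_def)

lemma hom_set_op_cat [simp]: "hom_set (op_cat C) A B = hom_set C B A"
  by (auto simp: hom_set_def)

lemma hom_group_op_cat [simp]: "hom_group (op_cat C) A B = hom_group C B A"
  by (simp add: hom_group_def)

lemma is_iso_op_cat [simp]: "is_iso (op_cat C) f \<longleftrightarrow> is_iso C f"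
  by (auto simp: is_iso_def)

lemma (in preadditive_category) preadditive_op_cat: "preadditive_category (op_cat C)"
  by (intro preadditive_category.intro category.intro preadditive_category_axioms.intro)
    (simp_all add: hom_comm_group)

lemma complex_op_seq:
  assumes "complex C (Suc d) S"
  shows "complex (op_cat C) (Suc d) (op_seq d S)"
proof -
  have "diff S (d - i) \<in> hom_set C (trm S (Suc d - i)) (trm S (d - i))" if "i \<le> d" for i
    using assms that unfolding complex_def by (metis Suc_diff_le diff_le_self le_imp_less_Suc)
  moreover have "diff S (d - Suc i) \<cdot>\<^bsub>C\<^esub> diff S (d - i) = zero_arr C (trm S (Suc d - i)) (trm S (d - Suc i))"
    if "i < d" for i
  proof -
    have "d - i = Suc (d - Suc i)" "Suc d - i = Suc (Suc (d - Suc i))" using that by auto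
    then show ?thesis using assms that unfolding complex_def by (metis Suc_diff_Suc diff_less_Suc less_Suc_eq Suc_mono)
  qed
  ultimately show ?thesis using assms by (auto simp: complex_def)
qed

lemma complex_morphism_op_seq:
  assumes "complex_morphism C (Suc d) S T h"
  shows "complex_morphism (op_cat C) (Suc d) (op_seq d T) (op_seq d S) (\<lambda>i. h (Suc d - i))"
proof -
  have "h (d - i) \<cdot>\<^bsub>C\<^esub> diff S (d - i) = diff T (d - i) \<cdot>\<^bsub>C\<^esub> h (Suc d - i)" if "i \<le> d" for i
    using assms that unfolding complex_morphism_def by (metis Suc_diff_le diff_le_self le_imp_less_Suc)
  then show ?thesis
    using assms complex_op_seq[of C d] by (auto simp: complex_morphism_def)
qed

lemma op_seq_exact:
  assumes "preadditive_category C"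
  shows "right_d_exact C d S \<Longrightarrow> left_d_exact (op_cat C) d (op_seq d S)"
    and "left_d_exact C d S \<Longrightarrow> right_d_exact (op_cat C) d (op_seq d S)"
proof -
  interpret preadditive_category C by fact
  interpret O: preadditive_category "op_cat C" by (rule preadditive_op_cat)
  \<comment> \<open>Exactness of the opposite at index \<open>i + 1\<close> is exactness of
    \<open>S\<close> at index \<open>Suc (d - Suc i)\<close>.\<close>
  have idx: "Suc d - i = Suc (d - i)" "d - i = Suc (d - Suc i)" "d - Suc i < d" if "i < d" for i
    using that by auto
  show "left_d_exact (op_cat C) d (op_seq d S)" if S: "right_d_exact C d S"
  proof (rule O.left_d_exactI[OF complex_op_seq[OF right_d_exactD(1)[OF S]]], goal_cases)
    case (1 x)
    then show ?case using right_d_exactD(2)[OF S, of x] by simp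
  next
    case (2 i x)
    then show ?case
      using right_d_exactD(3)[OF S, of "d - Suc i" x] idx[of i] by auto
  qed
  show "right_d_exact (op_cat C) d (op_seq d S)" if S: "left_d_exact C d S"
  proof (rule O.right_d_exactI[OF complex_op_seq[OF left_d_exactD(1)[OF S]]], goal_cases)
    case (1 x)
    then show ?case using left_d_exactD(2)[OF S, of x] by simp
  next
    case (2 i x)
    then show ?case
      using left_d_exactD(3)[OF S, of "d - Suc i" x] idx[of i] by auto
  qed
qed

lemma d_exact_op_seq:
  "preadditive_category C \<Longrightarrow> d_exact C d S \<Longrightarrow> d_exact (op_cat C) d (op_seq d S)"
  by (simp add: d_exact_def op_seq_exact)

lemma d_exact_cong:
  assumes "\<And>i. i \<le> Suc d \<Longrightarrow> trm S i = trm T i" "\<And>i. i \<le> d \<Longrightarrow> diff S i = diff T i"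
    and S: "d_exact C d S"
  shows "d_exact C d T"
proof -
  have "complex C (Suc d) T"
    using S assms(1,2) by (auto simp: d_exact_def left_d_exact_def complex_def)
  then show ?thesis
    using S by (simp add: d_exact_def left_d_exact_def right_d_exact_def assms(1,2)[symmetric])
qed

lemma d_exact_op_op: "d_exact C d (op_seq d (op_seq d S)) \<longleftrightarrow> d_exact C d S"
  using d_exact_cong[of d S "op_seq d (op_seq d S)" C] d_exact_cong[of d "op_seq d (op_seq d S)" S C]
  by auto

context preadditive_category
begin

lemma complex_morphism_op_op:
  assumes "complex C (Suc d) S"
  shows "complex_morphism C (Suc d) S (op_seq d (op_seq d S)) (\<lambda>i. ident C (trm S i))"
proof -
  have "complex C (Suc d) (op_seq d (op_seq d S))"
    using complex_op_seq[OF complex_op_seq[OF assms]] by simp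
  then show ?thesis using assms complexD[OF assms] by (auto simp: complex_morphism_def)
qed

text \<open>The comparison lemma in the opposite category, read back along
  \<open>i \<mapsto> d + 1 - i\<close>: the data now sit at the left end, and it is the source that
  has to be exact.\<close>

lemma extend_complex_morphism_right:
  assumes S: "right_d_exact C d S" and T: "complex C (Suc d) T"
    and f0: "f0 \<in> hom_set C (trm S (Suc d)) (trm T (Suc d))" and f1: "f1 \<in> hom_set C (trm S d) (trm T d)"
    and sq: "f1 \<cdot> diff S d = diff T d \<cdot> f0"
  obtains f where "\<And>i. i \<le> Suc d \<Longrightarrow> f i \<in> hom_set C (trm S i) (trm T i)"
    "\<And>i. i \<le> d \<Longrightarrow> f i \<cdot> diff S i = diff T i \<cdot> f (Suc i)" "f (Suc d) = f0" "f d = f1"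
proof -
  interpret O: preadditive_category "op_cat C" by (rule preadditive_op_cat)
  obtain f where f: "complex_morphism (op_cat C) (Suc d) (op_seq d T) (op_seq d S) f" "f 0 = f0" "f 1 = f1"
    by (rule O.extend_complex_morphism[OF complex_op_seq[OF T] op_seq_exact(1)[OF preadditive_category_axioms S],
          of f0 f1])
      (use f0 f1 sq in auto)
  note f' = O.complex_morphismD[OF f(1)]
  show thesis
  proof (rule that[of "\<lambda>i. f (Suc d - i)"])
    show "f (Suc d - i) \<in> hom_set C (trm S i) (trm T i)" if "i \<le> Suc d" for i
      using f'(3-5)[of "Suc d - i"] that by simp
    show "f (Suc d - i) \<cdot> diff S i = diff T i \<cdot> f (Suc d - Suc i)" if "i \<le> d" for i
      using f'(6)[of "d - i"] that by (simp add: Suc_diff_le)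
  qed (use f(2,3) in auto)
qed

end

section \<open>The dual class: membership read off from the first arrow\<close>

context exact_class
begin

text \<open>The identities form a weak isomorphism between the two representations.\<close>

lemma op_seq_op_seq_in_X:
  assumes "d_exact C d S"
  shows "S \<in> X \<longleftrightarrow> op_seq d (op_seq d S) \<in> X"
proof -
  have S: "complex C (Suc d) S" using assms by (simp add: d_exact_def left_d_exactD(1))
  have "d_exact C d (op_seq d (op_seq d S))"
    using assms by (simp add: d_exact_op_op)
  then show ?thesis
    by (rule weak_isomorphism_in_X[OF complex_morphism_op_op[OF S] assms, of 0])
      (use complexD[OF S] in auto)
qed

text \<open>The dual class is a preimage under \<open>op_seq d\<close> and not an image, so that it
  contains all representations of a sequence, whatever their values out of range. As
  \<open>exact_class\<close> asks only for a preadditive category, the dual is again an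
  instance.\<close>

lemma exact_class_op: "exact_class (op_cat C) d {S. op_seq d S \<in> X}"
proof -
  interpret O: preadditive_category "op_cat C" by (rule preadditive_op_cat)
  note dC = d_exact_op_seq[OF preadditive_category_axioms]
  note dO = d_exact_op_seq[OF O.preadditive_category_axioms, simplified]
  show ?thesis
  proof (unfold_locales, goal_cases)
    case (1 S)
    then have "d_exact (op_cat C) d (op_seq d (op_seq d S))" by (auto intro!: dC X_exact)
    then show ?case by (simp add: d_exact_op_op)
  next
    case 2
    show ?case
      unfolding closed_under_weak_isomorphisms_def
    proof (intro allI impI)
      fix S T h assume "weak_isomorphism (op_cat C) d S T h"
      then obtain i where ST: "d_exact (op_cat C) d S" "d_exact (op_cat C) d T"
        and h: "complex_morphism (op_cat C) (Suc d) S T h"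
        and i: "i \<le> d + 1" "is_iso C (h i)" "is_iso C (h ((i + 1) mod (d + 2)))"
        unfolding weak_isomorphism_def by auto
      \<comment> \<open>The isomorphisms at \<open>i\<close> and \<open>i + 1\<close> move to
        \<open>d + 1 - i\<close> and \<open>d - i\<close>, so the adjacent pair starts at
        \<open>d - i\<close>. The wrap-around pair of indices \<open>d + 1\<close> and 0 is
        exchanged with itself and starts again at \<open>d + 1\<close>.\<close>
      define j where "j = (if i \<le> d then d - i else d + 1)"
      have "Suc d - j = (i + 1) mod (d + 2)" "Suc d - (j + 1) mod (d + 2) = i" "j \<le> d + 1"
        using i(1) by (auto simp: j_def le_Suc_eq mod_Suc)
      then have "op_seq d T \<in> X \<longleftrightarrow> op_seq d S \<in> X"
        using weak_isomorphism_in_X[OF complex_morphism_op_seq[OF h, simplified] dO[OF ST(2)] dO[OF ST(1)], of j] i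
        by simp
      then show "S \<in> {S. op_seq d S \<in> X} \<longleftrightarrow> T \<in> {S. op_seq d S \<in> X}" by auto
    qed
  qed
qed

text \<open>This is \<open>in_X_if_same_epi\<close> for the dual class. What it yields is membership
  of \<open>op_seq d (op_seq d S)\<close>, which is then exchanged for \<open>S\<close>.\<close>

lemma in_X_if_same_mono:
  assumes V: "V \<in> X" and S: "right_d_exact C d S" and eq: "diff S d = diff V d"
  shows "S \<in> X"
proof -
  interpret O: exact_class "op_cat C" d "{S. op_seq d S \<in> X}" by (rule exact_class_op)
  have "op_seq d V \<in> {S. op_seq d S \<in> X}"
    using op_seq_op_seq_in_X[OF X_exact[OF V]] V by simp
  then have S': "op_seq d S \<in> {S. op_seq d S \<in> X}"
    by (rule O.in_X_if_same_epi[OF _ op_seq_exact(1)[OF preadditive_category_axioms S]]) (simp add: eq)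
  then have "d_exact C d S" using X_exact d_exact_op_op by blast
  then show ?thesis using op_seq_op_seq_in_X S' by blast
qed

end

section \<open>Admissible epimorphisms up to mutual factorization\<close>

context preadditive_category
begin

text \<open>Up to the automorphism \<open>(x, y) \<mapsto> (x - u y, y)\<close> of \<open>S\<^sub>1 \<oplus> D\<close>, this is the direct sum of \<open>S\<close>
  with the identity of \<open>D\<close> in degrees 2 and 1. It is set up for \<open>e = - diff S 0 \<cdot> u\<close>.\<close>

definition stabilize ::
    "('a, 'b) biproduct_data \<Rightarrow> ('a, 'b) biproduct_data \<Rightarrow> 'b \<Rightarrow> 'b \<Rightarrow> ('a, 'b) sequence \<Rightarrow> ('a, 'b) sequence"
  where
  "stabilize B B' e u S =
     \<lparr>trm = (\<lambda>i. if i = 1 then bip_obj B else if i = 2 then bip_obj B' else trm S i),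
      diff = (\<lambda>i. if i = 0 then copair B (diff S 0) e
                  else if i = 1 then pair B (copair B' (diff S 1) u) (proj2 B')
                  else if i = 2 then inj1 B' \<cdot> diff S 2
                  else diff S i)\<rparr>"

lemma stabilize_simps [simp]:
  "trm (stabilize B B' e u S) 0 = trm S 0"
  "trm (stabilize B B' e u S) 1 = bip_obj B"
  "trm (stabilize B B' e u S) (Suc 0) = bip_obj B"
  "trm (stabilize B B' e u S) (Suc (Suc 0)) = bip_obj B'"
  "trm (stabilize B B' e u S) (Suc (Suc (Suc i))) = trm S (Suc (Suc (Suc i)))"
  "diff (stabilize B B' e u S) 0 = copair B (diff S 0) e"
  "diff (stabilize B B' e u S) (Suc 0) = pair B (copair B' (diff S 1) u) (proj2 B')"
  "diff (stabilize B B' e u S) (Suc (Suc 0)) = inj1 B' \<cdot> diff S (Suc (Suc 0))"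
  "diff (stabilize B B' e u S) (Suc (Suc (Suc i))) = diff S (Suc (Suc (Suc i)))"
  by (simp_all add: stabilize_def numeral_2_eq_2)

lemma inj1_eq_null:
  assumes "biprod B" "x \<in> arrs C" "src C x = A" "tgt C x = tgt C (proj1 B)"
    "inj1 B \<cdot> x = \<zero> A (bip_obj B)"
  shows "x = \<zero> A (tgt C (proj1 B))"
proof -
  have "x = proj1 B \<cdot> (inj1 B \<cdot> x)" using assms(1-4) by simp
  also have "\<dots> = \<zero> A (tgt C (proj1 B))" unfolding assms(5) using assms(1-4) by auto
  finally show ?thesis .
qed

context
  fixes S :: "('a, 'b) sequence" and d D B B' e u
  assumes S: "left_d_exact C d S" and d: "2 \<le> d"
    and B: "biprod B" "tgt C (proj1 B) = trm S 1" "tgt C (proj2 B) = D"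
    and B': "biprod B'" "tgt C (proj1 B') = trm S 2" "tgt C (proj2 B') = D"
    and e: "e \<in> hom_set C D (trm S 0)" and u: "u \<in> hom_set C D (trm S 1)"
    and eu: "e = \<ominus> (diff S 0 \<cdot> u)"
begin

private lemmas S' = complexD[OF left_d_exactD(1)[OF S]]

private lemma D_in_objs: "D \<in> objs C" using u by auto

private lemma less3_cases:
  obtains "i = 0" | "i = Suc 0" | "i = Suc (Suc 0)" | j where "i = Suc (Suc (Suc j))"
  by (metis nat.exhaust)

lemma complex_stabilize: "complex C (Suc d) (stabilize B B' e u S)"
proof -
  have "trm (stabilize B B' e u S) i \<in> objs C" if "i \<le> Suc d" for i
    by (rule less3_cases[of i]) (use that S' B B' in auto)
  moreover have "diff (stabilize B B' e u S) i
      \<in> hom_set C (trm (stabilize B B' e u S) (Suc i)) (trm (stabilize B B' e u S) i)" if "i < Suc d" for i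
    by (rule less3_cases[of i]) (use that d S' B B' e u in \<open>auto simp: numeral_2_eq_2\<close>)
  moreover have "diff (stabilize B B' e u S) i \<cdot> diff (stabilize B B' e u S) (Suc i)
      = \<zero> (trm (stabilize B B' e u S) (Suc (Suc i))) (trm (stabilize B B' e u S) i)" if "i < d" for i
  proof (rule less3_cases[of i])
    assume i: "i = 0"
    have "copair B (diff S 0) e \<cdot> pair B (copair B' (diff S 1) u) (proj2 B')
        = diff S 0 \<cdot> copair B' (diff S 1) u \<oplus> e \<cdot> proj2 B'"
      using d S' B B' e u by (simp add: numeral_2_eq_2 del: cmp_copair)
    \<comment> \<open>The contributions of \<open>u\<close> and \<open>e\<close> cancel by the
      choice of \<open>e\<close>.\<close>
    also have "\<dots> = \<zero> (bip_obj B') (trm S 0)"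
      unfolding eu using d S' B B' e u complex_cmp_null[OF left_d_exactD(1)[OF S], of 0 "proj1 B'"]
      by (simp add: numeral_2_eq_2 copair_def)
    finally show ?thesis using i by simp
  next
    assume i: "i = Suc 0"
    have "(copair B' (diff S 1) u) \<cdot> (inj1 B' \<cdot> diff S (Suc (Suc 0))) = diff S 1 \<cdot> diff S (Suc (Suc 0))"
      using d S' B' u by (simp add: cmp_reduce[of _ _ "diff S (Suc 0)"] numeral_2_eq_2)
    then show ?thesis
      using i d that S' B B' u D_in_objs by (simp add: numeral_2_eq_2)
  next
    assume "i = Suc (Suc 0)"
    then show ?thesis using that S' B B' by (simp add: numeral_2_eq_2)
  next
    fix j assume "i = Suc (Suc (Suc j))"
    then show ?thesis using that S' by simp
  qed
  ultimately show ?thesis by (auto simp: complex_def)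
qed

text \<open>In components: \<open>(a, b)\<close> is a cycle at index 1 iff \<open>a - u b\<close> is
  a cycle of \<open>S\<close>, and a lift \<open>c\<close> of the latter gives the lift
  \<open>(c, b)\<close>. At index 2 the second component of the arrow forces \<open>b\<close> to
  vanish, so only a cycle of \<open>S\<close> remains.\<close>

lemma left_d_exact_stabilize: "left_d_exact C d (stabilize B B' e u S)"
proof (rule left_d_exactI[OF complex_stabilize], goal_cases)
  case (1 x)
  obtain j where j: "d = Suc (Suc j)"
    using le_Suc_ex[OF d] by auto
  \<comment> \<open>For \<open>d = 2\<close> the leftmost arrow is the altered one,
    \<open>inj1 B' \<cdot> diff S 2\<close>, and the monic injection has to be cancelled
    first.\<close>
  have "diff S d \<cdot> x = \<zero> (src C x) (trm S d)"
  proof (cases j)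
    case 0
    then show ?thesis
      using inj1_eq_null[OF B'(1), of "diff S 2 \<cdot> x" "src C x"] 1 j S' B' by (simp add: numeral_2_eq_2)
  next
    case (Suc k)
    then show ?thesis using 1 j by simp
  qed
  then have "x = \<zero> (src C x) (trm S (Suc d))"
    by (intro left_d_exactD(2)[OF S]) (use 1 j in simp_all)
  then show ?case unfolding j stabilize_simps .
next
  case (2 i x)
  note x = 2(2-4)
  show ?case
  proof (rule less3_cases[of i])
    assume i: "i = 0"
    have t: "tgt C x = bip_obj B" using x(2) i by simp
    define a b where "a = proj1 B \<cdot> x" and "b = proj2 B \<cdot> x"
    have x_eq: "x = pair B a b" by (simp only: a_def b_def pair_eta[OF B(1) x(1) t])
    have ab: "a \<in> arrs C" "b \<in> arrs C" "src C a = src C x"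
      "src C b = src C x" "tgt C a = trm S 1" "tgt C b = D"
      using x(1) t B by (simp_all add: a_def b_def)
    have "diff S 0 \<cdot> (a \<oplus> \<ominus> (u \<cdot> b)) = copair B (diff S 0) e \<cdot> pair B a b"
      using ab eu e S' B u d by simp
    also have "\<dots> = \<zero> (src C x) (trm S 0)" using x i by (simp flip: x_eq)
    finally obtain c where c: "c \<in> arrs C" "src C c = src C x" "tgt C c = trm S 2"
      "a \<oplus> \<ominus> (u \<cdot> b) = diff S 1 \<cdot> c"
      using left_d_exactD(3)[OF S, of 0 "a \<oplus> \<ominus> (u \<cdot> b)"] ab d S' u by (auto simp: numeral_2_eq_2)
    have "diff S 1 \<cdot> c \<oplus> u \<cdot> b = a"
      unfolding c(4)[symmetric] using ab u by simp
    then have "pair B a b = pair B (copair B' (diff S 1) u) (proj2 B') \<cdot> pair B' c b"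
      using ab c(1-3) B B' S' u d by (simp add: numeral_2_eq_2)
    then have *: "x = diff (stabilize B B' e u S) (Suc i) \<cdot> pair B' c b"
      unfolding x_eq i by simp
    show ?thesis
      by (intro bexI[of _ "pair B' c b"] conjI *) (use i c(1-3) ab B' in simp_all)
  next
    assume i: "i = Suc 0"
    have t: "tgt C x = bip_obj B'" using x(2) i by simp
    define a b where "a = proj1 B' \<cdot> x" and "b = proj2 B' \<cdot> x"
    have x_eq: "x = pair B' a b" by (simp only: a_def b_def pair_eta[OF B'(1) x(1) t])
    have ab: "a \<in> arrs C" "b \<in> arrs C" "src C a = src C x"
      "src C b = src C x" "tgt C a = trm S 2" "tgt C b = D"
      using x(1) t B' by (simp_all add: a_def b_def)
    have "pair B (diff S 1 \<cdot> a \<oplus> u \<cdot> b) b = pair B (copair B' (diff S 1) u) (proj2 B') \<cdot> pair B' a b"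
      using ab B B' S' u d by (simp add: numeral_2_eq_2)
    also have "\<dots> = \<zero> (src C x) (bip_obj B)" using x i by (simp flip: x_eq)
    finally have *: "pair B (diff S 1 \<cdot> a \<oplus> u \<cdot> b) b = \<zero> (src C x) (bip_obj B)" .
    have "diff S 1 \<cdot> a \<oplus> u \<cdot> b = \<zero> (src C x) (tgt C (proj1 B)) \<and> b = \<zero> (src C x) (tgt C (proj2 B))"
      by (rule iffD1[OF pair_eq_null *]) (use ab B S' u d in \<open>simp_all add: numeral_2_eq_2\<close>)
    then have b: "b = \<zero> (src C x) D" and *: "diff S 1 \<cdot> a \<oplus> u \<cdot> b = \<zero> (src C x) (trm S 1)"
      using B by auto
    have "diff S 1 \<cdot> a = \<zero> (src C x) (trm S 1)"
      using * ab S' u d x(1) unfolding b by (simp add: numeral_2_eq_2)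
    then obtain c where c: "c \<in> arrs C" "src C c = src C x" "tgt C c = trm S (Suc (Suc (Suc 0)))"
      "a = diff S 2 \<cdot> c"
      using left_d_exactD(3)[OF S, of 1 a] ab d by (auto simp: numeral_2_eq_2)
    have "pair B' a b = inj1 B' \<cdot> (diff S 2 \<cdot> c)"
      unfolding b c(4) using c(1-3) x(1) B' S' d by (simp add: pair_def numeral_2_eq_2)
    then have *: "x = diff (stabilize B B' e u S) (Suc i) \<cdot> c"
      unfolding x_eq i using c(1-3) B' S' d by (simp add: numeral_2_eq_2)
    show ?thesis
      by (intro bexI[of _ c] conjI *) (use i c(1-3) in simp_all)
  next
    assume i: "i = Suc (Suc 0)"
    have "diff S 2 \<cdot> x = \<zero> (src C x) (trm S 2)"
      using inj1_eq_null[OF B'(1), of "diff S 2 \<cdot> x" "src C x"] x i 2(1) S' B' by (simp add: numeral_2_eq_2)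
    then show ?thesis using left_d_exactD(3)[OF S, of 2 x] x i 2(1) by (auto simp: numeral_2_eq_2)
  next
    fix j assume "i = Suc (Suc (Suc j))"
    then show ?thesis using left_d_exactD(3)[OF S, of i x] x 2(1) by auto
  qed
qed

lemma complex_morphism_stabilize:
  "complex_morphism C (Suc d) S (stabilize B B' e u S)
     (\<lambda>i. if i = 1 then inj1 B else if i = 2 then inj1 B' else ident C (trm S i))" (is "complex_morphism _ _ _ _ ?h")
proof -
  have "?h i \<in> hom_set C (trm S i) (trm (stabilize B B' e u S) i)" if "i \<le> Suc d" for i
    by (rule less3_cases[of i]) (use that S' B B' in \<open>auto simp: numeral_2_eq_2\<close>)
  moreover have "?h i \<cdot> diff S i = diff (stabilize B B' e u S) i \<cdot> ?h (Suc i)" if "i < Suc d" for i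
    by (rule less3_cases[of i]) (use that d S' B B' e u D_in_objs in \<open>auto simp: numeral_2_eq_2 pair_def\<close>)
  ultimately show ?thesis
    using left_d_exactD(1)[OF S] complex_stabilize by (auto simp: complex_morphism_def)
qed

end

end

lemma (in additive_category) biproduct_simps:
  assumes "A \<in> objs C" "B \<in> objs C"
  shows "biprod (biproduct C A B)" "tgt C (proj1 (biproduct C A B)) = A"
    "tgt C (proj2 (biproduct C A B)) = B"
proof -
  have "is_biproduct C A B (biproduct C A B)"
    unfolding biproduct_def using biproduct_exists[OF assms] by (rule someI_ex)
  then show "biprod (biproduct C A B)" "tgt C (proj1 (biproduct C A B)) = A"
    "tgt C (proj2 (biproduct C A B)) = B"
    by (rule biprodI)+
qed

section \<open>Stabilization and mutual factorization inside the class\<close>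

locale additive_exact_class = exact_class C d X + additive_category C
  for C :: "('a, 'b) cat_data" (structure) and d X +
  assumes two_le_d: "2 \<le> d"
begin

text \<open>The inclusion of \<open>S\<close> is the identity at indices \<open>d + 1\<close> and 0,
  which are cyclically adjacent, so it is a weak isomorphism. Here \<open>2 \<le> d\<close> keeps
  the left end away from the altered indices 1 and 2.\<close>

lemma stabilize_in_X_iff:
  assumes S: "left_d_exact C d S"
    and B: "biprod B" "tgt C (proj1 B) = trm S 1" "tgt C (proj2 B) = D"
    and B': "biprod B'" "tgt C (proj1 B') = trm S 2" "tgt C (proj2 B') = D"
    and e: "e \<in> hom_set C D (trm S 0)" and u: "u \<in> hom_set C D (trm S 1)"
    and eu: "e = \<ominus> (diff S 0 \<cdot> u)" and ex: "d_exact C d S" "d_exact C d (stabilize B B' e u S)"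
  shows "S \<in> X \<longleftrightarrow> stabilize B B' e u S \<in> X"
  by (rule weak_isomorphism_in_X[OF complex_morphism_stabilize[OF S two_le_d B B' e u eu] ex, of "d + 1"])
    (use complexD[OF left_d_exactD(1)[OF S]] two_le_d in auto)

text \<open>Both sequences are stabilized so that they end in the same epimorphism
  \<open>W\<^sub>1 \<oplus> P\<^sub>1 \<rightarrow> P\<^sub>0\<close>.\<close>

lemma in_X_if_epis_factor:
  assumes W: "W \<in> X" and P: "left_d_exact C d P" and eq0: "trm P 0 = trm W 0"
    and a: "a \<in> hom_set C (trm P 1) (trm W 1)" "diff P 0 = diff W 0 \<cdot> a"
    and b: "b \<in> hom_set C (trm W 1) (trm P 1)" "diff W 0 = diff P 0 \<cdot> b"
  shows "P \<in> X"
proof -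
  note W' = complexD[OF X_complex[OF W]] and P' = complexD[OF left_d_exactD(1)[OF P]]
  have one: "1 \<le> Suc d" "2 \<le> Suc d" using two_le_d by auto
  note WP1 = biproduct_simps[OF W'(1)[OF one(1)] P'(1)[OF one(1)]]
    and WP2 = biproduct_simps[OF W'(1)[OF one(2)] P'(1)[OF one(1)]]
    and PW2 = biproduct_simps[OF P'(1)[OF one(2)] W'(1)[OF one(1)]]
  define B where "B = biproduct C (trm W 1) (trm P 1)"
  have B: "biprod B" "tgt C (proj1 B) = trm W 1" "tgt C (proj2 B) = trm P 1"
    using WP1 by (simp_all add: B_def)
  have Bs: "biprod (swap_biprod B)" "tgt C (proj1 (swap_biprod B)) = trm P 1"
    "tgt C (proj2 (swap_biprod B)) = trm W 1"
    using swap_biprod[OF B(1)] B by (simp_all add: swap_biprod_def)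
  \<comment> \<open>Taking \<open>\<ominus> a\<close> for \<open>u\<close> turns the extra entry
    \<open>e\<close> into \<open>diff P 0\<close>, and \<open>\<ominus> b\<close> likewise gives
    \<open>diff W 0\<close>. Both stabilizations then end in a row with the entries
    \<open>diff W 0\<close> and \<open>diff P 0\<close>.\<close>
  have a': "\<ominus> a \<in> hom_set C (trm P 1) (trm W 1)" "diff P 0 \<in> hom_set C (trm P 1) (trm W 0)"
    "diff P 0 = \<ominus> (diff W 0 \<cdot> \<ominus> a)"
    using a W' P' eq0 by simp_all
  have b': "\<ominus> b \<in> hom_set C (trm W 1) (trm P 1)" "diff W 0 \<in> hom_set C (trm W 1) (trm P 0)"
    "diff W 0 = \<ominus> (diff P 0 \<cdot> \<ominus> b)"
    using b W' P' eq0 by simp_all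
  define SW where "SW = stabilize B (biproduct C (trm W 2) (trm P 1)) (diff P 0) (\<ominus> a) W"
  \<comment> \<open>With the summands exchanged, the entries fit the same object in the same way, so
    \<open>SP\<close> and \<open>SW\<close> end in equal arrows and \<open>in_X_if_same_epi\<close>
    applies.\<close>
  define SP where "SP = stabilize (swap_biprod B) (biproduct C (trm P 2) (trm W 1)) (diff W 0) (\<ominus> b) P"
  have P_exact: "d_exact C d P"
    by (rule left_d_exact_imp_d_exact[OF P X_exact[OF W] eq0 a b])
  have SW_left: "left_d_exact C d SW"
    unfolding SW_def by (rule left_d_exact_stabilize[OF X_left[OF W] two_le_d B WP2 a'(2,1,3)])
  have SP_left: "left_d_exact C d SP"
    unfolding SP_def by (rule left_d_exact_stabilize[OF P two_le_d Bs PW2 b'(2,1,3)])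
  have SW0: "diff SW 0 = copair B (diff W 0) (diff P 0)" "trm SW 0 = trm W 0" "trm SW 1 = bip_obj B"
    by (simp_all add: SW_def)
  have SP0: "diff SP 0 = copair B (diff W 0) (diff P 0)" "trm SP 0 = trm W 0" "trm SP 1 = bip_obj B"
    using W' P' B eq0 by (simp_all add: SP_def swap_biprod_def copair_def add_commute)
  have SW_exact: "d_exact C d SW"
  proof (rule left_d_exact_imp_d_exact[OF SW_left X_exact[OF W] SW0(2)])
    \<comment> \<open>The row \<open>(1, a)\<close> and the first injection make the last arrows of
      \<open>SW\<close> and \<open>W\<close> factor through each other.\<close>
    let ?c = "copair B (ident C (trm W 1)) a"
    show "?c \<in> hom_set C (trm SW 1) (trm W 1)" using a B W' SW0 by simp
    show "diff SW 0 = diff W 0 \<cdot> ?c" using a B W' SW0 by simp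
    show "inj1 B \<in> hom_set C (trm W 1) (trm SW 1)" using B SW0 by simp
    show "diff W 0 = diff SW 0 \<cdot> inj1 B" using B W' P' eq0 SW0 by simp
  qed
  have "SW \<in> X"
    using stabilize_in_X_iff[OF X_left[OF W] B WP2 a'(2,1,3) X_exact[OF W]] SW_exact W
    by (simp add: SW_def)
  then have "SP \<in> X" by (rule in_X_if_same_epi[OF _ SP_left]) (simp add: SW0 SP0)
  then show "P \<in> X"
    using stabilize_in_X_iff[OF P Bs PW2 b'(2,1,3) P_exact] X_exact[of SP]
    by (simp add: SP_def)
qed

end

section \<open>Mapping cones, pushouts and pullbacks\<close>

context additive_category
begin

text \<open>Numbered by its first summand, this is the cone's term of index \<open>j + 1\<close>;
  the shift avoids the subtraction in \<open>mapping_cone\<close>.\<close>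

definition cone_biprod :: "('a, 'b) sequence \<Rightarrow> ('a, 'b) sequence \<Rightarrow> nat \<Rightarrow> ('a, 'b) biproduct_data" where
  "cone_biprod S T j = biproduct C (trm S j) (trm T (Suc j))"

lemma mapping_cone_simps:
  "trm (mapping_cone C d S T h) 0 = trm T 0"
  "trm (mapping_cone C d S T h) (Suc d) = trm S d"
  "j < d \<Longrightarrow> trm (mapping_cone C d S T h) (Suc j) = bip_obj (cone_biprod S T j)"
  "diff (mapping_cone C d S T h) 0 = copair (cone_biprod S T 0) (h 0) (diff T 0)"
  "d = Suc j \<Longrightarrow> diff (mapping_cone C d S T h) d = pair (cone_biprod S T j) (\<ominus> (diff S j)) (h d)"
  "Suc j < d \<Longrightarrow> diff (mapping_cone C d S T h) (Suc j)
     = pair (cone_biprod S T j) (\<ominus> (diff S j) \<cdot> proj1 (cone_biprod S T (Suc j)))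
         (copair (cone_biprod S T (Suc j)) (h (Suc j)) (diff T (Suc j)))"
  by (simp_all add: mapping_cone_def Let_def cone_biprod_def pair_def copair_def)

context
  fixes d S T h
  assumes h: "complex_morphism C d S T h"
begin

private lemmas cone_h = complex_morphismD[OF h]
private lemmas cone_S = complexD[OF complex_morphismD(1)[OF h]]
private lemmas cone_T = complexD[OF complex_morphismD(2)[OF h]]

lemma cone_biprod:
  assumes "j < d"
  shows "biprod (cone_biprod S T j)" "tgt C (proj1 (cone_biprod S T j)) = trm S j"
    "tgt C (proj2 (cone_biprod S T j)) = trm T (Suc j)"
  using biproduct_simps[of "trm S j" "trm T (Suc j)"] assms cone_S cone_T by (simp_all add: cone_biprod_def)

lemma cone_diff_0_pair:
  assumes "0 < d" "s \<in> hom_set C W (trm S 0)" "t \<in> hom_set C W (trm T 1)"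
  shows "diff (mapping_cone C d S T h) 0 \<cdot> pair (cone_biprod S T 0) s t = h 0 \<cdot> s \<oplus> diff T 0 \<cdot> t"
  using assms cone_h cone_S cone_T cone_biprod[of 0] by (simp add: mapping_cone_simps)

lemma cone_diff_Suc_pair:
  assumes "Suc j < d" "s \<in> hom_set C W (trm S (Suc j))" "t \<in> hom_set C W (trm T (Suc (Suc j)))"
  shows "diff (mapping_cone C d S T h) (Suc j) \<cdot> pair (cone_biprod S T (Suc j)) s t
    = pair (cone_biprod S T j) (\<ominus> (diff S j \<cdot> s)) (h (Suc j) \<cdot> s \<oplus> diff T (Suc j) \<cdot> t)"
  using assms cone_h cone_S cone_T cone_biprod[of j] cone_biprod[of "Suc j"] by (simp add: mapping_cone_simps)

lemma cone_diff_last: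
  assumes "d = Suc j" "s \<in> hom_set C W (trm S d)"
  shows "diff (mapping_cone C d S T h) d \<cdot> s = pair (cone_biprod S T j) (\<ominus> (diff S j \<cdot> s)) (h d \<cdot> s)"
  using assms cone_h cone_S cone_T cone_biprod[of j] by (simp add: mapping_cone_simps)

lemma cone_diff_0_inj:
  assumes "0 < d"
  shows "diff (mapping_cone C d S T h) 0 \<cdot> inj1 (cone_biprod S T 0) = h 0"
    "diff (mapping_cone C d S T h) 0 \<cdot> inj2 (cone_biprod S T 0) = diff T 0"
  using assms cone_h cone_S cone_T cone_biprod[of 0] by (simp_all add: mapping_cone_simps)

lemma cone_diff_Suc_inj2:
  assumes "Suc j < d"
  shows "diff (mapping_cone C d S T h) (Suc j) \<cdot> inj2 (cone_biprod S T (Suc j))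
    = inj2 (cone_biprod S T j) \<cdot> diff T (Suc j)"
  using assms cone_h cone_S cone_T cone_biprod[of j] cone_biprod[of "Suc j"]
  by (simp add: mapping_cone_simps pair_def)

lemma copair_cone_diff_Suc:
  assumes "Suc j < d" "a \<in> hom_set C (trm S j) W" "b \<in> hom_set C (trm T (Suc j)) W"
  shows "copair (cone_biprod S T j) a b \<cdot> diff (mapping_cone C d S T h) (Suc j)
    = copair (cone_biprod S T (Suc j)) (\<ominus> (a \<cdot> diff S j) \<oplus> b \<cdot> h (Suc j)) (b \<cdot> diff T (Suc j))"
  using assms cone_h cone_S cone_T cone_biprod[of j] cone_biprod[of "Suc j"]
  by (simp add: mapping_cone_simps copair_def)

end

lemma copair_null:
  assumes "biprod B" "W \<in> objs C"
  shows "copair B (\<zero> (tgt C (proj1 B)) W) (\<zero> (tgt C (proj2 B)) W) = \<zero> (bip_obj B) W"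
  using assms by (simp add: copair_def)

text \<open>If \<open>h\<^sub>0\<close> is an identity, the first two terms of the full cone of \<open>h\<close> cancel, and what is left
  is the cone of the truncation of \<open>h\<close>.\<close>

lemma left_d_exact_cone:
  assumes T: "left_d_exact C d T" and Z: "left_d_exact C d Z" and d: "2 \<le> d"
    and h: "complex_morphism C (Suc d) T Z h" and h0: "h 0 = ident C (trm T 0)"
    and P: "P = mapping_cone C d (drop_term0 T) (drop_term0 Z) (\<lambda>i. h (Suc i))"
    and P_complex: "complex C (Suc d) P"
  shows "left_d_exact C d P"
proof -
  note h' = complex_morphismD[OF h]
  note T' = complexD[OF h'(1)] and Z' = complexD[OF h'(2)]
  let ?T = "drop_term0 T" and ?Z = "drop_term0 Z" and ?h = "\<lambda>i. h (Suc i)"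
  have drop: "complex_morphism C d ?T ?Z ?h"
    using h by (auto simp: complex_morphism_def complex_def drop_term0_def)
  have drop_simps: "trm ?T i = trm T (Suc i)" "diff ?T i = diff T (Suc i)"
    "trm ?Z i = trm Z (Suc i)" "diff ?Z i = diff Z (Suc i)" for i
    by (simp_all add: drop_term0_def)
  let ?b = "cone_biprod ?T ?Z"
  note b = cone_biprod[OF drop, unfolded drop_simps]
  have Z0: "trm Z 0 = trm T 0" using h'(5)[of 0] h0 T' by simp
  show ?thesis
  proof (rule left_d_exactI[OF P_complex], goal_cases)
    case (1 x)
    obtain j where j: "d = Suc j" using d by (cases d) auto
    have x: "x \<in> arrs C" "tgt C x = trm T (Suc d)" using 1 by (simp_all add: P mapping_cone_simps drop_simps)
    have "pair (?b j) (\<ominus> (diff T d \<cdot> x)) (h (Suc d) \<cdot> x) = diff P d \<cdot> x"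
      using cone_diff_last[OF drop j, of x "src C x"] x by (simp add: drop_simps P j)
    also have "\<dots> = \<zero> (src C x) (bip_obj (?b j))"
      using 1 j by (simp add: P mapping_cone_simps)
    finally have "\<ominus> (diff T d \<cdot> x) = \<zero> (src C x) (trm T d)"
      using pair_eq_null[of "?b j" "\<ominus> (diff T d \<cdot> x)" "h (Suc d) \<cdot> x" "src C x"] x b[of j] j T' h' by simp
    then have "diff T d \<cdot> x = \<zero> (src C x) (trm T d)" using x T' by simp
    then have "x = \<zero> (src C x) (trm T (Suc d))" by (intro left_d_exactD(2)[OF T] x)
    then show ?case unfolding P mapping_cone_simps drop_simps .
  next
    case (2 i x)
    then have i: "i < d" and x: "x \<in> arrs C" by auto
    note bi = b[OF i]
    have tx: "tgt C x = bip_obj (?b i)" using 2 i by (simp add: P mapping_cone_simps)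
    define t z W where "t = proj1 (?b i) \<cdot> x" and "z = proj2 (?b i) \<cdot> x" and "W = src C x"
    have x_eq: "x = pair (?b i) t z" by (simp only: t_def z_def pair_eta[OF bi(1) x tx])
    have tz: "t \<in> arrs C" "z \<in> arrs C" "src C t = W" "src C z = W" "tgt C t = trm T (Suc i)"
      "tgt C z = trm Z (Suc (Suc i))"
      using x tx bi by (simp_all add: t_def z_def W_def)
    have W: "W \<in> objs C" using x by (simp add: W_def)
    have dx: "diff P i \<cdot> pair (?b i) t z = \<zero> W (trm P i)" using 2 by (simp flip: x_eq W_def)
    have "diff T i \<cdot> t = \<zero> W (trm T i) \<and> h (Suc i) \<cdot> t \<oplus> diff Z (Suc i) \<cdot> z = \<zero> W (trm Z (Suc i))"
    proof (cases i)
      case 0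
      \<comment> \<open>The last arrow of the cone gives only the second equation. The first follows
        by applying \<open>diff Z 0\<close>, because \<open>h 0\<close> is an identity.\<close>
      have hz: "h 1 \<cdot> t \<oplus> diff Z 1 \<cdot> z = \<zero> W (trm Z 1)"
        using cone_diff_0_pair[OF drop, of t W z] dx tz d 0
        by (simp add: P drop_simps mapping_cone_simps)
      have "diff T 0 \<cdot> t = diff Z 0 \<cdot> (h 1 \<cdot> t)"
        using complex_morphism_cmp[OF h, of 0 t] h0 tz T' 0 by simp
      also have "\<dots> = diff Z 0 \<cdot> (h 1 \<cdot> t \<oplus> diff Z 1 \<cdot> z)"
        using complex_cmp_null[OF h'(2), of 0 z] tz T' Z' h' d 0 W by simp
      also have "\<dots> = \<zero> W (trm T 0)" unfolding hz using W Z' Z0 by simp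
      finally show ?thesis using hz 0 by simp
    next
      case (Suc j)
      have "pair (?b j) (\<ominus> (diff T i \<cdot> t)) (h (Suc i) \<cdot> t \<oplus> diff Z (Suc i) \<cdot> z) = diff P i \<cdot> pair (?b i) t z"
        using cone_diff_Suc_pair[OF drop, of j t W z] tz i Suc by (simp add: P drop_simps)
      also have "\<dots> = \<zero> W (bip_obj (?b j))" unfolding dx using i Suc by (simp add: P mapping_cone_simps)
      finally have *: "pair (?b j) (\<ominus> (diff T i \<cdot> t)) (h (Suc i) \<cdot> t \<oplus> diff Z (Suc i) \<cdot> z) = \<zero> W (bip_obj (?b j))" .
      have "\<ominus> (diff T i \<cdot> t) = \<zero> W (tgt C (proj1 (?b j)))
          \<and> h (Suc i) \<cdot> t \<oplus> diff Z (Suc i) \<cdot> z = \<zero> W (tgt C (proj2 (?b j)))"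
        by (rule iffD1[OF pair_eq_null *]) (use b[of j] i Suc tz T' Z' h' in simp_all)
      then show ?thesis using b[of j] i Suc tz T' by simp
    qed
    then have t0: "diff T i \<cdot> t = \<zero> W (trm T i)"
      and hz: "h (Suc i) \<cdot> t \<oplus> diff Z (Suc i) \<cdot> z = \<zero> W (trm Z (Suc i))" by auto
    obtain t' where t': "t' \<in> arrs C" "src C t' = W" "tgt C t' = trm T (Suc (Suc i))" "t = diff T (Suc i) \<cdot> t'"
      using left_d_exactD(3)[OF T i tz(1)] tz(3,5) t0 by auto
    \<comment> \<open>Once \<open>t\<close> is lifted to \<open>t'\<close>, the corrected component
      \<open>?w\<close> is a cycle of \<open>Z\<close>. If \<open>z'\<close> lifts it,
      \<open>(- t', z')\<close> is the required preimage of \<open>(t, z)\<close>.\<close>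
    let ?w = "z \<oplus> h (Suc (Suc i)) \<cdot> t'"
    have w: "?w \<in> arrs C" "src C ?w = W" "tgt C ?w = trm Z (Suc (Suc i))"
      using t' tz h' i by simp_all
    have "diff Z (Suc i) \<cdot> ?w = h (Suc i) \<cdot> t \<oplus> diff Z (Suc i) \<cdot> z"
      unfolding t'(4) using complex_morphism_cmp[OF h, of "Suc i" t'] t'(1-3) tz(2,4,6) h' T' Z' i
      by (simp add: add_commute)
    then have w0: "diff Z (Suc i) \<cdot> ?w = \<zero> W (trm Z (Suc i))" unfolding hz .
    show ?case
    \<comment> \<open>At the left end the cone has the single summand \<open>trm T (Suc d)\<close>.
      There \<open>diff Z d\<close> is monic, so \<open>?w\<close> vanishes and \<open>- t'\<close>
      alone is the preimage.\<close>
    proof (cases "Suc i = d")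
      case True
      have "?w = \<zero> (src C ?w) (trm Z (Suc d))"
        by (rule left_d_exactD(2)[OF Z]) (use w w0 True in simp_all)
      then have "?w = \<zero> W (trm Z (Suc d))" unfolding w(2) .
      then have "h (Suc (Suc i)) \<cdot> t' \<oplus> z = \<zero> W (trm Z (Suc d))"
        using t' tz h' i add_commute[of z "h (Suc (Suc i)) \<cdot> t'"] by simp
      then have "\<ominus> (h (Suc (Suc i)) \<cdot> t') = z"
        using neg_unique[of "h (Suc (Suc i)) \<cdot> t'" z] t'(1-3) tz(2,4,6) h' i True by simp
      then have "diff P d \<cdot> (\<ominus> t') = pair (?b i) t z"
        using cone_diff_last[OF drop True[symmetric], of "\<ominus> t'" W] t' h' T' i True
        by (simp add: P drop_simps)
      then have *: "x = diff P (Suc i) \<cdot> (\<ominus> t')" unfolding x_eq True by (rule sym)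
      show ?thesis
        by (intro bexI[of _ "\<ominus> t'"] conjI *)
          (use t' True in \<open>simp_all add: P mapping_cone_simps drop_simps flip: W_def\<close>)
    next
      case False
      then have i': "Suc i < d" using i by simp
      obtain z' where z': "z' \<in> arrs C" "src C z' = W" "tgt C z' = trm Z (Suc (Suc (Suc i)))"
        "?w = diff Z (Suc (Suc i)) \<cdot> z'"
        using left_d_exactD(3)[OF Z i' w(1)] w(2,3) w0 by auto
      have "\<ominus> (h (Suc (Suc i)) \<cdot> t') \<oplus> diff Z (Suc (Suc i)) \<cdot> z' = z"
        unfolding z'(4)[symmetric] using t'(1-3) tz(2,4,6) h' i by (simp add: add_commute[of z])
      then have "diff P (Suc i) \<cdot> pair (?b (Suc i)) (\<ominus> t') z' = pair (?b i) t z"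
        using cone_diff_Suc_pair[OF drop i', of "\<ominus> t'" W z'] t' z'(1-3) h' T' i
        by (simp add: P drop_simps)
      then have *: "x = diff P (Suc i) \<cdot> pair (?b (Suc i)) (\<ominus> t') z'" unfolding x_eq by (rule sym)
      show ?thesis
        by (intro bexI[of _ "pair (?b (Suc i)) (\<ominus> t') z'"] conjI *)
          (use t' z'(1-3) b[OF i'] i' in \<open>simp_all add: P mapping_cone_simps flip: W_def\<close>)
    qed
  qed
qed

end

section \<open>Pullbacks, completed pushouts and their cones in the class\<close>

locale pre_d_exact_category = additive_exact_class +
  assumes E1op: "axiom_E1op C X" and E2: "axiom_E2 C d X" and E2op: "axiom_E2op C d X"
begin

text \<open>(E2)op makes only the last arrow of the pullback admissible, so \<open>V\<close> is a
  member of the class ending in that arrow. The lifting property is exactness of the cone at index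
  1; it is that of a weak pullback, with the second component correct up to an arrow through
  \<open>diff Y 1\<close>.\<close>

lemma pullback_exists:
  assumes Y: "Y \<in> X" and g: "g \<in> arrs C" "tgt C g = trm Y 0"
  obtains V k where "V \<in> X" "trm V 0 = src C g" "k \<in> hom_set C (trm V 1) (trm Y 1)"
    "g \<cdot> diff V 0 = diff Y 0 \<cdot> k"
    "\<And>W x y. x \<in> hom_set C W (src C g) \<Longrightarrow> y \<in> hom_set C W (trm Y 1) \<Longrightarrow> g \<cdot> x = diff Y 0 \<cdot> y \<Longrightarrow>
       \<exists>w \<in> hom_set C W (trm V 1). \<exists>t \<in> hom_set C W (trm Y 2).
         diff V 0 \<cdot> w = x \<and> k \<cdot> w = y \<oplus> diff Y 1 \<cdot> t"
proof -
  obtain R h where h: "complex_morphism C d R Y h" "h 0 = g"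
    and cone: "left_d_exact C d (mapping_cone C d R Y h)" and "admissible_epi X (diff R 0)"
    using E2op Y g unfolding axiom_E2op_def is_d_pullback_def by blast
  then obtain V where V: "V \<in> X" "diff V 0 = diff R 0" by (auto simp: admissible_epi_def)
  note h' = complex_morphismD[OF h(1)]
  note R' = complexD[OF h'(1)] and Y' = complexD[OF h'(2)] and V' = complexD[OF X_complex[OF V(1)]]
  have d: "0 < d" "Suc 0 < d" using two_le_d by auto
  have t: "trm V 0 = src C g" "trm V 1 = trm R 1" "trm R 0 = src C g"
    using V'(3,4)[of 0] R'(3,4)[of 0] h'(3-5)[of 0] V(2) d h(2) by auto
  note b = cone_biprod[OF h(1) d(1)] cone_biprod[OF h(1) d(2)]
  show thesis
  proof (rule that[OF V(1) t(1), of "h 1"])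
    show "h 1 \<in> hom_set C (trm V 1) (trm Y 1)" using h' t d by simp
    show "g \<cdot> diff V 0 = diff Y 0 \<cdot> h 1" using h'(6)[of 0] d h(2) V(2) by simp
    fix W x y assume x: "x \<in> hom_set C W (src C g)" and y: "y \<in> hom_set C W (trm Y 1)"
      and eq: "g \<cdot> x = diff Y 0 \<cdot> y"
    \<comment> \<open>The cone's last arrow adds its two contributions, whence the sign of
      \<open>y\<close>. Its preceding arrow negates \<open>diff R 0\<close>, so the lift of
      \<open>x\<close> will be \<open>\<ominus> s\<close>.\<close>
    let ?p = "pair (cone_biprod R Y 0) x (\<ominus> y)"
    have p: "?p \<in> arrs C" "src C ?p = W" "tgt C ?p = trm (mapping_cone C d R Y h) (Suc 0)"
      using x y b t d by (simp_all add: mapping_cone_simps)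
    have "diff (mapping_cone C d R Y h) 0 \<cdot> ?p = g \<cdot> x \<oplus> \<ominus> (diff Y 0 \<cdot> y)"
      using cone_diff_0_pair[OF h(1) d(1), of x W "\<ominus> y"] x y t h(2) Y' d by simp
    also have "\<dots> = \<zero> W (trm Y 0)" using x g by (simp flip: eq)
    finally have "diff (mapping_cone C d R Y h) 0 \<cdot> ?p = \<zero> (src C ?p) (trm (mapping_cone C d R Y h) 0)"
      using p by (simp add: mapping_cone_simps)
    then obtain q where q: "q \<in> arrs C" "src C q = W" "tgt C q = bip_obj (cone_biprod R Y 1)"
      "?p = diff (mapping_cone C d R Y h) 1 \<cdot> q"
      using left_d_exactD(3)[OF cone d(1) p(1,3)] p(2) d by (auto simp: mapping_cone_simps)
    define s t' where "s = proj1 (cone_biprod R Y 1) \<cdot> q" and "t' = proj2 (cone_biprod R Y 1) \<cdot> q"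
    have st: "s \<in> hom_set C W (trm R 1)" "t' \<in> hom_set C W (trm Y 2)"
      using b(4-6) q by (simp_all add: s_def t'_def numeral_2_eq_2)
    have q_eq: "pair (cone_biprod R Y 1) s t' = q"
      using pair_eta[of "cone_biprod R Y 1" q] b(4) q(1,3) by (simp add: s_def t'_def)
    have "?p = pair (cone_biprod R Y 0) (\<ominus> (diff R 0 \<cdot> s)) (h 1 \<cdot> s \<oplus> diff Y 1 \<cdot> t')"
      using q(4) cone_diff_Suc_pair[OF h(1) d(2), of s W t'] st unfolding q_eq[symmetric]
      by (simp add: numeral_2_eq_2)
    then have "x = \<ominus> (diff R 0 \<cdot> s) \<and> \<ominus> y = h 1 \<cdot> s \<oplus> diff Y 1 \<cdot> t'"
      by (rule iffD1[OF pair_eq_iff, rotated -1])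
        (use x y t b(1-3) st R' Y' h' d in \<open>simp_all add: numeral_2_eq_2\<close>)
    then have 1: "x = \<ominus> (diff R 0 \<cdot> s)" and 2: "\<ominus> y = h 1 \<cdot> s \<oplus> diff Y 1 \<cdot> t'" by auto
    have "y = \<ominus> (h 1 \<cdot> s \<oplus> diff Y 1 \<cdot> t')" unfolding 2[symmetric] using y by simp
    then have "y \<oplus> diff Y 1 \<cdot> t' = h 1 \<cdot> (\<ominus> s)"
      using st h' Y' d by (simp add: numeral_2_eq_2)
    then show "\<exists>w \<in> hom_set C W (trm V 1). \<exists>t \<in> hom_set C W (trm Y 2).
         diff V 0 \<cdot> w = x \<and> h 1 \<cdot> w = y \<oplus> diff Y 1 \<cdot> t"
      using st t 1 V(2) R' d by (intro bexI[of _ "\<ominus> s"] bexI[of _ t']) simp_all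
  qed
qed

text \<open>(E2) provides only the terms of index 1 to \<open>d + 1\<close>. An arrow
  \<open>e\<close> to \<open>trm T 0\<close>, coming from right exactness of the cone, completes
  them; the result is right exact and starts with an admissible monomorphism, so it lies in the
  class.\<close>

lemma pushout_exists:
  assumes T: "T \<in> X" and p: "p \<in> arrs C" "src C p = trm T (Suc d)"
  obtains Z h where "Z \<in> X" "complex_morphism C (Suc d) T Z h" "h 0 = ident C (trm T 0)"
    "h (Suc d) = p"
    "right_d_exact C d (mapping_cone C d (drop_term0 T) (drop_term0 Z) (\<lambda>i. h (Suc i)))"
proof -
  let ?T = "drop_term0 T"
  obtain R k where k: "complex_morphism C d ?T R k" "k d = p"
    and cone: "right_d_exact C d (mapping_cone C d ?T R k)" and "admissible_mono d X (diff R (d - 1))"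
    using E2 T p unfolding axiom_E2_def is_d_pushout_def by fastforce
  then obtain V where V: "V \<in> X" "diff V d = diff R (d - 1)" by (auto simp: admissible_mono_def)
  have d: "0 < d" "Suc 0 < d" using two_le_d by auto
  have drop: "trm ?T i = trm T (Suc i)" "diff ?T i = diff T (Suc i)" for i
    by (simp_all add: drop_term0_def)
  note k' = complex_morphismD[OF k(1), unfolded drop] and sq = complex_morphismD(6)[OF k(1), unfolded drop]
  note T' = complexD[OF X_complex[OF T]] and R' = complexD[OF complex_morphismD(2)[OF k(1)]]
  let ?b = "cone_biprod ?T R" and ?P = "mapping_cone C d ?T R k"
  note b = cone_biprod[OF k(1), unfolded drop]
  have "\<exists>e. e \<in> hom_set C (trm R 0) (trm T 0) \<and> e \<cdot> k 0 = diff T 0 \<and> e \<cdot> diff R 0 = \<zero> (trm R 1) (trm T 0)"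
  proof -
    \<comment> \<open>This row is annihilated by the arrow \<open>diff ?P 1\<close>, so it factors
      through \<open>diff ?P 0\<close>. The factor is \<open>e\<close>, and restriction to the two
      summands gives its two equations.\<close>
    let ?x = "copair (?b 0) (diff T 0) (\<zero> (trm R 1) (trm T 0))"
    have x: "?x \<in> arrs C" "src C ?x = trm ?P (Suc 0)" "tgt C ?x = trm T 0"
      using b[OF d(1)] T' R' d by (simp_all add: mapping_cone_simps)
    have "?x \<cdot> diff ?P (Suc 0)
        = copair (?b 1) (\<zero> (tgt C (proj1 (?b 1))) (trm T 0)) (\<zero> (tgt C (proj2 (?b 1))) (trm T 0))"
      using copair_cone_diff_Suc[OF k(1) d(2), of "diff T 0" "trm T 0" "\<zero> (trm R 1) (trm T 0)"]
        b[OF d(2)] T' R' k' d by (simp add: drop)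
    also have "\<dots> = \<zero> (trm ?P (Suc (Suc 0))) (tgt C ?x)"
      using copair_null[of "?b 1" "trm T 0"] b[OF d(2)] T' x d by (simp add: mapping_cone_simps)
    finally obtain e where e: "e \<in> arrs C" "src C e = trm R 0" "tgt C e = trm T 0" "?x = e \<cdot> diff ?P 0"
      using right_d_exactD(3)[OF cone d(1) x(1,2)] x(3) by (auto simp: mapping_cone_simps)
    have "e \<cdot> k 0 = ?x \<cdot> inj1 (?b 0)" "e \<cdot> diff R 0 = ?x \<cdot> inj2 (?b 0)"
      unfolding e(4) using cone_diff_0_inj[OF k(1) d(1)] e(1,2) b[OF d(1)] complexD[OF right_d_exactD(1)[OF cone]] d
      by (simp_all add: mapping_cone_simps(1-3))
    then show ?thesis using e(1-3) b[OF d(1)] T' R' d by (intro exI[of _ e]) simp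
  qed
  then obtain e where e: "e \<in> arrs C" "src C e = trm R 0" "tgt C e = trm T 0" "e \<cdot> k 0 = diff T 0"
    "e \<cdot> diff R 0 = \<zero> (trm R 1) (trm T 0)" by auto
  \<comment> \<open>Prefixing a term at index 0 undoes the shift of
    \<open>drop_term0\<close>.\<close>
  define Z where "Z = \<lparr>trm = case_nat (trm T 0) (trm R), diff = case_nat e (diff R)\<rparr>"
  define h where "h = case_nat (ident C (trm T 0)) k"
  have Z_simps: "trm Z 0 = trm T 0" "trm Z (Suc i) = trm R i" "diff Z 0 = e" "diff Z (Suc i) = diff R i" for i
    by (simp_all add: Z_def)
  have h_simps: "h 0 = ident C (trm T 0)" "h (Suc i) = k i" for i by (simp_all add: h_def)
  have drop_Z: "drop_term0 Z = R" by (simp add: drop_term0_def Z_def)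
  have Z_complex: "complex C (Suc d) Z"
    unfolding complex_def
  proof (intro conjI allI impI)
    show "trm Z i \<in> objs C" if "i \<le> Suc d" for i
      using that R' T' by (cases i) (simp_all add: Z_simps)
    show "diff Z i \<in> hom_set C (trm Z (Suc i)) (trm Z i)" if "i < Suc d" for i
      using that R' e by (cases i) (simp_all add: Z_simps)
    show "diff Z i \<cdot> diff Z (Suc i) = \<zero> (trm Z (Suc (Suc i))) (trm Z i)" if "Suc i < Suc d" for i
      using that R' e by (cases i) (simp_all add: Z_simps)
  qed
  have h: "complex_morphism C (Suc d) T Z h"
    unfolding complex_morphism_def
  proof (intro conjI allI impI X_complex[OF T] Z_complex)
    show "h i \<in> hom_set C (trm T i) (trm Z i)" if "i \<le> Suc d" for i
      using that k' T' by (cases i) (simp_all add: Z_simps h_simps)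
    show "h i \<cdot> diff T i = diff Z i \<cdot> h (Suc i)" if "i < Suc d" for i
      using that k' T' e by (cases i) (simp_all add: Z_simps h_simps)
  qed
  have "right_d_exact C d Z"
  proof (rule right_d_exactI[OF Z_complex], goal_cases)
    case (1 x)
    then have x: "x \<in> arrs C" "src C x = trm T 0" by (simp_all add: Z_simps)
    have "x \<cdot> diff T 0 = (x \<cdot> e) \<cdot> k 0" using x e(1-4) k' d by simp
    also have "\<dots> = \<zero> (trm T 1) (tgt C x)" using 1 k' d by (simp add: Z_simps)
    finally have "x = \<zero> (trm T 0) (tgt C x)" by (intro right_d_exactD(2)[OF X_right[OF T]] x)
    then show ?case unfolding Z_simps .
  next
    case (2 i x)
    then have i: "i < d" and x: "x \<in> arrs C" "src C x = trm R i"
      and x0: "x \<cdot> diff R i = \<zero> (trm R (Suc i)) (tgt C x)" by (simp_all add: Z_simps)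
    define W where "W = tgt C x"
    have W: "W \<in> objs C" "tgt C x = W" using x by (simp_all add: W_def)
    \<comment> \<open>Composing \<open>x\<close> with \<open>k i\<close> gives a cocycle of
      \<open>T\<close>, and right exactness of \<open>T\<close> supplies \<open>a\<close>.\<close>
    have "(x \<cdot> k i) \<cdot> diff T (Suc i) = (x \<cdot> diff R i) \<cdot> k (Suc i)"
      using x i k' T' R' by simp
    also have "\<dots> = \<zero> (trm T (Suc (Suc i))) W" unfolding x0 using i W k' R' by simp
    finally obtain a where a: "a \<in> arrs C" "src C a = trm T i" "tgt C a = W" "x \<cdot> k i = a \<cdot> diff T i"
      using right_d_exactD(3)[OF X_right[OF T] i, of "x \<cdot> k i"] x i k' W(2) by auto
    show ?case
    proof (cases i)
      case 0
      \<comment> \<open>The candidate factor is \<open>a\<close>. The error \<open>?y\<close>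
        vanishes on \<open>k 0\<close> and on \<open>diff R 0\<close>, hence on the last arrow of
        the cone, which is epic.\<close>
      let ?y = "x \<oplus> \<ominus> (a \<cdot> e)"
      have y: "?y \<in> arrs C" "src C ?y = trm ?P 0" "tgt C ?y = W"
        using x a(1-3) e W(2) 0 by (simp_all add: mapping_cone_simps)
      have "?y \<cdot> k 0 = x \<cdot> k 0 \<oplus> \<ominus> (a \<cdot> diff T 0)" using x a(1-3) e W(2) k' 0 by simp
      also have "\<dots> = \<zero> (trm T 1) W" using a T' 0 by simp
      finally have y1: "?y \<cdot> k 0 = \<zero> (trm T 1) W" .
      have y2: "?y \<cdot> diff R 0 = \<zero> (trm R 1) W" using x a(1-3) e W R' x0 d 0 by simp
      have "?y \<cdot> diff ?P 0 = copair (?b 0) (?y \<cdot> k 0) (?y \<cdot> diff R 0)"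
        using y b[OF d(1)] k' R' d by (simp add: mapping_cone_simps del: add_cmp neg_cmp add_simps neg_simps)
      also have "\<dots> = \<zero> (trm ?P 1) (tgt C ?y)"
        unfolding y1 y2 y(3) using copair_null[of "?b 0" W] b[OF d(1)] W d by (simp add: mapping_cone_simps)
      finally have "?y = \<zero> (trm ?P 0) (tgt C ?y)" by (intro right_d_exactD(2)[OF cone] y)
      then have "?y = \<zero> (trm R 0) W" unfolding y(3) mapping_cone_simps .
      then have "x = a \<cdot> e" using diff_eq_null(1)[of x "a \<cdot> e" "trm R 0" W] x a(1-3) e W(2) 0 by simp
      then show ?thesis using a(1-3) 0 W(2) by (intro bexI[of _ a]) (simp_all add: Z_simps)
    next
      case (Suc j)
      \<comment> \<open>The row \<open>(a, x)\<close> is a cocycle of the cone: its first entry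
        cancels the contribution of \<open>x \<cdot> k i\<close>. It therefore factors through the
        next arrow of the cone, and restriction to the second summand factors \<open>x\<close>
        through \<open>diff R j\<close>.\<close>
      let ?x = "copair (?b j) a x"
      have j: "Suc j < d" "j < d" using i Suc by auto
      have xx: "?x \<in> arrs C" "src C ?x = trm ?P (Suc j)" "tgt C ?x = W"
        using b[OF j(2)] a(1-3) x W(2) j Suc by (simp_all add: mapping_cone_simps)
      have "?x \<cdot> diff ?P (Suc j) = copair (?b (Suc j)) (\<zero> (tgt C (proj1 (?b (Suc j)))) W) (\<zero> (tgt C (proj2 (?b (Suc j)))) W)"
        using copair_cone_diff_Suc[OF k(1) j(1), of a W x] a x W x0 b[OF j(1)] Suc T' i by (simp add: drop)
      also have "\<dots> = \<zero> (trm ?P (Suc (Suc j))) (tgt C ?x)"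
        using copair_null[of "?b (Suc j)" W] b[OF j(1)] W xx j by (simp add: mapping_cone_simps)
      finally obtain v where v: "v \<in> arrs C" "src C v = trm ?P j" "tgt C v = W" "?x = v \<cdot> diff ?P j"
        using right_d_exactD(3)[OF cone j(2) xx(1,2)] xx(3) by auto
      have x_v: "x = v \<cdot> (diff ?P j \<cdot> inj2 (?b j))"
      proof -
        have "x = ?x \<cdot> inj2 (?b j)" using b[OF j(2)] a(1-3) x W(2) Suc by simp
        also have "\<dots> = v \<cdot> (diff ?P j \<cdot> inj2 (?b j))"
          unfolding v(4) using v(1,2) b[OF j(2)] complexD[OF right_d_exactD(1)[OF cone]] j
          by (simp add: mapping_cone_simps(3))
        finally show ?thesis .
      qed
      show ?thesis
      proof (cases j)
        case 0
        have "x = v \<cdot> diff R 0"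
          using x_v cone_diff_0_inj(2)[OF k(1) d(1)] 0 by simp
        then show ?thesis
          using v(1-3) 0 Suc W(2) by (intro bexI[of _ v]) (simp_all add: Z_simps mapping_cone_simps)
      next
        case (Suc m)
        have m: "Suc m < d" "m < d" using j Suc by auto
        have "x = (v \<cdot> inj2 (?b m)) \<cdot> diff R j"
          using x_v cone_diff_Suc_inj2[OF k(1) m(1)] Suc v(1,2) b[OF m(2)] R' m
          by (simp add: mapping_cone_simps)
        then show ?thesis
          using v(1-3) \<open>i = Suc j\<close> Suc m W(2) b[OF m(2)]
          by (intro bexI[of _ "v \<cdot> inj2 (?b m)"]) (simp_all add: Z_simps mapping_cone_simps)
      qed
    qed
  qed
  moreover have "diff Z d = diff V d" using V(2) d by (cases d) (simp_all add: Z_simps)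
  ultimately have "Z \<in> X" by (intro in_X_if_same_mono[OF V(1)])
  then show thesis
    by (rule that[OF _ h]) (use cone k(2) d in \<open>simp_all add: h_simps drop_Z\<close>)
qed

text \<open>The last arrow of \<open>P\<close> is compared with the pullback \<open>V\<close> of
  \<open>T\<close> along \<open>diff Z 0\<close>. As \<open>diff Z 0 \<cdot> diff P 0\<close> is
  \<open>diff T 0\<close> after the first projection, \<open>diff P 0\<close> lifts through
  \<open>diff V 0\<close>. Conversely \<open>diff V 0\<close> and \<open>h 1 \<cdot> k\<close> agree
  after \<open>diff Z 0\<close>, so they differ by some \<open>diff Z 1 \<cdot> z\<close>, and
  \<open>(k, z)\<close> is the factor.\<close>

lemma cone_in_X:
  assumes T: "T \<in> X" and Z: "Z \<in> X" and h: "complex_morphism C (Suc d) T Z h"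
    and h0: "h 0 = ident C (trm T 0)"
    and P: "P = mapping_cone C d (drop_term0 T) (drop_term0 Z) (\<lambda>i. h (Suc i))"
    and P_complex: "complex C (Suc d) P"
  shows "P \<in> X"
proof -
  let ?T = "drop_term0 T" and ?Z = "drop_term0 Z" and ?h = "\<lambda>i. h (Suc i)"
  have drop: "complex_morphism C d ?T ?Z ?h"
    using h by (auto simp: complex_morphism_def complex_def drop_term0_def)
  have drop_simps: "trm ?T i = trm T (Suc i)" "diff ?T i = diff T (Suc i)"
    "trm ?Z i = trm Z (Suc i)" "diff ?Z i = diff Z (Suc i)" for i
    by (simp_all add: drop_term0_def)
  let ?b = "cone_biprod ?T ?Z 0"
  have d: "0 < d" "Suc 0 < d" using two_le_d by auto
  note b = cone_biprod[OF drop d(1), unfolded drop_simps]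
  note h' = complex_morphismD[OF h]
  note T' = complexD[OF h'(1)] and Z' = complexD[OF h'(2)] and P' = complexD[OF P_complex]
  have P0: "trm P 0 = trm Z 1" "trm P 1 = bip_obj ?b" "diff P 0 = copair ?b (h 1) (diff Z 1)"
    using d by (simp_all add: P mapping_cone_simps drop_simps)
  have Z0: "trm Z 0 = trm T 0" using h'(5)[of 0] h0 T' by simp
  have P_left: "left_d_exact C d P"
    by (rule left_d_exact_cone[OF X_left[OF T] X_left[OF Z] two_le_d h h0 P P_complex])
  obtain V k where V: "V \<in> X" "trm V 0 = src C (diff Z 0)" "k \<in> hom_set C (trm V 1) (trm T 1)"
    "diff Z 0 \<cdot> diff V 0 = diff T 0 \<cdot> k"
    and lift: "\<And>W x y. x \<in> hom_set C W (src C (diff Z 0)) \<Longrightarrow> y \<in> hom_set C W (trm T 1) \<Longrightarrow>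
       diff Z 0 \<cdot> x = diff T 0 \<cdot> y \<Longrightarrow>
       \<exists>w \<in> hom_set C W (trm V 1). \<exists>t \<in> hom_set C W (trm T 2).
         diff V 0 \<cdot> w = x \<and> k \<cdot> w = y \<oplus> diff T 1 \<cdot> t"
    by (rule pullback_exists[OF T, of "diff Z 0"]) (use Z' Z0 in auto)
  note V' = complexD[OF X_complex[OF V(1)]]
  have eq: "diff Z 0 \<cdot> h 1 = diff T 0" "diff Z 0 \<cdot> diff Z 1 = \<zero> (trm Z 2) (trm T 0)"
    using h'(6)[of 0] h0 T' Z' Z0 d by (simp_all add: numeral_2_eq_2)
  have "diff Z 0 \<cdot> diff P 0 = copair ?b (diff Z 0 \<cdot> h 1) (diff Z 0 \<cdot> diff Z 1)"
    using b h' Z' d by (simp add: P0)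
  also have "\<dots> = diff T 0 \<cdot> proj1 ?b"
    unfolding eq using b T' d by (simp add: copair_def numeral_2_eq_2)
  finally have eq': "diff Z 0 \<cdot> diff P 0 = diff T 0 \<cdot> proj1 ?b" .
  have "\<exists>w \<in> hom_set C (trm P 1) (trm V 1). \<exists>t \<in> hom_set C (trm P 1) (trm T 2).
      diff V 0 \<cdot> w = diff P 0 \<and> k \<cdot> w = proj1 ?b \<oplus> diff T 1 \<cdot> t"
    by (rule lift[OF _ _ eq']) (use P'(2-4)[of 0] P0(1,2) b Z' in simp_all)
  then obtain a where a: "a \<in> hom_set C (trm P 1) (trm V 1)" "diff V 0 \<cdot> a = diff P 0"
    by blast
  have "diff Z 0 \<cdot> (diff V 0 \<oplus> \<ominus> (h 1 \<cdot> k)) = \<zero> (trm V 1) (trm Z 0)"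
    using V V' h' T' Z' Z0 complex_morphism_cmp[OF h, of 0 k] h0 by simp
  then obtain z where z: "z \<in> arrs C" "src C z = trm V 1" "tgt C z = trm Z 2"
    "diff V 0 \<oplus> \<ominus> (h 1 \<cdot> k) = diff Z 1 \<cdot> z"
    using left_d_exactD(3)[OF X_left[OF Z] d(1), of "diff V 0 \<oplus> \<ominus> (h 1 \<cdot> k)"] V V' h' Z'
    by (auto simp: numeral_2_eq_2)
  have "diff V 0 = h 1 \<cdot> k \<oplus> diff Z 1 \<cdot> z"
    unfolding z(4)[symmetric] using V V' h' Z' by (simp add: add_ac)
  also have "\<dots> = diff P 0 \<cdot> pair ?b k z"
    using b V z(1-3) h' Z' d by (simp add: P0 numeral_2_eq_2)
  finally have v: "diff V 0 = diff P 0 \<cdot> pair ?b k z" .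
  show ?thesis
    by (rule in_X_if_epis_factor[OF V(1) P_left _ a(1) a(2)[symmetric] _ v])
      (use V P0 b z Z' in \<open>simp_all add: numeral_2_eq_2\<close>)
qed

end

section \<open>Composing admissible monomorphisms\<close>

context additive_category
begin

text \<open>The cone of \<open>\<phi>\<close> with the summands \<open>P\<^sub>d\<^sub>+\<^sub>1 = S\<^sub>d\<close> and \<open>S\<^sub>d\<^sub>-\<^sub>1\<close> cancelled, for \<open>d = m + 2\<close>. Here \<open>b\<close>
  decomposes \<open>P\<^sub>d\<close> with second summand \<open>S\<^sub>d\<^sub>-\<^sub>1\<close>.\<close>

definition composite_seq ::
    "nat \<Rightarrow> ('a, 'b) sequence \<Rightarrow> ('a, 'b) sequence \<Rightarrow> ('a, 'b) biproduct_data \<Rightarrow> 'b \<Rightarrow> (nat \<Rightarrow> 'b) \<Rightarrow> ('a, 'b) sequence"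
  where
  "composite_seq m P S b g \<phi> =
     (let q = (\<lambda>i. biproduct C (trm P i) (trm S i)) in
      \<lparr>trm = (\<lambda>i. if i \<le> m then bip_obj (q i)
                   else if i = m + 1 then trm P i
                   else if i = m + 2 then tgt C (proj1 b)
                   else trm S i),
       diff = (\<lambda>i. if i < m then pair (q i) (diff P i \<cdot> proj1 (q (i + 1)))
                                   (copair (q (i + 1)) (\<phi> i) (\<ominus> (diff S i)))
                   else if i = m then pair (q m) (diff P m) (\<phi> m)
                   else if i = m + 1 then diff P i \<cdot> inj1 b
                   else g \<cdot> diff S i)\<rparr>)"

text \<open>In the application \<open>P\<close> is the cone of a pushout of the second sequence,
  \<open>g\<close> is the first arrow of that sequence, and \<open>\<phi>\<close> is a morphism from
  \<open>P\<close> to \<open>S\<close> lowering the index by one. Fixing only these properties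
  separates the cancellation from the construction of the cone.\<close>

context
  fixes d m P S b g \<phi>
  assumes P: "left_d_exact C d P" and S: "left_d_exact C d S" and d: "d = Suc (Suc m)"
    and b: "biprod b" "bip_obj b = trm P (Suc (Suc m))" "tgt C (proj2 b) = trm S (Suc m)"
    and PS: "trm P (Suc (Suc (Suc m))) = trm S (Suc (Suc m))"
    and g: "g \<in> arrs C" "src C g = trm S (Suc (Suc m))" "tgt C g = tgt C (proj1 b)"
    and g_mono: "\<And>x. x \<in> arrs C \<Longrightarrow> tgt C x = src C g \<Longrightarrow> g \<cdot> x = \<zero> (src C x) (tgt C g) \<Longrightarrow>
      x = \<zero> (src C x) (src C g)"
    and Pd: "diff P (Suc (Suc m)) = pair b (\<ominus> g) (diff S (Suc m))"
    and \<phi>: "\<And>i. i \<le> Suc m \<Longrightarrow> \<phi> i \<in> hom_set C (trm P (Suc i)) (trm S i)"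
    and \<phi>_diff: "\<And>i. i \<le> m \<Longrightarrow> \<phi> i \<cdot> diff P (Suc i) = diff S i \<cdot> \<phi> (Suc i)"
    and \<phi>_last: "\<phi> (Suc m) = proj2 b"
begin

private abbreviation "M \<equiv> composite_seq m P S b g \<phi>"
private abbreviation "q i \<equiv> biproduct C (trm P i) (trm S i)"

private lemmas P' = complexD[OF left_d_exactD(1)[OF P, unfolded d]]
private lemmas S' = complexD[OF left_d_exactD(1)[OF S, unfolded d]]

private lemma \<phi>': "i \<le> Suc m \<Longrightarrow> \<phi> i \<in> arrs C" "i \<le> Suc m \<Longrightarrow> src C (\<phi> i) = trm P (Suc i)"
  "i \<le> Suc m \<Longrightarrow> tgt C (\<phi> i) = trm S i"
  using \<phi> by simp_all

private lemma \<phi>_cmp: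
  assumes "i \<le> m" "x \<in> arrs C" "tgt C x = trm P (Suc (Suc i))"
  shows "\<phi> i \<cdot> (diff P (Suc i) \<cdot> x) = diff S i \<cdot> (\<phi> (Suc i) \<cdot> x)"
proof -
  have "\<phi> i \<cdot> (diff P (Suc i) \<cdot> x) = (diff S i \<cdot> \<phi> (Suc i)) \<cdot> x"
    by (rule cmp_reduce[OF \<phi>_diff]) (use assms \<phi>' P' in simp_all)
  then show ?thesis using assms \<phi>' S' by simp
qed

private lemma P_null:
  assumes "i \<le> Suc m" "x \<in> arrs C" "tgt C x = trm P (Suc (Suc i))"
  shows "diff P i \<cdot> (diff P (Suc i) \<cdot> x) = \<zero> (src C x) (trm P i)"
  by (rule complex_cmp_null[OF left_d_exactD(1)[OF P]]) (use assms d in simp_all)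

private lemma S_null:
  assumes "i \<le> Suc m" "x \<in> arrs C" "tgt C x = trm S (Suc (Suc i))"
  shows "diff S i \<cdot> (diff S (Suc i) \<cdot> x) = \<zero> (src C x) (trm S i)"
  by (rule complex_cmp_null[OF left_d_exactD(1)[OF S]]) (use assms d in simp_all)

private lemma q:
  assumes "i \<le> m"
  shows "biprod (q i)" "tgt C (proj1 (q i)) = trm P i" "tgt C (proj2 (q i)) = trm S i"
  using biproduct_simps[of "trm P i" "trm S i"] P' S' assms by simp_all

lemma composite_seq_simps:
  "i \<le> m \<Longrightarrow> trm M i = bip_obj (q i)"
  "trm M (Suc m) = trm P (Suc m)"
  "trm M (Suc (Suc m)) = tgt C (proj1 b)"
  "trm M (Suc (Suc (Suc m))) = trm S (Suc (Suc (Suc m)))"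
  "i < m \<Longrightarrow> diff M i = pair (q i) (diff P i \<cdot> proj1 (q (Suc i))) (copair (q (Suc i)) (\<phi> i) (\<ominus> (diff S i)))"
  "diff M m = pair (q m) (diff P m) (\<phi> m)"
  "diff M (Suc m) = diff P (Suc m) \<cdot> inj1 b"
  "diff M (Suc (Suc m)) = g \<cdot> diff S (Suc (Suc m))"
  by (simp_all add: composite_seq_def Let_def)

private lemma diff_M_pair:
  assumes "i < m" "x \<in> hom_set C W (trm P (Suc i))" "y \<in> hom_set C W (trm S (Suc i))"
  shows "diff M i \<cdot> pair (q (Suc i)) x y = pair (q i) (diff P i \<cdot> x) (\<phi> i \<cdot> x \<oplus> \<ominus> (diff S i \<cdot> y))"
  using assms q[of i] q[of "Suc i"] P' S' \<phi>' by (simp add: composite_seq_simps)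

private lemma Suc_m_cases:
  assumes "i \<le> Suc (Suc m)"
  obtains "i < m" | "i = m" | "i = Suc m" | "i = Suc (Suc m)"
  using assms by linarith

private lemma diff_M_in_hom:
  assumes "i \<le> Suc (Suc m)"
  shows "diff M i \<in> hom_set C (trm M (Suc i)) (trm M i)"
  using assms
proof (rule Suc_m_cases)
  assume "i < m"
  then show ?thesis using q[of i] q[of "Suc i"] P' S' \<phi>' by (simp add: composite_seq_simps)
next
  assume "i = m"
  then show ?thesis using q[of m] P' S' \<phi>' by (simp add: composite_seq_simps)
next
  assume "i = Suc m"
  then show ?thesis using b P' by (simp add: composite_seq_simps)
next
  assume "i = Suc (Suc m)"
  then show ?thesis using g S' by (simp add: composite_seq_simps)
qed

text \<open>By \<open>Pd\<close>, the leftmost arrow of \<open>P\<close> has components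
  \<open>\<ominus> g\<close> and \<open>diff S (Suc m)\<close>. On a cycle of \<open>S\<close> the
  second vanishes, so consecutive arrows of \<open>P\<close> composing to zero becomes a statement
  about \<open>g\<close>.\<close>

private lemma P_diff_inj1:
  assumes "x \<in> arrs C" "tgt C x = trm S (Suc (Suc m))" "diff S (Suc m) \<cdot> x = \<zero> (src C x) (trm S (Suc m))"
  shows "diff P (Suc m) \<cdot> (inj1 b \<cdot> (g \<cdot> x)) = \<zero> (src C x) (trm P (Suc m))"
proof -
  have "diff P (Suc (Suc m)) \<cdot> x = \<ominus> (inj1 b \<cdot> (g \<cdot> x))"
    using assms b g S' by (simp add: Pd pair_def)
  then have "\<ominus> (diff P (Suc m) \<cdot> (inj1 b \<cdot> (g \<cdot> x))) = diff P (Suc m) \<cdot> (diff P (Suc (Suc m)) \<cdot> x)"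
    using assms(1,2) b g P' by simp
  also have "\<dots> = \<zero> (src C x) (trm P (Suc m))"
    by (rule P_null) (use assms PS in simp_all)
  finally show ?thesis using assms(1,2) b g P' by simp
qed

lemma complex_composite_seq: "complex C (Suc d) M"
proof -
  have "trm M i \<in> objs C" if "i \<le> Suc (Suc m)" for i
    using diff_M_in_hom[OF that] tgt_in_objs[of "diff M i"] by simp
  moreover have "trm M (Suc (Suc (Suc m))) \<in> objs C"
    using S' by (simp add: composite_seq_simps)
  moreover have "diff M i \<cdot> diff M (Suc i) = \<zero> (trm M (Suc (Suc i))) (trm M i)" if i: "i \<le> Suc m" for i
  proof -
    consider "Suc i < m" | "Suc i = m" | "i = m" | "i = Suc m" using i by linarith
    then show ?thesis
    proof cases
      case 1
      let ?Q = "q (Suc (Suc i))"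
      note qs = q[of i] q[of "Suc i"] q[of "Suc (Suc i)"]
      have "diff M i \<cdot> diff M (Suc i) = pair (q i) (diff P i \<cdot> (diff P (Suc i) \<cdot> proj1 ?Q))
          (\<phi> i \<cdot> (diff P (Suc i) \<cdot> proj1 ?Q) \<oplus> \<ominus> (diff S i \<cdot> copair ?Q (\<phi> (Suc i)) (\<ominus> (diff S (Suc i)))))"
        using diff_M_pair[of i "diff P (Suc i) \<cdot> proj1 ?Q" "bip_obj ?Q" "copair ?Q (\<phi> (Suc i)) (\<ominus> (diff S (Suc i)))"]
          1 qs P' S' \<phi>' by (simp add: composite_seq_simps(5))
      also have "\<dots> = pair (q i) (\<zero> (bip_obj ?Q) (trm P i)) (\<zero> (bip_obj ?Q) (trm S i))"
        using P_null[of i "proj1 ?Q"] \<phi>_cmp[of i "proj1 ?Q"] S_null[of i "proj2 ?Q"] 1 qs P' S' \<phi>'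
        by (simp add: copair_def)
      finally show ?thesis using 1 qs by (simp add: composite_seq_simps)
    next
      case 2
      note qs = q[of i] q[of m]
      have "diff M i \<cdot> diff M (Suc i) = pair (q i) (diff P i \<cdot> diff P (Suc i))
          (\<phi> i \<cdot> diff P (Suc i) \<oplus> \<ominus> (diff S i \<cdot> \<phi> (Suc i)))"
        using diff_M_pair[of i "diff P (Suc i)" "trm P (Suc (Suc i))" "\<phi> (Suc i)"]
          2 qs P' S' \<phi>' by (simp add: composite_seq_simps(6))
      also have "\<dots> = pair (q i) (\<zero> (trm P (Suc (Suc i))) (trm P i)) (\<zero> (trm P (Suc (Suc i))) (trm S i))"
        using 2 P' S' \<phi>' P'(5)[of i] \<phi>_diff[of i] by simp
      finally show ?thesis using 2 qs P' by (simp add: composite_seq_simps)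
    next
      case 3
      then show ?thesis
        using q[of m] P' S' \<phi>' b P_null[of m "inj1 b"] \<phi>_cmp[of m "inj1 b"] \<phi>_last
        by (simp add: composite_seq_simps)
    next
      case 4
      then show ?thesis
        using P' S' b g P_diff_inj1[of "diff S (Suc (Suc m))"] by (simp add: composite_seq_simps)
    qed
  qed
  ultimately show ?thesis
    using diff_M_in_hom unfolding d complex_def by (auto simp: le_Suc_eq less_Suc_eq_le simp del: hom_iff)
qed

text \<open>First \<open>x\<close> lifts to \<open>x'\<close> by exactness of \<open>P\<close>. Then
  \<open>\<phi> (Suc i) \<cdot> x'\<close> and \<open>y\<close> agree after \<open>diff S i\<close>,
  so their difference lifts to \<open>y'\<close> by exactness of \<open>S\<close>.\<close>

private lemma lift_M_pair:
  assumes i: "Suc i \<le> m" and x: "x \<in> hom_set C W (trm P (Suc i))" and y: "y \<in> hom_set C W (trm S (Suc i))"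
    and null: "diff M i \<cdot> pair (q (Suc i)) x y = \<zero> W (bip_obj (q i))"
  obtains x' y' where "x' \<in> hom_set C W (trm P (Suc (Suc i)))" "y' \<in> hom_set C W (trm S (Suc (Suc i)))"
    "x = diff P (Suc i) \<cdot> x'" "y = \<phi> (Suc i) \<cdot> x' \<oplus> \<ominus> (diff S (Suc i) \<cdot> y')"
proof -
  have W: "W \<in> objs C" using x by auto
  have "diff P i \<cdot> x = \<zero> W (tgt C (proj1 (q i))) \<and> \<phi> i \<cdot> x \<oplus> \<ominus> (diff S i \<cdot> y) = \<zero> W (tgt C (proj2 (q i)))"
    by (rule iffD1[OF pair_eq_null null[unfolded diff_M_pair[OF Suc_le_lessD[OF i] x y]]])
      (use i x y q[of i] P' S' \<phi>' in simp_all)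
  then have x0: "diff P i \<cdot> x = \<zero> W (trm P i)" and y0: "\<phi> i \<cdot> x \<oplus> \<ominus> (diff S i \<cdot> y) = \<zero> W (trm S i)"
    using q[of i] i by simp_all
  obtain x' where x': "x' \<in> arrs C" "src C x' = W" "tgt C x' = trm P (Suc (Suc i))" "x = diff P (Suc i) \<cdot> x'"
    using left_d_exactD(3)[OF P, of i x] x x0 i d by auto
  have "\<phi> i \<cdot> x = diff S i \<cdot> y"
    by (rule iffD1[OF diff_eq_null(1) y0]) (use i x y P' S' \<phi>' in simp_all)
  moreover have "\<phi> i \<cdot> x = diff S i \<cdot> (\<phi> (Suc i) \<cdot> x')"
    unfolding x'(4) by (rule \<phi>_cmp) (use i x' in simp_all)
  ultimately have "diff S i \<cdot> (\<phi> (Suc i) \<cdot> x' \<oplus> \<ominus> y) = \<zero> W (trm S i)"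
    using i x'(1-3) y S' \<phi>' by simp
  then obtain y' where y': "y' \<in> arrs C" "src C y' = W" "tgt C y' = trm S (Suc (Suc i))"
    "\<phi> (Suc i) \<cdot> x' \<oplus> \<ominus> y = diff S (Suc i) \<cdot> y'"
    using left_d_exactD(3)[OF S, of i "\<phi> (Suc i) \<cdot> x' \<oplus> \<ominus> y"] x'(1-3) y \<phi>' i d by auto
  have "y = \<phi> (Suc i) \<cdot> x' \<oplus> \<ominus> (diff S (Suc i) \<cdot> y')"
    unfolding y'(4)[symmetric] using x'(1-3) y \<phi>' i by (simp add: add_ac)
  then show thesis using that[of x' y'] x' y' by simp
qed

lemma left_d_exact_composite_seq: "left_d_exact C d M"
proof (rule left_d_exactI[OF complex_composite_seq], goal_cases)
  case (1 x)
  then have x: "x \<in> arrs C" "tgt C x = trm S (Suc (Suc (Suc m)))"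
    and "g \<cdot> (diff S (Suc (Suc m)) \<cdot> x) = \<zero> (src C x) (tgt C g)"
    using g S' by (simp_all add: composite_seq_simps d)
  then have "diff S (Suc (Suc m)) \<cdot> x = \<zero> (src C x) (src C g)"
    using g_mono[of "diff S (Suc (Suc m)) \<cdot> x"] g S' by simp
  then have "x = \<zero> (src C x) (trm S (Suc d))"
    by (intro left_d_exactD(2)[OF S]) (use x g d in simp_all)
  then show ?case unfolding d composite_seq_simps .
next
  case (2 i x)
  define W where "W = src C x"
  have x: "x \<in> arrs C" "src C x = W" "tgt C x = trm M (Suc i)" and null: "diff M i \<cdot> x = \<zero> W (trm M i)"
    using 2 by (simp_all add: W_def)
  have W: "W \<in> objs C" using x by auto
  consider "Suc i < m" | "Suc i = m" | "i = m" | "i = Suc m" using 2(1) d by linarith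
  then show ?case
  proof cases
    case 1
    let ?Q = "q (Suc i)"
    note Q = q[of "Suc i"] q[of "Suc (Suc i)"]
    have tx: "tgt C x = bip_obj ?Q" using x(3) 1 by (simp add: composite_seq_simps)
    define u v where "u = proj1 ?Q \<cdot> x" and "v = proj2 ?Q \<cdot> x"
    have x_eq: "x = pair ?Q u v" using pair_eta[of ?Q x] Q x tx 1 by (simp add: u_def v_def)
    have uv: "u \<in> hom_set C W (trm P (Suc i))" "v \<in> hom_set C W (trm S (Suc i))"
      using Q x(1,2) tx 1 by (simp_all add: u_def v_def)
    obtain x' y' where xy: "x' \<in> hom_set C W (trm P (Suc (Suc i)))" "y' \<in> hom_set C W (trm S (Suc (Suc i)))"
      "u = diff P (Suc i) \<cdot> x'" "v = \<phi> (Suc i) \<cdot> x' \<oplus> \<ominus> (diff S (Suc i) \<cdot> y')"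
      by (rule lift_M_pair[OF _ uv]) (use null x_eq 1 in \<open>simp_all add: composite_seq_simps\<close>)
    have *: "x = diff M (Suc i) \<cdot> pair (q (Suc (Suc i))) x' y'"
      unfolding x_eq xy(3,4) using diff_M_pair[OF 1 xy(1,2)] by simp
    show ?thesis
      by (intro bexI[of _ "pair (q (Suc (Suc i))) x' y'"] conjI *)
        (use xy(1,2) Q x(2) 1 in \<open>simp_all add: composite_seq_simps\<close>)
  next
    case 2
    let ?Q = "q (Suc i)"
    note Q = q[of "Suc i"]
    have tx: "tgt C x = bip_obj ?Q" using x(3) 2 by (simp add: composite_seq_simps)
    define u v where "u = proj1 ?Q \<cdot> x" and "v = proj2 ?Q \<cdot> x"
    have x_eq: "x = pair ?Q u v" using pair_eta[of ?Q x] Q x tx 2 by (simp add: u_def v_def)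
    have uv: "u \<in> hom_set C W (trm P (Suc i))" "v \<in> hom_set C W (trm S (Suc i))"
      using Q x(1,2) tx 2 by (simp_all add: u_def v_def)
    obtain x' y' where xy: "x' \<in> hom_set C W (trm P (Suc (Suc i)))" "y' \<in> hom_set C W (trm S (Suc (Suc i)))"
      "u = diff P (Suc i) \<cdot> x'" "v = \<phi> (Suc i) \<cdot> x' \<oplus> \<ominus> (diff S (Suc i) \<cdot> y')"
      by (rule lift_M_pair[OF _ uv]) (use null x_eq 2 in \<open>simp_all add: composite_seq_simps\<close>)
    note xy' = xy(1,2)[unfolded 2]
    \<comment> \<open>The term of index \<open>m + 1\<close> has lost its summand from
      \<open>S\<close>. The component \<open>y'\<close> is absorbed through \<open>inj2 b\<close>,
      since \<open>\<phi> (Suc m)\<close> is the second projection and recovers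
      \<open>y'\<close>.\<close>
    let ?z = "x' \<oplus> \<ominus> (diff P (Suc m) \<cdot> (inj2 b \<cdot> y'))"
    have z: "?z \<in> arrs C" "src C ?z = W" "tgt C ?z = trm P (Suc m)" using xy' P' b by simp_all
    have "\<phi> m \<cdot> (diff P (Suc m) \<cdot> (inj2 b \<cdot> y')) = diff S m \<cdot> y'"
      using \<phi>_cmp[of m "inj2 b \<cdot> y'"] xy' b \<phi>_last by simp
    then have "diff P m \<cdot> ?z = u" "\<phi> m \<cdot> ?z = v"
      unfolding xy(3,4) 2 using xy' P' S' \<phi>' b P_null[of m "inj2 b \<cdot> y'"] W by simp_all
    moreover have "pair (q m) (diff P m) (\<phi> m) \<cdot> ?z = pair (q m) (diff P m \<cdot> ?z) (\<phi> m \<cdot> ?z)"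
      by (rule pair_cmp) (use z q[of m] P' \<phi>' in simp_all)
    ultimately have "pair (q m) (diff P m) (\<phi> m) \<cdot> ?z = pair (q m) u v" by simp
    then have *: "x = diff M (Suc i) \<cdot> ?z"
      unfolding x_eq 2 composite_seq_simps by (rule sym)
    show ?thesis
      by (intro bexI[of _ ?z] conjI *) (use z x(2) 2 in \<open>simp_all add: composite_seq_simps\<close>)
  next
    case 3
    have tx: "tgt C x = trm P (Suc m)" using x(3) 3 by (simp add: composite_seq_simps)
    have "pair (q m) (diff P m \<cdot> x) (\<phi> m \<cdot> x) = \<zero> W (bip_obj (q m))"
      using null x(1) tx 3 q[of m] P' S' \<phi>' by (simp add: composite_seq_simps)
    then have "diff P m \<cdot> x = \<zero> W (tgt C (proj1 (q m))) \<and> \<phi> m \<cdot> x = \<zero> W (tgt C (proj2 (q m)))"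
      by (rule iffD1[OF pair_eq_null, rotated -1]) (use x(1,2) tx q[of m] P' S' \<phi>' in simp_all)
    then have x0: "diff P m \<cdot> x = \<zero> W (trm P m)" "\<phi> m \<cdot> x = \<zero> W (trm S m)" using q[of m] by simp_all
    obtain w where w: "w \<in> arrs C" "src C w = W" "tgt C w = bip_obj b" "x = diff P (Suc m) \<cdot> w"
      using left_d_exactD(3)[OF P, of m x] x(1,2) tx x0(1) d b(2) by auto
    define s where "s = proj2 b \<cdot> w"
    have s: "s \<in> arrs C" "src C s = W" "tgt C s = trm S (Suc m)" using w(1-3) b by (simp_all add: s_def)
    have "diff S m \<cdot> s = \<phi> m \<cdot> (diff P (Suc m) \<cdot> w)"
      using \<phi>_cmp[of m w] w(1-3) b \<phi>_last by (simp add: s_def)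
    also have "\<dots> = \<zero> W (trm S m)" using x0(2) unfolding w(4) .
    finally obtain y where y: "y \<in> arrs C" "src C y = W" "tgt C y = trm S (Suc (Suc m))" "s = diff S (Suc m) \<cdot> y"
      using left_d_exactD(3)[OF S, of m s] s d by auto
    \<comment> \<open>Adding a boundary of \<open>P\<close> does not change the image of
      \<open>w\<close>. Subtracting \<open>diff P (Suc (Suc m)) \<cdot> y\<close> removes the second
      component and changes the first to \<open>?c\<close>.\<close>
    let ?c = "proj1 b \<cdot> w \<oplus> g \<cdot> y"
    have c: "?c \<in> arrs C" "src C ?c = W" "tgt C ?c = tgt C (proj1 b)" using w(1-3) y(1-3) g b by simp_all
    have "w = inj1 b \<cdot> (proj1 b \<cdot> w) \<oplus> inj2 b \<cdot> s"
      using pair_eta[OF b(1) w(1,3)] by (simp add: pair_def s_def)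
    also have "\<dots> = inj1 b \<cdot> ?c \<oplus> diff P (Suc (Suc m)) \<cdot> y"
      unfolding y(4) Pd using w(1-3) y(1-3) g b S' by (simp add: pair_def)
    finally have "diff P (Suc m) \<cdot> w = diff P (Suc m) \<cdot> (inj1 b \<cdot> ?c \<oplus> diff P (Suc (Suc m)) \<cdot> y)"
      by (rule arg_cong)
    also have "\<dots> = diff P (Suc m) \<cdot> (inj1 b \<cdot> ?c)"
      using c y(1-3) P' b PS P_null[of "Suc m" y] by (simp del: cmp_add add: cmp_add[of "inj1 b \<cdot> ?c"])
    finally have *: "x = diff M (Suc i) \<cdot> ?c"
      unfolding w(4) 3 composite_seq_simps using c b P' by simp
    show ?thesis
      by (intro bexI[of _ ?c] conjI *) (use c x(2) 3 in \<open>simp_all add: composite_seq_simps\<close>)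
  next
    case 4
    have tx: "tgt C x = tgt C (proj1 b)" using x(3) 4 by (simp add: composite_seq_simps)
    \<comment> \<open>As a cycle of \<open>P\<close>, \<open>inj1 b \<cdot> x\<close> comes from
      some \<open>y\<close>. Its first component gives \<open>x = \<ominus> (g \<cdot> y)\<close>,
      its second makes \<open>y\<close> a cycle of \<open>S\<close>, so that \<open>x\<close>
      factors through the composite.\<close>
    have "diff P (Suc m) \<cdot> (inj1 b \<cdot> x) = \<zero> W (trm P (Suc m))"
      using null x(1,2) tx b P' 4 by (simp add: composite_seq_simps)
    then obtain y where y: "y \<in> arrs C" "src C y = W" "tgt C y = trm S (Suc (Suc m))"
      "inj1 b \<cdot> x = diff P (Suc (Suc m)) \<cdot> y"
      using left_d_exactD(3)[OF P, of "Suc m" "inj1 b \<cdot> x"] x(1,2) tx d b PS by auto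
    have "x = proj1 b \<cdot> (inj1 b \<cdot> x)" using x tx b by simp
    also have "\<dots> = \<ominus> (g \<cdot> y)" unfolding y(4) Pd using y(1-3) b g S' by simp
    finally have x_eq: "x = \<ominus> (g \<cdot> y)" .
    have "diff S (Suc m) \<cdot> y = proj2 b \<cdot> (diff P (Suc (Suc m)) \<cdot> y)" unfolding Pd using y(1-3) b g S' by simp
    also have "\<dots> = \<zero> W (trm S (Suc m))" unfolding y(4)[symmetric] using x(1,2) tx b by simp
    finally obtain a where a: "a \<in> arrs C" "src C a = W" "tgt C a = trm S (Suc (Suc (Suc m)))"
      "y = diff S (Suc (Suc m)) \<cdot> a"
      using left_d_exactD(3)[OF S, of "Suc m" y] y(1-3) d by auto
    have *: "x = diff M (Suc i) \<cdot> (\<ominus> a)"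
      unfolding x_eq 4 composite_seq_simps a(4) using a(1-3) S' g by simp
    show ?thesis
      by (intro bexI[of _ "\<ominus> a"] conjI *) (use a(1-3) x(2) 4 in \<open>simp_all add: composite_seq_simps\<close>)
  qed
qed

text \<open>For \<open>m = 0\<close> the last arrow has no summand \<open>S\<^sub>1\<close> in its source; there \<open>y\<close> is absorbed by
  the arrow \<open>P\<^sub>2 \<rightarrow> P\<^sub>1\<close>.\<close>

lemma composite_seq_lift:
  assumes x: "x \<in> hom_set C W (trm P 1)" and y: "y \<in> hom_set C W (trm S 1)"
  shows "\<exists>a \<in> hom_set C W (trm M 1).
    diff M 0 \<cdot> a = pair (q 0) (diff P 0 \<cdot> x) (\<phi> 0 \<cdot> x \<oplus> \<ominus> (diff S 0 \<cdot> y))"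
proof (cases m)
  case 0
  let ?z = "x \<oplus> \<ominus> (diff P 1 \<cdot> (inj2 b \<cdot> y))"
  have W: "W \<in> objs C" using x by auto
  have xy: "x \<in> arrs C" "src C x = W" "tgt C x = trm P (Suc m)" "y \<in> arrs C" "src C y = W"
    "tgt C y = trm S (Suc m)" using x y 0 by simp_all
  have z: "?z \<in> arrs C" "src C ?z = W" "tgt C ?z = trm P (Suc m)" using xy P' b 0 by simp_all
  have "\<phi> m \<cdot> (diff P (Suc m) \<cdot> (inj2 b \<cdot> y)) = diff S m \<cdot> y"
    using \<phi>_cmp[of m "inj2 b \<cdot> y"] xy b \<phi>_last by simp
  then have "diff P m \<cdot> ?z = diff P m \<cdot> x" "\<phi> m \<cdot> ?z = \<phi> m \<cdot> x \<oplus> \<ominus> (diff S m \<cdot> y)"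
    using xy P' S' \<phi>' b P_null[of m "inj2 b \<cdot> y"] W 0 by simp_all
  moreover have "pair (q m) (diff P m) (\<phi> m) \<cdot> ?z = pair (q m) (diff P m \<cdot> ?z) (\<phi> m \<cdot> ?z)"
    by (rule pair_cmp) (use z q[of m] P' \<phi>' in simp_all)
  ultimately have "pair (q m) (diff P m) (\<phi> m) \<cdot> ?z
      = pair (q m) (diff P m \<cdot> x) (\<phi> m \<cdot> x \<oplus> \<ominus> (diff S m \<cdot> y))" by simp
  then show ?thesis
    using z composite_seq_simps(2,6) 0 by (intro bexI[of _ ?z]) simp_all
next
  case (Suc k)
  then show ?thesis
    using diff_M_pair[of 0 x W y] x y q[of 1] composite_seq_simps(1)[of 1] by (intro bexI[of _ "pair (q 1) x y"]) simp_all
qed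

text \<open>With \<open>composite_seq_lift\<close> this describes, uniformly in \<open>m\<close>,
  the arrows that factor through the last arrow: exactly those of the displayed form. For
  \<open>m = 0\<close> the identity and a zero arrow serve as \<open>x\<close> and
  \<open>y\<close>.\<close>

lemma composite_seq_diff_0:
  "\<exists>x \<in> hom_set C (trm M 1) (trm P 1). \<exists>y \<in> hom_set C (trm M 1) (trm S 1).
    diff M 0 = pair (q 0) (diff P 0 \<cdot> x) (\<phi> 0 \<cdot> x \<oplus> \<ominus> (diff S 0 \<cdot> y))"
proof (cases m)
  case 0
  then show ?thesis
    using composite_seq_simps(2,6) P' S' \<phi>' q[of 0]
    by (intro bexI[of _ "ident C (trm P 1)"] bexI[of _ "\<zero> (trm P 1) (trm S 1)"]) simp_all
next
  case (Suc k)
  have q1: "bip_obj (q 1) = trm M 1" using Suc composite_seq_simps(1)[of 1] by simp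
  have "diff M 0 = diff M 0 \<cdot> pair (q 1) (proj1 (q 1)) (proj2 (q 1))"
    using pair_eta[of "q 1" "ident C (bip_obj (q 1))"] q[of 1] diff_M_in_hom[of 0] Suc q1 by simp
  also have "\<dots> = pair (q 0) (diff P 0 \<cdot> proj1 (q 1)) (\<phi> 0 \<cdot> proj1 (q 1) \<oplus> \<ominus> (diff S 0 \<cdot> proj2 (q 1)))"
    using diff_M_pair[of 0 "proj1 (q 1)" "bip_obj (q 1)" "proj2 (q 1)"] q[of 1] Suc by simp
  finally show ?thesis
    using q[of 1] Suc q1 by (intro bexI[of _ "proj1 (q 1)"] bexI[of _ "proj2 (q 1)"]) simp_all
qed

end

end

section \<open>Admissibility of the composite sequence\<close>

context pre_d_exact_category
begin

text \<open>Pulling back \<open>P\<close> along \<open>P\<^sub>0 \<oplus> S\<^sub>0 \<rightarrow> P\<^sub>0\<close>, and then \<open>S\<close> along the difference of the two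
  resulting arrows to \<open>S\<^sub>0\<close>, gives an admissible epimorphism with the same sieve as the last
  arrow of the composite sequence.\<close>

lemma composite_seq_in_X:
  assumes P: "P \<in> X" and S: "S \<in> X" and d: "d = Suc (Suc m)"
    and b: "biprod b" "bip_obj b = trm P (Suc (Suc m))" "tgt C (proj2 b) = trm S (Suc m)"
    and PS: "trm P (Suc (Suc (Suc m))) = trm S (Suc (Suc m))"
    and g: "g \<in> arrs C" "src C g = trm S (Suc (Suc m))" "tgt C g = tgt C (proj1 b)"
    and g_mono: "\<And>x. x \<in> arrs C \<Longrightarrow> tgt C x = src C g \<Longrightarrow> g \<cdot> x = \<zero> (src C x) (tgt C g) \<Longrightarrow>
      x = \<zero> (src C x) (src C g)"
    and Pd: "diff P (Suc (Suc m)) = pair b (\<ominus> g) (diff S (Suc m))"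
    and \<phi>: "\<And>i. i \<le> Suc m \<Longrightarrow> \<phi> i \<in> hom_set C (trm P (Suc i)) (trm S i)"
    and \<phi>_diff: "\<And>i. i \<le> m \<Longrightarrow> \<phi> i \<cdot> diff P (Suc i) = diff S i \<cdot> \<phi> (Suc i)"
    and \<phi>_last: "\<phi> (Suc m) = proj2 b"
  shows "composite_seq m P S b g \<phi> \<in> X"
proof -
  let ?M = "composite_seq m P S b g \<phi>" and ?q = "biproduct C (trm P 0) (trm S 0)"
  note hyps = X_left[OF P] X_left[OF S] d b PS g g_mono Pd \<phi> \<phi>_diff \<phi>_last
  have M_left: "left_d_exact C d ?M"
    by (rule left_d_exact_composite_seq[where \<phi> = \<phi> and g = g, OF hyps])
  note P' = complexD[OF X_complex[OF P]] and S' = complexD[OF X_complex[OF S]]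
    and M' = complexD[OF left_d_exactD(1)[OF M_left]]
  have q: "biprod ?q" "tgt C (proj1 ?q) = trm P 0" "tgt C (proj2 ?q) = trm S 0"
    using biproduct_simps[of "trm P 0" "trm S 0"] P' S' by simp_all
  have M0: "trm ?M 0 = bip_obj ?q" by (simp add: composite_seq_def Let_def)
  have \<phi>0: "\<phi> 0 \<in> arrs C" "src C (\<phi> 0) = trm P 1" "tgt C (\<phi> 0) = trm S 0"
    "\<phi> 1 \<in> arrs C" "src C (\<phi> 1) = trm P 2" "tgt C (\<phi> 1) = trm S 1"
    using \<phi>[of 0] \<phi>[of 1] by (simp_all add: numeral_2_eq_2)
  obtain A k where A: "A \<in> X" "trm A 0 = src C (proj1 ?q)" "k \<in> hom_set C (trm A 1) (trm P 1)"
    "proj1 ?q \<cdot> diff A 0 = diff P 0 \<cdot> k"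
    and lift_A: "\<And>W x y. x \<in> hom_set C W (src C (proj1 ?q)) \<Longrightarrow> y \<in> hom_set C W (trm P 1) \<Longrightarrow>
       proj1 ?q \<cdot> x = diff P 0 \<cdot> y \<Longrightarrow>
       \<exists>w \<in> hom_set C W (trm A 1). \<exists>t \<in> hom_set C W (trm P 2).
         diff A 0 \<cdot> w = x \<and> k \<cdot> w = y \<oplus> diff P 1 \<cdot> t"
    by (rule pullback_exists[OF P, of "proj1 ?q"]) (use q in auto)
  note A' = complexD[OF X_complex[OF A(1)]]
  have A0: "diff A 0 \<in> arrs C" "src C (diff A 0) = trm A 1" "tgt C (diff A 0) = bip_obj ?q"
    "k \<in> arrs C" "src C k = trm A 1" "tgt C k = trm P 1"
    using A(2,3) A' q by simp_all
  \<comment> \<open>The two arrows from \<open>trm A 1\<close> to \<open>trm S 0\<close> need agree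
    only up to \<open>diff S 0\<close>; the second pullback enforces that on their
    difference.\<close>
  define \<psi> where "\<psi> = \<phi> 0 \<cdot> k \<oplus> \<ominus> (proj2 ?q \<cdot> diff A 0)"
  have \<psi>: "\<psi> \<in> arrs C" "src C \<psi> = trm A 1" "tgt C \<psi> = trm S 0"
    using A0 q \<phi>0 by (simp_all add: \<psi>_def)
  obtain B l where B: "B \<in> X" "trm B 0 = src C \<psi>" "l \<in> hom_set C (trm B 1) (trm S 1)"
    "\<psi> \<cdot> diff B 0 = diff S 0 \<cdot> l"
    and lift_B: "\<And>W x y. x \<in> hom_set C W (src C \<psi>) \<Longrightarrow> y \<in> hom_set C W (trm S 1) \<Longrightarrow>
       \<psi> \<cdot> x = diff S 0 \<cdot> y \<Longrightarrow>
       \<exists>w \<in> hom_set C W (trm B 1). \<exists>t \<in> hom_set C W (trm S 2).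
         diff B 0 \<cdot> w = x \<and> l \<cdot> w = y \<oplus> diff S 1 \<cdot> t"
    by (rule pullback_exists[OF S, of \<psi>]) (use \<psi> in auto)
  note B' = complexD[OF X_complex[OF B(1)]]
  have B0: "diff B 0 \<in> arrs C" "src C (diff B 0) = trm B 1" "tgt C (diff B 0) = trm A 1"
    "l \<in> arrs C" "src C l = trm B 1" "tgt C l = trm S 1"
    using B(2,3) B' \<psi> by simp_all
  have "admissible_epi X (diff A 0)" "admissible_epi X (diff B 0)"
    using A(1) B(1) by (auto simp: admissible_epi_def)
  \<comment> \<open>This is where (E1)op enters.\<close>
  then have "admissible_epi X (diff A 0 \<cdot> diff B 0)"
    using E1op A0 B0 unfolding axiom_E1op_def by simp
  then obtain V where V: "V \<in> X" "diff V 0 = diff A 0 \<cdot> diff B 0" by (auto simp: admissible_epi_def)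
  note V' = complexD[OF X_complex[OF V(1)]]
  have V0: "trm V 0 = bip_obj ?q" "trm V 1 = trm B 1"
    using V'(3,4)[of 0] V(2) A0 B0 by simp_all
  have "\<exists>a \<in> hom_set C (trm B 1) (trm ?M 1). diff ?M 0 \<cdot> a
      = pair ?q (diff P 0 \<cdot> (k \<cdot> diff B 0)) (\<phi> 0 \<cdot> (k \<cdot> diff B 0) \<oplus> \<ominus> (diff S 0 \<cdot> l))"
    by (rule composite_seq_lift[where \<phi> = \<phi> and g = g, OF hyps]) (use A0 B0 in simp_all)
  then obtain a where a: "a \<in> hom_set C (trm B 1) (trm ?M 1)" "diff ?M 0 \<cdot> a
      = pair ?q (diff P 0 \<cdot> (k \<cdot> diff B 0)) (\<phi> 0 \<cdot> (k \<cdot> diff B 0) \<oplus> \<ominus> (diff S 0 \<cdot> l))"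
    by blast
  \<comment> \<open>The two pullback squares identify the components of
    \<open>diff ?M 0 \<cdot> a\<close> with those of \<open>diff V 0\<close>.\<close>
  have "diff P 0 \<cdot> (k \<cdot> diff B 0) = proj1 ?q \<cdot> (diff A 0 \<cdot> diff B 0)"
    using cmp_reduce[OF A(4), of "diff B 0"] A0 B0 q P' by simp
  moreover have "\<phi> 0 \<cdot> (k \<cdot> diff B 0) \<oplus> \<ominus> (diff S 0 \<cdot> l) = proj2 ?q \<cdot> (diff A 0 \<cdot> diff B 0)"
    unfolding B(4)[symmetric] using A0 B0 q \<phi>0 by (simp add: \<psi>_def)
  ultimately have a_eq: "diff V 0 = diff ?M 0 \<cdot> a"
    unfolding a(2) V(2) using pair_eta[of ?q "diff A 0 \<cdot> diff B 0"] A0 B0 q by simp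
  obtain x y where x: "x \<in> hom_set C (trm ?M 1) (trm P 1)" and y: "y \<in> hom_set C (trm ?M 1) (trm S 1)"
    and M_eq: "diff ?M 0 = pair ?q (diff P 0 \<cdot> x) (\<phi> 0 \<cdot> x \<oplus> \<ominus> (diff S 0 \<cdot> y))"
    using composite_seq_diff_0[where \<phi> = \<phi> and g = g, OF hyps] by blast
  have xy: "x \<in> arrs C" "src C x = trm ?M 1" "tgt C x = trm P 1"
    "y \<in> arrs C" "src C y = trm ?M 1" "tgt C y = trm S 1" using x y by simp_all
  have projs: "proj1 ?q \<cdot> diff ?M 0 = diff P 0 \<cdot> x"
    "proj2 ?q \<cdot> diff ?M 0 = \<phi> 0 \<cdot> x \<oplus> \<ominus> (diff S 0 \<cdot> y)"
    unfolding M_eq using xy q \<phi>0 P' S' by simp_all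
  \<comment> \<open>Conversely, \<open>diff ?M 0\<close> is lifted first through \<open>A\<close>
    and then through \<open>B\<close>.\<close>
  have "\<exists>w \<in> hom_set C (trm ?M 1) (trm A 1). \<exists>t \<in> hom_set C (trm ?M 1) (trm P 2).
         diff A 0 \<cdot> w = diff ?M 0 \<and> k \<cdot> w = x \<oplus> diff P 1 \<cdot> t"
  proof (rule lift_A[OF _ x projs(1)])
    have "diff ?M 0 \<in> arrs C" "src C (diff ?M 0) = trm ?M 1" "tgt C (diff ?M 0) = trm ?M 0"
      using M'(2-4)[of 0] by simp_all
    then show "diff ?M 0 \<in> hom_set C (trm ?M 1) (src C (proj1 ?q))"
      unfolding M0 using q(1) by simp
  qed
  then obtain w t where w': "w \<in> hom_set C (trm ?M 1) (trm A 1)" and t': "t \<in> hom_set C (trm ?M 1) (trm P 2)"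
    and wt: "diff A 0 \<cdot> w = diff ?M 0" "k \<cdot> w = x \<oplus> diff P 1 \<cdot> t"
    by blast
  have w: "w \<in> arrs C" "src C w = trm ?M 1" "tgt C w = trm A 1"
    and t: "t \<in> arrs C" "src C t = trm ?M 1" "tgt C t = trm P 2"
    using w' t' by simp_all
  have P1: "diff P 1 \<in> arrs C" "src C (diff P 1) = trm P 2" "tgt C (diff P 1) = trm P 1"
    using P' d by (simp_all add: numeral_2_eq_2)
  have "\<phi> 0 \<cdot> (diff P 1 \<cdot> t) = (diff S 0 \<cdot> \<phi> 1) \<cdot> t"
    by (rule cmp_reduce) (use \<phi>_diff[of 0] P1 t \<phi>0 in simp_all)
  then have \<phi>t: "\<phi> 0 \<cdot> (diff P 1 \<cdot> t) = diff S 0 \<cdot> (\<phi> 1 \<cdot> t)" using \<phi>0 t S' by simp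
  \<comment> \<open>The first lift matches \<open>x\<close> only up to
    \<open>diff P 1 \<cdot> t\<close>. Since \<open>\<phi> 0\<close> turns this error into
    \<open>diff S 0 \<cdot> (\<phi> 1 \<cdot> t)\<close>, the second lift still exists, with
    \<open>y\<close> corrected by \<open>\<phi> 1 \<cdot> t\<close>.\<close>
  have "\<psi> \<cdot> w = \<phi> 0 \<cdot> (k \<cdot> w) \<oplus> \<ominus> (proj2 ?q \<cdot> (diff A 0 \<cdot> w))"
    using A0 q w \<phi>0 by (simp add: \<psi>_def)
  also have "\<dots> = \<phi> 0 \<cdot> x \<oplus> (diff S 0 \<cdot> (\<phi> 1 \<cdot> t) \<oplus> \<ominus> (\<phi> 0 \<cdot> x \<oplus> \<ominus> (diff S 0 \<cdot> y)))"
    unfolding wt projs using xy P1 t \<phi>0 S' \<phi>t by simp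
  also have "\<dots> = diff S 0 \<cdot> (\<phi> 1 \<cdot> t \<oplus> y)"
    using xy t \<phi>0 S' add_left_commute[of "diff S 0 \<cdot> (\<phi> 1 \<cdot> t)" "\<ominus> (\<phi> 0 \<cdot> x)" "diff S 0 \<cdot> y"] by simp
  finally have \<psi>w: "\<psi> \<cdot> w = diff S 0 \<cdot> (\<phi> 1 \<cdot> t \<oplus> y)" .
  have "\<exists>v \<in> hom_set C (trm ?M 1) (trm B 1). \<exists>t' \<in> hom_set C (trm ?M 1) (trm S 2).
         diff B 0 \<cdot> v = w \<and> l \<cdot> v = (\<phi> 1 \<cdot> t \<oplus> y) \<oplus> diff S 1 \<cdot> t'"
    by (rule lift_B[OF _ _ \<psi>w]) (use w \<psi> t xy \<phi>0 in simp_all)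
  then obtain v where v': "v \<in> hom_set C (trm ?M 1) (trm B 1)" and "diff B 0 \<cdot> v = w"
    by blast
  then have v: "v \<in> arrs C" "src C v = trm ?M 1" "tgt C v = trm B 1" "diff B 0 \<cdot> v = w"
    by simp_all
  have v_eq: "diff ?M 0 = diff V 0 \<cdot> v"
    unfolding V(2) wt(1)[symmetric] v(4)[symmetric] using v(1-3) A0 B0 by simp
  show ?thesis
    by (rule in_X_if_epis_factor[OF V(1) M_left _ _ v_eq _ a_eq]) (use v(1-3) a(1) V0 M0 in simp_all)
qed

text \<open>The first arrow of \<open>composite_seq\<close> is the composite by construction, so it
  remains to produce \<open>P\<close> and \<open>\<phi>\<close> satisfying the hypotheses of
  \<open>composite_seq_in_X\<close>.\<close>

lemma admissible_mono_comp:
  assumes S: "S \<in> X" and T: "T \<in> X" and ST: "trm S d = trm T (Suc d)"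
  shows "admissible_mono d X (diff T d \<cdot> diff S d)"
proof -
  obtain m where d: "d = Suc (Suc m)" using le_Suc_ex[OF two_le_d] by auto
  note S' = complexD[OF X_complex[OF S]] and T' = complexD[OF X_complex[OF T]]
  obtain Z h where Z: "Z \<in> X" and h: "complex_morphism C (Suc d) T Z h" "h 0 = ident C (trm T 0)"
    "h (Suc d) = diff S (Suc m)"
    and cone: "right_d_exact C d (mapping_cone C d (drop_term0 T) (drop_term0 Z) (\<lambda>i. h (Suc i)))"
    by (rule pushout_exists[OF T, of "diff S (Suc m)"]) (use S' ST d in auto)
  define P where "P = mapping_cone C d (drop_term0 T) (drop_term0 Z) (\<lambda>i. h (Suc i))"
  note cone = cone[folded P_def]
  have P: "P \<in> X" by (rule cone_in_X[OF T Z h(1,2) P_def right_d_exactD(1)[OF cone]])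
  note P' = complexD[OF X_complex[OF P]]
  have drop: "complex_morphism C d (drop_term0 T) (drop_term0 Z) (\<lambda>i. h (Suc i))"
    using h(1) by (auto simp: complex_morphism_def complex_def drop_term0_def)
  have drop_simps: "trm (drop_term0 U) i = trm U (Suc i)" "diff (drop_term0 U) i = diff U (Suc i)" for U i
    by (simp_all add: drop_term0_def)
  define b where "b = cone_biprod (drop_term0 T) (drop_term0 Z) (Suc m)"
  have Zd: "trm Z (Suc d) = trm S (Suc m)"
    using complex_morphismD(5)[OF h(1), of "Suc d"] h(3) S' d by simp
  have b: "biprod b" "tgt C (proj1 b) = trm T d" "tgt C (proj2 b) = trm S (Suc m)"
    using cone_biprod[OF drop, of "Suc m"] d Zd by (simp_all add: b_def drop_simps)
  have Pb: "bip_obj b = trm P (Suc (Suc m))"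
    using mapping_cone_simps(3)[of "Suc m" d] d by (simp add: P_def b_def)
  have PS: "trm P (Suc (Suc (Suc m))) = trm S (Suc (Suc m))"
    using mapping_cone_simps(2)[of d] d ST by (simp add: P_def drop_simps)
  have Pd: "diff P (Suc (Suc m)) = pair b (\<ominus> (diff T d)) (diff S (Suc m))"
    using mapping_cone_simps(5)[OF d] d h(3) by (simp add: P_def b_def drop_simps)
  obtain N where N: "N \<in> objs C" using zero_object_exists by (auto simp: zero_object_def)
  \<comment> \<open>A map of degree -1 becomes an ordinary morphism into \<open>U\<close>, which is
    \<open>S\<close> shifted by one index. The term \<open>N\<close> with its zero arrow fills index
    0, and the leftmost term of \<open>S\<close> falls outside the range.\<close>
  define U where "U = \<lparr>trm = case_nat N (trm S), diff = case_nat (\<zero> (trm S 0) N) (diff S)\<rparr>"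
  have U: "trm U 0 = N" "trm U (Suc i) = trm S i" "diff U 0 = \<zero> (trm S 0) N" "diff U (Suc i) = diff S i" for i
    by (simp_all add: U_def)
  have "complex C (Suc d) U"
    unfolding complex_def
  proof (intro conjI allI impI)
    show "trm U i \<in> objs C" if "i \<le> Suc d" for i
      using that S' N by (cases i) (simp_all add: U)
    show "diff U i \<in> hom_set C (trm U (Suc i)) (trm U i)" if "i < Suc d" for i
      using that S' N by (cases i) (simp_all add: U)
    show "diff U i \<cdot> diff U (Suc i) = \<zero> (trm U (Suc (Suc i))) (trm U i)" if "Suc i < Suc d" for i
      using that S' N by (cases i) (simp_all add: U)
  qed
  \<comment> \<open>The identity of \<open>trm S d\<close> and the second projection form the
    leftmost square, by the formula \<open>Pd\<close>; right exactness of \<open>P\<close> extends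
    them to the right.\<close>
  then obtain f where f: "\<And>i. i \<le> Suc d \<Longrightarrow> f i \<in> hom_set C (trm P i) (trm U i)"
    "\<And>i. i \<le> d \<Longrightarrow> f i \<cdot> diff P i = diff U i \<cdot> f (Suc i)" "f d = proj2 b"
    by (rule extend_complex_morphism_right[OF X_right[OF P], of _ "ident C (trm S d)" "proj2 b"])
      (use b Pb PS Pd S' T' d U ST in auto)
  have "composite_seq m P S b (diff T d) (\<lambda>i. f (Suc i)) \<in> X"
  proof (rule composite_seq_in_X[OF P S d b(1) Pb b(3) PS _ _ _ _ Pd])
    show "x = \<zero> (src C x) (src C (diff T d))"
      if "x \<in> arrs C" "tgt C x = src C (diff T d)" "diff T d \<cdot> x = \<zero> (src C x) (tgt C (diff T d))" for x
    proof -
      have "src C (diff T d) = trm T (Suc d)" "tgt C (diff T d) = trm T d" using T' by simp_all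
      then show ?thesis using left_d_exactD(2)[OF X_left[OF T] that(1)] that(2,3) by simp
    qed
    show "f (Suc i) \<in> hom_set C (trm P (Suc i)) (trm S i)" if "i \<le> Suc m" for i
      using f(1)[of "Suc i"] that d by (simp add: U)
    show "f (Suc i) \<cdot> diff P (Suc i) = diff S i \<cdot> f (Suc (Suc i))" if "i \<le> m" for i
      using f(2)[of "Suc i"] that d by (simp add: U)
    show "f (Suc (Suc m)) = proj2 b" using f(3) d by simp
  qed (use T' ST d b in simp_all)
  moreover have "diff (composite_seq m P S b (diff T d) (\<lambda>i. f (Suc i))) d = diff T d \<cdot> diff S d"
    unfolding d by (simp add: composite_seq_def Let_def)
  ultimately show ?thesis unfolding admissible_mono_def by metis
qed

end

theorem corollary5p5:
  fixes C :: "('o, 'm) cat_data" and d :: nat and X :: "('o, 'm) sequence set"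
  assumes "d \<ge> 2"
    and "additive_category C"
    and "\<forall>S \<in> X. d_exact C d S"
    and "closed_under_weak_isomorphisms C d X"
    and "axiom_E0 C X"
    and "axiom_E1op C X"
    and "axiom_E2 C d X"
    and "axiom_E2op C d X"
  shows "axiom_E1 C d X"
proof -
  interpret additive_category C by fact
  interpret pre_d_exact_category C d X
    by unfold_locales (use assms in auto)
  show ?thesis
    unfolding axiom_E1_def
  proof (intro allI impI)
    fix f g assume "admissible_mono d X f" "admissible_mono d X g" and fg: "tgt C f = src C g"
    then obtain S T where S: "S \<in> X" "f = diff S d" and T: "T \<in> X" "g = diff T d"
      by (auto simp: admissible_mono_def)
    have "trm S d = trm T (Suc d)"
      using fg complexD(4)[OF X_complex[OF S(1)], of d] complexD(3)[OF X_complex[OF T(1)], of d]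
      by (simp add: S(2) T(2))
    then show "admissible_mono d X (g \<cdot>\<^bsub>C\<^esub> f)"
      unfolding S(2) T(2) by (rule admissible_mono_comp[OF S(1) T(1)])
  qed
qed

end
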